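(* Let $G$ be a finite group, $p$ a prime divisor of $|G|$, and $S$ a Sylow $p$-subgroup of $G$. Suppose that $S$ has a subgroup $D$ with $1\le D<S$ (so $D$ is a proper, possibly trivial, subgroup) such that all subgroups of $S$ of order $|D|$ or $p|D|$ are abelian and weakly $S\Phi$-supplemented in $G$. If $S$ is a non-abelian $2$-group and $|D|=1$, suppose additionally that every cyclic subgroup of $G$ of order $4$ is weakly $S\Phi$-supplemented in $G$. Then $\mathcal{F}_S(G)$ is supersolvable.
   Context: A subgroup of $G$ is $s$-permutable in $G$ if it permutes with every Sylow subgroup of $G$. For $H\le G$, $H_{sG}$ denotes the subgroup generated by all subgroups of $H$ that are $s$-permutable in $G$, and $\Phi(H)$ is the Frattini subgroup of $H$. A subgroup $H$ of $G$ is weakly $S\Phi$-supplemented in $G$ if there is a subgroup $K$ of $G$ with $G=KH$ and $K\cap H\le\Phi(H)H_{sG}$. $\mathcal{F}_S(G)$ is the (saturated) fusion system on $S\in\mathrm{Syl}_p(G)$ whose objects are the subgroups of $S$ and whose morphisms $P\to Q$ are the maps $x\mapsto x^g$ with $g\in G$, $P^g\le Q$. A saturated fusion system $\mathcal{F}$ on a $p$-group $S$ is supersolvable if there is a series $1=S_0\le S_1\le\cdots\le S_n=S$ of strongly $\mathcal{F}$-closed subgroups of $S$ with $S_{i+1}/S_i$ cyclic for $0\le i\le n-1$. (A subgroup $T\le S$ is strongly $\mathcal{F}$-closed if for every $P\le T$ and every $\phi\in\mathrm{Hom}_{\mathcal{F}}(P,S)$ one has $P^{\phi}\le T$.) *)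

theory Defs
  imports "HOL-Algebra.Algebra"
begin

definition sylow_subgroup :: "('a, 'b) monoid_scheme \<Rightarrow> nat \<Rightarrow> 'a set \<Rightarrow> bool" where
  "sylow_subgroup G p P \<longleftrightarrow> subgroup P G \<and> card P = p ^ multiplicity p (Coset.order G)"

definition s_permutable :: "('a, 'b) monoid_scheme \<Rightarrow> 'a set \<Rightarrow> bool" where
  "s_permutable G H \<longleftrightarrow> subgroup H G \<and>
     (\<forall>q Q. Factorial_Ring.prime q \<longrightarrow> sylow_subgroup G q Q \<longrightarrow> H <#>\<^bsub>G\<^esub> Q = Q <#>\<^bsub>G\<^esub> H)"

text \<open>The subgroup \<open>H\<^sub>s\<^sub>G\<close>.\<close>

definition s_core :: "('a, 'b) monoid_scheme \<Rightarrow> 'a set \<Rightarrow> 'a set" where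
  "s_core G H = generate G (\<Union>{L. L \<subseteq> H \<and> s_permutable G L})"

definition maximal_subgroup :: "('a, 'b) monoid_scheme \<Rightarrow> 'a set \<Rightarrow> bool" where
  "maximal_subgroup G M \<longleftrightarrow> subgroup M G \<and> M \<noteq> carrier G \<and>
     (\<forall>L. subgroup L G \<longrightarrow> M \<subseteq> L \<longrightarrow> L = M \<or> L = carrier G)"

text \<open>Intersecting with the carrier makes the Frattini subgroup of a group without maximal
  subgroups (in the finite case, the trivial group) the whole group.\<close>

definition frattini :: "('a, 'b) monoid_scheme \<Rightarrow> 'a set" where
  "frattini G = carrier G \<inter> \<Inter>{M. maximal_subgroup G M}"

definition weakly_SPhi_supplemented :: "('a, 'b) monoid_scheme \<Rightarrow> 'a set \<Rightarrow> bool" where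
  "weakly_SPhi_supplemented G H \<longleftrightarrow> subgroup H G \<and>
     (\<exists>K. subgroup K G \<and> carrier G = K <#>\<^bsub>G\<^esub> H \<and>
          K \<inter> H \<subseteq> frattini (G\<lparr>carrier := H\<rparr>) <#>\<^bsub>G\<^esub> s_core G H)"

text \<open>A fusion system is given by its sets of morphisms, indexed by source and target.
  Morphisms are extensional functions, so that maps agreeing on their source are identified;
  conjugation is on the right, \<open>x\<^sup>g = g\<^sup>-\<^sup>1 x g\<close>.\<close>

type_synonym 'a fusion_homs = "'a set \<Rightarrow> 'a set \<Rightarrow> ('a \<Rightarrow> 'a) set"

definition fusion_system :: "('a, 'b) monoid_scheme \<Rightarrow> 'a set \<Rightarrow> 'a fusion_homs" where
  "fusion_system G S P Q =
     {\<phi>. subgroup P G \<and> P \<subseteq> S \<and> subgroup Q G \<and> Q \<subseteq> S \<and>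
         (\<exists>g\<in>carrier G. \<phi> = (\<lambda>x\<in>P. inv\<^bsub>G\<^esub> g \<otimes>\<^bsub>G\<^esub> x \<otimes>\<^bsub>G\<^esub> g) \<and> \<phi> ` P \<subseteq> Q)}"

definition strongly_closed :: "('a, 'b) monoid_scheme \<Rightarrow> 'a fusion_homs \<Rightarrow> 'a set \<Rightarrow> bool" where
  "strongly_closed S F T \<longleftrightarrow> subgroup T S \<and>
     (\<forall>P. subgroup P S \<longrightarrow> P \<subseteq> T \<longrightarrow> (\<forall>\<phi>\<in>F P (carrier S). \<phi> ` P \<subseteq> T))"

text \<open>The condition below is meant for a saturated fusion system \<open>F\<close> on the \<open>p\<close>-group \<open>S\<close>.
  Since \<open>F\<close> contains the conjugations by elements of \<open>S\<close>, strongly closed subgroups are normal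
  in \<open>S\<close>, so the factors of the series are quotient groups.\<close>

definition supersolvable_fusion :: "('a, 'b) monoid_scheme \<Rightarrow> 'a fusion_homs \<Rightarrow> bool" where
  "supersolvable_fusion S F \<longleftrightarrow>
     (\<exists>(n::nat) T. T 0 = {\<one>\<^bsub>S\<^esub>} \<and> T n = carrier S \<and>
        (\<forall>i\<le>n. strongly_closed S F (T i)) \<and>
        (\<forall>i<n. T i \<subseteq> T (Suc i) \<and> cyclic_group (S\<lparr>carrier := T (Suc i)\<rparr> Mod T i)))"

end

theory Submission
  imports Defs "HOL-Number_Theory.Residue_Primitive_Roots"
begin

text \<open>
  An s-permutable \<open>p\<close>-subgroup lies in every Sylow \<open>p\<close>-subgroup and is normalised by every Sylow
  subgroup for another prime. Hence if \<open>H\<close> is weakly supplemented by \<open>K\<close> and \<open>K = G\<close>, then \<open>H\<close> is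
  normalised by \<open>O\<^sup>p(G)\<close>; if \<open>K < G\<close> and \<open>H \<le> P\<close> with \<open>P\<close> a normal \<open>p\<close>-subgroup, then \<open>K\<close> cuts out
  proper \<open>G\<close>-invariant subgroups of \<open>P\<close>. Playing these alternatives against each other shows that a
  normal \<open>p\<close>-subgroup \<open>P\<close> with \<open>|P| > |D|\<close> satisfying the hypothesis has a \<open>G\<close>-invariant series with
  factors of order \<open>p\<close>: for \<open>D = 1\<close> either some minimal subgroup yields an invariant subgroup of index
  \<open>p\<close>, or all of them are normalised by \<open>O\<^sup>p(G)\<close>, and then the \<open>p'\<close>-elements fixing one of them centralise
  \<open>P\<close>; larger \<open>D\<close> are reduced to this case by factoring out minimal normal subgroups.

  To pass from normal subgroups to fusion, let \<open>P < S\<close> contain its centraliser in \<open>S\<close>. Subgroups of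
  order \<open>p|D|\<close> being abelian forces \<open>|P| > |D|\<close>, so the series exists for \<open>P\<close> in \<open>N\<^sub>G(P)\<close>, and thus
  \<open>N\<^sub>G(P)\<close> acts on \<open>P\<close> with a normal Sylow \<open>p\<close>-subgroup. Descending induction, as in Alperin's theorem,
  gives that \<open>N\<^sub>G(S)\<close> controls fusion in \<open>S\<close>; the series of \<open>S\<close> in \<open>N\<^sub>G(S)\<close> is then strongly closed.
\<close>

section \<open>Conjugation in finite groups\<close>

text \<open>That a subgroup contains \<open>O^p(G)\<close> is always expressed by powers: all
  \<open>p ^ k\<close>-th powers of elements of \<open>G\<close> lie in it, for some
  \<open>k\<close>. Such a statement passes to subgroups and quotients, and a subgroup that also
  contains a Sylow \<open>p\<close>-subgroup must be the whole group. The reduction of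
  \<open>D\<close> meets an obstacle at the prime 2. Dividing by a normal subgroup of order
  \<open>p ^ e\<close> turns the exponent \<open>d\<close> of \<open>|D|\<close> into
  \<open>d - e\<close>. An automorphism of odd order can fix all involutions of a 2-group without
  being trivial, as for the quaternion group, so elements of order 4 must be controlled too. With
  exponent 0 the subgroups of order \<open>|D|\<close> and \<open>p|D|\<close> say nothing about
  them, with exponent 1 the order \<open>p|D|\<close> is 4. Hence the induction bottoms out at
  \<open>d = 1\<close>, and a quotient with exponent 0 is used only to find one normal subgroup of
  order \<open>p\<close>. In the fusion argument nothing is known about subgroups of
  \<open>S\<close> that do not contain their centraliser in \<open>S\<close>; there the centraliser
  itself provides the larger subgroup for the induction.\<close>

definition cj :: "('a, 'b) monoid_scheme \<Rightarrow> 'a \<Rightarrow> 'a \<Rightarrow> 'a" where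
  "cj G g x = inv\<^bsub>G\<^esub> g \<otimes>\<^bsub>G\<^esub> x \<otimes>\<^bsub>G\<^esub> g"

context group
begin

lemma cj_closed [simp, intro]: "\<lbrakk>g \<in> carrier G; x \<in> carrier G\<rbrakk> \<Longrightarrow> cj G g x \<in> carrier G"
  by (simp add: cj_def)

lemma cj_mult: "\<lbrakk>g \<in> carrier G; x \<in> carrier G; y \<in> carrier G\<rbrakk> \<Longrightarrow> cj G g (x \<otimes> y) = cj G g x \<otimes> cj G g y"
  by (simp add: cj_def m_assoc) (simp flip: m_assoc)

lemma cj_cj: "\<lbrakk>g \<in> carrier G; h \<in> carrier G; x \<in> carrier G\<rbrakk> \<Longrightarrow> cj G h (cj G g x) = cj G (g \<otimes> h) x"
  by (simp add: cj_def m_assoc inv_mult_group)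

lemma cj_one_left [simp]: "x \<in> carrier G \<Longrightarrow> cj G \<one> x = x"
  by (simp add: cj_def)

lemma cj_one [simp]: "g \<in> carrier G \<Longrightarrow> cj G g \<one> = \<one>"
  by (simp add: cj_def)

lemma cj_pow: "\<lbrakk>g \<in> carrier G; x \<in> carrier G\<rbrakk> \<Longrightarrow> cj G g (x [^] (n::nat)) = cj G g x [^] n"
  by (induction n) (auto simp: cj_mult)

lemma cj_inv_cj [simp]: "\<lbrakk>g \<in> carrier G; x \<in> carrier G\<rbrakk> \<Longrightarrow> cj G (inv g) (cj G g x) = x"
  by (simp add: cj_cj)

lemma cj_cj_inv [simp]: "\<lbrakk>g \<in> carrier G; x \<in> carrier G\<rbrakk> \<Longrightarrow> cj G g (cj G (inv g) x) = x"
  by (simp add: cj_cj)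

lemma cj_inj: "g \<in> carrier G \<Longrightarrow> inj_on (cj G g) (carrier G)"
  by (rule inj_on_inverseI[of _ "cj G (inv g)"]) simp

lemma cj_fix_iff: "\<lbrakk>g \<in> carrier G; x \<in> carrier G\<rbrakk> \<Longrightarrow> cj G g x = x \<longleftrightarrow> x \<otimes> g = g \<otimes> x"
  using inv_solve_left'[of x g "x \<otimes> g"] by (simp add: cj_def m_assoc)

lemma cj_eq_one_iff [simp]: "\<lbrakk>g \<in> carrier G; x \<in> carrier G\<rbrakk> \<Longrightarrow> cj G g x = \<one> \<longleftrightarrow> x = \<one>"
  using cj_inv_cj[of g x] by (metis cj_one inv_closed)

lemma cj_sub: "subgroup L G \<Longrightarrow> g \<in> L \<Longrightarrow> cj (G\<lparr>carrier := L\<rparr>) g x = cj G g x"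
  by (simp add: cj_def)

lemma pow_mem: "subgroup H G \<Longrightarrow> x \<in> H \<Longrightarrow> x [^] (n::nat) \<in> H"
  by (induction n) (auto simp: subgroup.one_closed subgroup.m_closed)

lemma cj_mem: "subgroup H G \<Longrightarrow> x \<in> H \<Longrightarrow> g \<in> H \<Longrightarrow> cj G g x \<in> H"
  by (simp add: cj_def subgroup.m_closed subgroup.m_inv_closed)

text \<open>By Bezout, \<open>x\<close> is a product of powers of \<open>x [^] m\<close> and
  \<open>x [^] n\<close>. This does the work of splitting an element into its \<open>p\<close>-part
  and its \<open>p'\<close>-part.\<close>

lemma pow_coprime_mem:
  assumes "subgroup H G" "x \<in> carrier G" "x [^] (m::nat) \<in> H" "x [^] (n::nat) \<in> H" "coprime m n"
  shows "x \<in> H"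
proof -
  obtain a b where ab: "a * int m + b * int n = 1"
    using assms(5) by (metis bezout_int coprime_imp_gcd_eq_1 coprime_int_iff)
  have "x = x [^] (1::int)" using assms(2) by (simp add: int_pow_1)
  also have "\<dots> = x [^] (int m * a) \<otimes> x [^] (int n * b)"
    using assms(2) ab by (metis int_pow_mult mult.commute)
  also have "\<dots> = (x [^] m) [^] a \<otimes> (x [^] n) [^] b"
    using assms(2) by (metis int_pow_pow int_pow_int)
  also have "\<dots> \<in> H" using assms subgroup_int_pow_closed subgroup.m_closed by metis
  finally show ?thesis .
qed

lemma pow_coprime_one:
  assumes "x \<in> carrier G" "x [^] (m::nat) = \<one>" "x [^] (n::nat) = \<one>" "coprime m n"
  shows "x = \<one>"
  using pow_coprime_mem[OF triv_subgroup assms(1), of m n] assms by simp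

end

locale fin_group = group G for G (structure) + assumes fin: "finite (carrier G)"
begin

lemma fin_sub: "subgroup H G \<Longrightarrow> finite H"
  using fin finite_subset subgroup.subset by metis

lemma sub_fin_group: "subgroup L G \<Longrightarrow> fin_group (G\<lparr>carrier := L\<rparr>)"
  using fin_sub subgroup_imp_group by (simp add: fin_group_def fin_group_axioms_def)

lemma sub_sub: "\<lbrakk>subgroup L G; subgroup H G; H \<subseteq> L\<rbrakk> \<Longrightarrow> subgroup H (G\<lparr>carrier := L\<rparr>)"
  using subgroup_incl by blast

lemma pow_order_sub:
  assumes "subgroup H G" "x \<in> H" shows "x [^] card H = \<one>"
proof -
  interpret H: group "G\<lparr>carrier := H\<rparr>" using assms by (simp add: subgroup_imp_group)
  have "x [^]\<^bsub>G\<lparr>carrier := H\<rparr>\<^esub> Coset.order (G\<lparr>carrier := H\<rparr>) = \<one>"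
    using H.pow_order_eq_1[of x] assms by simp
  thus ?thesis by (simp add: Coset.order_def flip: nat_pow_consistent)
qed

text \<open>In a finite group the inverse of an element is one of its powers, so closure under
  products suffices.\<close>

lemma fin_subgroupI:
  assumes "H \<subseteq> carrier G" "\<one> \<in> H" "\<And>x y. x \<in> H \<Longrightarrow> y \<in> H \<Longrightarrow> x \<otimes> y \<in> H"
  shows "subgroup H G"
proof (rule subgroupI)
  fix x assume x: "x \<in> H"
  have pw: "x [^] (n::nat) \<in> H" for n by (induction n) (use assms x in auto)
  have "Coset.order G > 0" using fin order_gt_0_iff_finite by blast
  then obtain n where n: "Coset.order G = Suc n" using gr0_conv_Suc by blast
  have "x [^] n \<otimes> x = \<one>" using pow_order_eq_1[of x] n x assms(1) by (metis nat_pow_Suc subsetD)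
  hence "inv x = x [^] n" using x assms(1) by (metis inv_equality nat_pow_closed subsetD)
  thus "inv x \<in> H" using pw by simp
qed (use assms in auto)

lemma card_sub_pos: "subgroup H G \<Longrightarrow> card H > 0"
  using fin subgroup.finite_imp_card_positive by blast

lemma card_dvd: "\<lbrakk>subgroup A G; subgroup B G; A \<subseteq> B\<rbrakk> \<Longrightarrow> card A dvd card B"
proof -
  assume a: "subgroup A G" "subgroup B G" "A \<subseteq> B"
  interpret B: group "G\<lparr>carrier := B\<rparr>" using a by (simp add: subgroup_imp_group)
  have "subgroup A (G\<lparr>carrier := B\<rparr>)" using a sub_sub by blast
  from B.lagrange[OF this] show ?thesis by (simp add: Coset.order_def) (metis dvd_triv_right)
qed

lemma card_dvd_order: "subgroup A G \<Longrightarrow> card A dvd Coset.order G"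
  using card_dvd[OF _ subgroup_self] subgroup.subset by (auto simp: Coset.order_def)

lemma sub_eq: "\<lbrakk>subgroup B G; A \<subseteq> B; card B \<le> card A\<rbrakk> \<Longrightarrow> A = B"
  using card_seteq fin_sub by blast

lemma card_proper: "\<lbrakk>subgroup B G; A \<subset> B\<rbrakk> \<Longrightarrow> card A < card B"
  using fin_sub psubset_card_mono by blast

lemma card_one_iff: "subgroup A G \<Longrightarrow> card A = 1 \<longleftrightarrow> A = {\<one>}"
  using subgroup.one_closed by (metis card_1_singletonE is_singletonI is_singleton_altdef singletonD)

end

lemma (in fin_group) subgroup_centI:
  assumes P: "subgroup P G" and C: "C \<subseteq> carrier G"
  shows "subgroup {x\<in>P. \<forall>c\<in>C. x \<otimes> c = c \<otimes> x} G"
proof (rule fin_subgroupI)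
  show "{x\<in>P. \<forall>c\<in>C. x \<otimes> c = c \<otimes> x} \<subseteq> carrier G" using P subgroup.subset by blast
  show "\<one> \<in> {x\<in>P. \<forall>c\<in>C. x \<otimes> c = c \<otimes> x}"
    using C subgroup.one_closed[OF P] by (auto simp: subset_iff)
next
  fix x y assume x: "x \<in> {x\<in>P. \<forall>c\<in>C. x \<otimes> c = c \<otimes> x}" and y: "y \<in> {x\<in>P. \<forall>c\<in>C. x \<otimes> c = c \<otimes> x}"
  have xy: "x \<in> carrier G" "y \<in> carrier G" using x y subgroup.mem_carrier[OF P] by auto
  have "x \<otimes> y \<otimes> c = c \<otimes> (x \<otimes> y)" if "c \<in> C" for c
  proof -
    have c: "c \<in> carrier G" "x \<otimes> c = c \<otimes> x" "y \<otimes> c = c \<otimes> y" using that C x y by auto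
    have "x \<otimes> y \<otimes> c = x \<otimes> (c \<otimes> y)" using c xy by (simp add: m_assoc)
    also have "\<dots> = c \<otimes> x \<otimes> y" using c xy by (simp flip: m_assoc)
    finally show ?thesis using c xy by (simp add: m_assoc)
  qed
  thus "x \<otimes> y \<in> {x\<in>P. \<forall>c\<in>C. x \<otimes> c = c \<otimes> x}" using x y subgroup.m_closed[OF P] by simp
qed

section \<open>Actions of p-groups\<close>

lemma (in group) group_actionI:
  assumes act: "\<And>g x. g \<in> carrier G \<Longrightarrow> x \<in> E \<Longrightarrow> act g x \<in> E"
    and one: "\<And>x. x \<in> E \<Longrightarrow> act \<one> x = x"
    and mult: "\<And>g h x. g \<in> carrier G \<Longrightarrow> h \<in> carrier G \<Longrightarrow> x \<in> E \<Longrightarrow> act (g \<otimes> h) x = act g (act h x)"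
  shows "group_action G E (\<lambda>g. \<lambda>x\<in>E. act g x)"
proof -
  have "bij_betw (act g) E E" if g: "g \<in> carrier G" for g
  proof (rule bij_betwI)
    show "act (inv g) (act g x) = x" "act g (act (inv g) x) = x" if "x \<in> E" for x
      using that g one[of x] mult[of g "inv g" x] mult[of "inv g" g x] by simp_all
  qed (use act g in auto)
  hence "(\<lambda>x\<in>E. act g x) \<in> carrier (BijGroup E)" if "g \<in> carrier G" for g
    using that by (auto simp: BijGroup_def Bij_def bij_betw_def inj_on_def)
  moreover have "(\<lambda>x\<in>E. act (g \<otimes> h) x) = (\<lambda>x\<in>E. act g x) \<otimes>\<^bsub>BijGroup E\<^esub> (\<lambda>x\<in>E. act h x)"
    if "g \<in> carrier G" "h \<in> carrier G" for g h
  proof -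
    have "compose E (\<lambda>x\<in>E. act g x) (\<lambda>x\<in>E. act h x) = (\<lambda>x\<in>E. act (g \<otimes> h) x)"
      using that act mult by (auto simp: compose_def fun_eq_iff)
    thus ?thesis using that calculation by (simp add: BijGroup_def)
  qed
  ultimately show ?thesis
    unfolding group_action_def group_hom_def group_hom_axioms_def
    using group_BijGroup is_group by (auto intro!: homI)
qed

text \<open>The moved points are the union of the orbits of size other than 1. Each such size
  divides a power of \<open>p\<close>, so it is itself divisible by \<open>p\<close>.\<close>

lemma (in group_action) prime_dvd_card_moved:
  assumes "Factorial_Ring.prime p" "Coset.order G = p ^ a" "finite E"
  shows "p dvd card {x\<in>E. \<exists>g\<in>carrier G. \<phi> g x \<noteq> x}"
proof -
  define C where "C = {\<O> \<in> orbits G E \<phi>. card \<O> \<noteq> 1}"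
  have part: "partition E (orbits G E \<phi>)" by (rule orbit_partition)
  have fixed: "(\<forall>g\<in>carrier G. \<phi> g x = x) \<longleftrightarrow> card (orbit G \<phi> x) = 1" if "x \<in> E" for x
  proof
    assume "\<forall>g\<in>carrier G. \<phi> g x = x"
    hence "orbit G \<phi> x = {x}" using that orbit_refl[of x] by (auto simp: orbit_def)
    thus "card (orbit G \<phi> x) = 1" by simp
  next
    assume "card (orbit G \<phi> x) = 1"
    moreover have "x \<in> orbit G \<phi> x" using that by (rule orbit_refl)
    ultimately have "orbit G \<phi> x = {x}" by (metis card_1_singletonE singletonD)
    thus "\<forall>g\<in>carrier G. \<phi> g x = x" by (auto simp: orbit_def)
  qed
  have sub: "orbit G \<phi> x \<subseteq> E" if "x \<in> E" for x
    using that element_image by (auto simp: orbit_def)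
  have same: "orbit G \<phi> y = orbit G \<phi> x" if "x \<in> E" "y \<in> orbit G \<phi> x" for x y
  proof -
    have "orbit G \<phi> x \<in> orbits G E \<phi>" "orbit G \<phi> y \<in> orbits G E \<phi>" "y \<in> orbit G \<phi> y" "y \<in> E"
      using that sub[of x] orbit_refl[of y] by (auto simp: orbits_def)
    thus ?thesis using part that(2) unfolding partition_def by blast
  qed
  have Un: "{x\<in>E. \<exists>g\<in>carrier G. \<phi> g x \<noteq> x} = \<Union>C"
  proof (rule subset_antisym; rule subsetI)
    fix x assume "x \<in> {x\<in>E. \<exists>g\<in>carrier G. \<phi> g x \<noteq> x}"
    thus "x \<in> \<Union>C" using fixed[of x] orbit_refl[of x] by (auto simp: C_def orbits_def)
  next
    fix y assume "y \<in> \<Union>C"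
    then obtain x where x: "x \<in> E" "y \<in> orbit G \<phi> x" "card (orbit G \<phi> x) \<noteq> 1" by (auto simp: C_def orbits_def)
    thus "y \<in> {x\<in>E. \<exists>g\<in>carrier G. \<phi> g x \<noteq> x}" using fixed[of y] same[of x y] sub[of x] by auto
  qed
  have "p dvd card (\<Union>C)"
  proof (rule dvd_partition)
    show "finite (\<Union>C)" using Un assms(3) by (metis (no_types, lifting) finite_subset mem_Collect_eq subsetI)
    show "\<forall>c\<in>C. p dvd card c"
    proof
      fix c assume "c \<in> C"
      then obtain x where x: "x \<in> E" "c = orbit G \<phi> x" "card c \<noteq> 1" by (auto simp: C_def orbits_def)
      hence "card c dvd p ^ a" using orbit_stabilizer_theorem[of x] assms(2) by (metis dvd_triv_left)
      then obtain i where "card c = p ^ i" using assms(1) divides_primepow_nat by blast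
      thus "p dvd card c" using x(3) by (cases i) auto
    qed
    show "\<forall>c1\<in>C. \<forall>c2\<in>C. c1 \<noteq> c2 \<longrightarrow> c1 \<inter> c2 = {}"
      using part unfolding C_def partition_def by blast
  qed
  thus ?thesis using Un by simp
qed

context fin_group
begin

lemma pgroup_moved:
  assumes "subgroup R G" "card R = p ^ a" "Factorial_Ring.prime p" "finite E"
    and act: "\<And>g x. g \<in> R \<Longrightarrow> x \<in> E \<Longrightarrow> act g x \<in> E"
    and one: "\<And>x. x \<in> E \<Longrightarrow> act \<one> x = x"
    and mult: "\<And>g h x. g \<in> R \<Longrightarrow> h \<in> R \<Longrightarrow> x \<in> E \<Longrightarrow> act (g \<otimes> h) x = act g (act h x)"
  shows "p dvd card {x\<in>E. \<exists>g\<in>R. act g x \<noteq> x}"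
proof -
  interpret R: group "G\<lparr>carrier := R\<rparr>" using assms by (simp add: subgroup_imp_group)
  interpret group_action "G\<lparr>carrier := R\<rparr>" E "\<lambda>g. \<lambda>x\<in>E. act g x"
    by (rule R.group_actionI) (use assms in auto)
  have "p dvd card {x\<in>E. \<exists>g\<in>carrier (G\<lparr>carrier := R\<rparr>). (\<lambda>x\<in>E. act g x) x \<noteq> x}"
    by (rule prime_dvd_card_moved) (use assms in \<open>auto simp: Coset.order_def\<close>)
  also have "{x\<in>E. \<exists>g\<in>carrier (G\<lparr>carrier := R\<rparr>). (\<lambda>x\<in>E. act g x) x \<noteq> x} = {x\<in>E. \<exists>g\<in>R. act g x \<noteq> x}" by auto
  finally show ?thesis .
qed

lemma pgroup_fixed:
  assumes "subgroup R G" "card R = p ^ a" "Factorial_Ring.prime p" "finite E"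
    and "\<And>g x. g \<in> R \<Longrightarrow> x \<in> E \<Longrightarrow> act g x \<in> E"
    and "\<And>x. x \<in> E \<Longrightarrow> act \<one> x = x"
    and "\<And>g h x. g \<in> R \<Longrightarrow> h \<in> R \<Longrightarrow> x \<in> E \<Longrightarrow> act (g \<otimes> h) x = act g (act h x)"
  shows "p dvd card {x\<in>E. \<forall>g\<in>R. act g x = x} \<longleftrightarrow> p dvd card E"
proof -
  have "E = {x\<in>E. \<exists>g\<in>R. act g x \<noteq> x} \<union> {x\<in>E. \<forall>g\<in>R. act g x = x}" by auto
  hence "card E = card {x\<in>E. \<exists>g\<in>R. act g x \<noteq> x} + card {x\<in>E. \<forall>g\<in>R. act g x = x}"
    using assms(4) by (subst card_Un_disjoint[symmetric]) auto
  thus ?thesis using dvd_add_right_iff[OF pgroup_moved[OF assms]] by simp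
qed

end

text \<open>Mapping \<open>A\<close> into itself is enough: in a finite group the injective map is
  then onto \<open>A\<close>, so this is the full normaliser.\<close>

definition nrm :: "('a, 'b) monoid_scheme \<Rightarrow> 'a set \<Rightarrow> 'a set" where
  "nrm G A = {g \<in> carrier G. \<forall>a\<in>A. cj G g a \<in> A}"

lemma (in group) inv_cancel:
  "\<lbrakk>x \<in> carrier G; y \<in> carrier G\<rbrakk> \<Longrightarrow> inv x \<otimes> (x \<otimes> y) = y"
  "\<lbrakk>x \<in> carrier G; y \<in> carrier G\<rbrakk> \<Longrightarrow> x \<otimes> (inv x \<otimes> y) = y"
  by (simp_all flip: m_assoc)

context fin_group
begin

lemma nrmD: "g \<in> nrm G A \<Longrightarrow> a \<in> A \<Longrightarrow> cj G g a \<in> A"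
  by (simp add: nrm_def)

lemma nrm_carrier: "g \<in> nrm G A \<Longrightarrow> g \<in> carrier G"
  by (simp add: nrm_def)

lemma subgroup_nrm: "A \<subseteq> carrier G \<Longrightarrow> subgroup (nrm G A) G"
proof (rule fin_subgroupI)
  assume A: "A \<subseteq> carrier G"
  fix x y assume "x \<in> nrm G A" "y \<in> nrm G A"
  thus "x \<otimes> y \<in> nrm G A" using A by (auto simp: nrm_def cj_cj[symmetric] subset_iff)
qed (auto simp: nrm_def subset_iff)

lemma sub_nrm: "subgroup A G \<Longrightarrow> A \<subseteq> nrm G A"
  using cj_mem subgroup.subset by (fastforce simp: nrm_def)

lemma nrm_inv: "A \<subseteq> carrier G \<Longrightarrow> g \<in> nrm G A \<Longrightarrow> inv g \<in> nrm G A"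
  using subgroup_nrm subgroup.m_inv_closed by metis

lemma nrm_pow: "A \<subseteq> carrier G \<Longrightarrow> g \<in> nrm G A \<Longrightarrow> g [^] (n::nat) \<in> nrm G A"
  using subgroup_nrm pow_mem by metis

lemma nrm_iff:
  assumes "A \<subseteq> carrier G" "g \<in> nrm G A" "x \<in> carrier G"
  shows "cj G g x \<in> A \<longleftrightarrow> x \<in> A"
proof
  have g: "g \<in> carrier G" using assms nrm_carrier by blast
  assume "cj G g x \<in> A"
  from nrmD[OF nrm_inv[OF assms(1,2)] this] show "x \<in> A" using g assms by simp
qed (use nrmD assms in blast)

lemma nrm_swap:
  assumes "subgroup A G" "g \<in> nrm G A" "a \<in> A"
  shows "g \<otimes> a \<otimes> inv g \<in> A"
proof -
  have "inv g \<in> nrm G A" using assms nrm_inv subgroup.subset by metis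
  from nrmD[OF this assms(3)] show ?thesis using nrm_carrier[OF assms(2)] by (simp add: cj_def)
qed

text \<open>Powers of a coset behave as in a quotient: \<open>b\<close> normalises \<open>A\<close>,
  so every factor from \<open>A\<close> can be moved to the left.\<close>

lemma coset_pow:
  assumes A: "subgroup A G" and b: "b \<in> nrm G A" and a: "a \<in> A"
  shows "\<exists>a'\<in>A. (a \<otimes> b) [^] (n::nat) = a' \<otimes> b [^] n"
proof (induction n)
  case 0
  show ?case using subgroup.one_closed[OF A] by (intro bexI[of _ \<one>]) auto
next
  case (Suc n)
  then obtain a' where a': "a' \<in> A" "(a \<otimes> b) [^] n = a' \<otimes> b [^] n" by blast
  have c: "a \<in> carrier G" "a' \<in> carrier G" "b \<in> carrier G"
    using subgroup.mem_carrier[OF A] a a' nrm_carrier[OF b] by simp_all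
  have bn: "b [^] n \<in> nrm G A" using A b nrm_pow subgroup.subset by metis
  let ?u = "b [^] n \<otimes> a \<otimes> inv (b [^] n)"
  have u: "?u \<in> A" using nrm_swap[OF A bn a] .
  have "(a \<otimes> b) [^] Suc n = a' \<otimes> b [^] n \<otimes> (a \<otimes> b)" using a' by simp
  also have "\<dots> = (a' \<otimes> ?u) \<otimes> b [^] Suc n" using c by (simp add: m_assoc inv_cancel)
  finally show ?case using u a' subgroup.m_closed[OF A] by blast
qed

text \<open>The standard way to enlarge a subgroup by a factor \<open>p\<close>. The cosets of
  \<open>b [^] i\<close> for \<open>i < p\<close> are distinct: a power \<open>b [^] (i - j)\<close>
  in \<open>A\<close> together with \<open>b [^] p\<close> in \<open>A\<close> would put
  \<open>b\<close> into \<open>A\<close>, since \<open>i - j\<close> is coprime to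
  \<open>p\<close>.\<close>

lemma adjoin:
  assumes A: "subgroup A G" and b: "b \<in> nrm G A" and p: "Factorial_Ring.prime p" and bp: "b [^] (p::nat) \<in> A" and nb: "b \<notin> A"
  defines "C \<equiv> {a \<otimes> b [^] (i::nat) |a i. a \<in> A}"
  shows "subgroup C G" "card C = p * card A" "A \<subseteq> C" "b \<in> C"
proof -
  have bc: "b \<in> carrier G" using b nrm_carrier by blast
  have Ac: "\<And>a. a \<in> A \<Longrightarrow> a \<in> carrier G" using A subgroup.mem_carrier by metis
  have bn: "b [^] n \<in> nrm G A" for n :: nat using A b nrm_pow subgroup.subset by metis
  show AC: "A \<subseteq> C"
  proof
    fix a assume "a \<in> A"
    thus "a \<in> C" using Ac unfolding C_def by (intro CollectI exI[of _ a] exI[of _ "0::nat"]) simp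
  qed
  show "b \<in> C" using bc subgroup.one_closed[OF A] unfolding C_def
    by (intro CollectI exI[of _ \<one>] exI[of _ "1::nat"]) simp
  show "subgroup C G"
  proof (rule fin_subgroupI)
    show "C \<subseteq> carrier G" using bc Ac by (auto simp: C_def)
    show "\<one> \<in> C" using AC subgroup.one_closed[OF A] by blast
    fix x y assume "x \<in> C" "y \<in> C"
    then obtain a i a' j where xy: "x = a \<otimes> b [^] (i::nat)" "y = a' \<otimes> b [^] (j::nat)" "a \<in> A" "a' \<in> A" by (auto simp: C_def)
    let ?u = "b [^] i \<otimes> a' \<otimes> inv (b [^] i)"
    have "x \<otimes> y = (a \<otimes> ?u) \<otimes> (b [^] i \<otimes> b [^] j)" using xy Ac bc by (simp add: m_assoc inv_cancel)
    hence "x \<otimes> y = (a \<otimes> ?u) \<otimes> b [^] (i + j)" using bc by (simp add: nat_pow_mult)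
    thus "x \<otimes> y \<in> C" using nrm_swap[OF A bn xy(4)] xy(3) subgroup.m_closed[OF A] unfolding C_def by blast
  qed
  have "bij_betw (\<lambda>(a, i). a \<otimes> b [^] i) (A \<times> {..<p}) C"
  proof (rule bij_betw_imageI)
    have key: "i = j" if "a \<in> A" "a' \<in> A" "i < p" "j \<le> i" "a \<otimes> b [^] i = a' \<otimes> b [^] j" for a a' i j
    proof (rule ccontr)
      assume "i \<noteq> j"
      hence ij: "0 < i - j" "i - j < p" using that by auto
      have "a \<otimes> b [^] (i - j) \<otimes> b [^] j = a' \<otimes> b [^] j"
        using that bc Ac by (simp add: m_assoc nat_pow_mult)
      hence "a \<otimes> b [^] (i - j) = a'" using that bc Ac by (metis m_closed nat_pow_closed r_cancel)
      hence "b [^] (i - j) = inv a \<otimes> a'" using that bc Ac inv_cancel(1)[of a "b [^] (i - j)"] by simp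
      hence "b [^] (i - j) \<in> A" using that A subgroup.m_closed subgroup.m_inv_closed by metis
      moreover have "coprime (i - j) p" using ij p by (metis coprime_commute nat_dvd_not_less prime_imp_coprime)
      ultimately show False using pow_coprime_mem[OF A bc _ bp] nb by blast
    qed
    show "inj_on (\<lambda>(a, i). a \<otimes> b [^] i) (A \<times> {..<p})"
    proof (rule inj_onI, clarsimp)
      fix a i a' j assume h: "a \<in> A" "a' \<in> A" "i < p" "j < p" "a \<otimes> b [^] i = a' \<otimes> b [^] j"
      hence "i = j" using key[of a a' i j] key[of a' a j i] by (metis nle_le)
      thus "a = a' \<and> i = j" using h bc Ac by (metis nat_pow_closed r_cancel)
    qed
    show "(\<lambda>(a, i). a \<otimes> b [^] i) ` (A \<times> {..<p}) = C"
    proof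
      show "(\<lambda>(a, i). a \<otimes> b [^] i) ` (A \<times> {..<p}) \<subseteq> C" by (auto simp: C_def)
      show "C \<subseteq> (\<lambda>(a, i). a \<otimes> b [^] i) ` (A \<times> {..<p})"
      proof
        fix x assume "x \<in> C"
        then obtain a i where x: "x = a \<otimes> b [^] (i::nat)" "a \<in> A" by (auto simp: C_def)
        have "b [^] i = (b [^] p) [^] (i div p) \<otimes> b [^] (i mod p)" using bc by (simp add: nat_pow_pow nat_pow_mult)
        hence "x = (a \<otimes> (b [^] p) [^] (i div p)) \<otimes> b [^] (i mod p)" using x bc Ac by (simp add: m_assoc)
        moreover have "a \<otimes> (b [^] p) [^] (i div p) \<in> A" using x bp pow_mem[OF A] subgroup.m_closed[OF A] by blast
        moreover have "i mod p < p" using p prime_gt_0_nat by auto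
        ultimately show "x \<in> (\<lambda>(a, i). a \<otimes> b [^] i) ` (A \<times> {..<p})" by force
      qed
    qed
  qed
  from bij_betw_same_card[OF this] show "card C = p * card A" by (simp add: card_cartesian_product mult.commute)
qed

text \<open>The sequence of iterated \<open>p\<close>-th powers starts outside \<open>A\<close> and
  reaches \<open>A\<close>; the element just before it enters is what \<open>adjoin\<close>
  needs.\<close>

lemma pow_step:
  assumes "b \<in> carrier G" "b \<notin> A" "b [^] (p ^ m :: nat) \<in> A"
  shows "\<exists>j. b [^] (p ^ j :: nat) \<notin> A \<and> (b [^] (p ^ j)) [^] p \<in> A"
  using assms
proof (induction m)
  case (Suc m)
  show ?case
  proof (cases "b [^] (p ^ m) \<in> A")
    case False
    thus ?thesis using Suc.prems by (intro exI[of _ m]) (simp add: nat_pow_pow mult.commute)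
  qed (use Suc in auto)
qed auto

section \<open>Sylow's theorems by counting fixed cosets\<close>

lemma sylow_index:
  assumes "Factorial_Ring.prime p" "sylow_subgroup G p S"
  obtains m where "Coset.order G = m * card S" "\<not> p dvd m"
proof -
  have "Coset.order G \<noteq> 0" using fin order_gt_0_iff_finite by auto
  then obtain m where "Coset.order G = p ^ multiplicity p (Coset.order G) * m" "\<not> p dvd m"
    using assms(1) by (metis multiplicity_decompose' not_prime_unit)
  thus ?thesis using that[of m] assms(2) by (simp add: sylow_subgroup_def mult.commute)
qed

lemma sylow_exists:
  assumes "Factorial_Ring.prime p"
  obtains S where "sylow_subgroup G p S"
proof -
  have "Coset.order G \<noteq> 0" using fin order_gt_0_iff_finite by auto
  then obtain m where "Coset.order G = p ^ multiplicity p (Coset.order G) * m"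
    using assms(1) by (metis multiplicity_decompose' not_prime_unit)
  from sylow_thm[OF assms is_group this fin] show ?thesis using that by (auto simp: sylow_subgroup_def)
qed

text \<open>The \<open>p\<close>-group \<open>R\<close> acts on the right cosets of \<open>S\<close>
  by right multiplication; the inverse turns this into the left action that
  \<open>pgroup_fixed\<close> expects.\<close>

lemma prime_dvd_card_iff:
  assumes "subgroup R G" "card R = p ^ a" "Factorial_Ring.prime p" "subgroup S G"
  shows "p dvd card {C \<in> rcosets S. \<forall>r\<in>R. C #> inv r = C} \<longleftrightarrow> p dvd card (rcosets S)"
proof (rule pgroup_fixed[OF assms(1-3)])
  show "finite (rcosets S)" using fin assms(4) cosets_finite rcosets_part_G
    by (metis finite_UnionD)
  have Rc: "\<And>g. g \<in> R \<Longrightarrow> g \<in> carrier G" using assms subgroup.mem_carrier by metis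
  have Sc: "S \<subseteq> carrier G" using assms subgroup.subset by metis
  fix C assume "C \<in> rcosets S"
  then obtain x where x: "x \<in> carrier G" "C = S #> x" by (auto simp: RCOSETS_def)
  show "C #> inv \<one> = C" using x Sc by (simp add: coset_mult_assoc)
  fix g assume g: "g \<in> R"
  show "C #> inv g \<in> rcosets S" using x Sc Rc[OF g] by (simp add: coset_mult_assoc rcosetsI)
  fix h assume h: "h \<in> R"
  show "C #> inv (g \<otimes> h) = C #> inv h #> inv g"
    using x Sc Rc[OF g] Rc[OF h] by (simp add: coset_mult_assoc inv_mult_group m_assoc)
qed

lemma coset_fix_imp:
  assumes "subgroup S G" "x \<in> carrier G" "r \<in> carrier G" "S #> x #> inv r = S #> x"
  shows "cj G (inv x) r \<in> S"
proof -
  have Sc: "S \<subseteq> carrier G" using assms subgroup.subset by metis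
  have "S #> (x \<otimes> inv r) = S #> x" using assms Sc by (simp add: coset_mult_assoc)
  hence "x \<otimes> inv r \<in> S #> x" using assms rcos_self[of "x \<otimes> inv r" S] by simp
  then obtain s where s: "s \<in> S" "x \<otimes> inv r = s \<otimes> x" by (auto simp: r_coset_def)
  hence sc: "s \<in> carrier G" using Sc by auto
  have "s = x \<otimes> inv r \<otimes> inv x" using s sc assms by (simp add: m_assoc)
  hence "inv s = x \<otimes> r \<otimes> inv x" using assms by (simp add: inv_mult_group m_assoc)
  hence "inv s = cj G (inv x) r" using assms by (simp add: cj_def)
  thus ?thesis using s(1) subgroup.m_inv_closed[OF assms(1)] by metis
qed

text \<open>The number of cosets of \<open>S\<close> is prime to \<open>p\<close>, so
  \<open>R\<close> fixes one of them. That \<open>S #> x\<close> is fixed means that conjugation by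
  \<open>inv x\<close> carries \<open>R\<close> into \<open>S\<close>.\<close>

lemma sylow_conj:
  assumes "Factorial_Ring.prime p" "sylow_subgroup G p S" "subgroup R G" "card R = p ^ a"
  obtains g where "g \<in> carrier G" "\<forall>r\<in>R. cj G g r \<in> S"
proof -
  have S: "subgroup S G" using assms by (simp add: sylow_subgroup_def)
  obtain m where m: "Coset.order G = m * card S" "\<not> p dvd m" using sylow_index assms by metis
  have "card (rcosets S) * card S = m * card S" using lagrange[OF S] m by simp
  hence "\<not> p dvd card (rcosets S)" using m card_sub_pos[OF S] by simp
  hence "\<not> p dvd card {C \<in> rcosets S. \<forall>r\<in>R. C #> inv r = C}"
    using prime_dvd_card_iff[OF assms(3,4,1) S] by simp
  hence "{C \<in> rcosets S. \<forall>r\<in>R. C #> inv r = C} \<noteq> {}" by (metis card.empty dvd_0_right)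
  then obtain x where x: "x \<in> carrier G" "\<forall>r\<in>R. S #> x #> inv r = S #> x" by (auto simp: RCOSETS_def)
  have "\<forall>r\<in>R. cj G (inv x) r \<in> S" using x coset_fix_imp[OF S x(1)] subgroup.mem_carrier[OF assms(3)] by blast
  thus ?thesis using that[of "inv x"] x by simp
qed

end

lemma (in group) prime_order_imp_cyclic:
  assumes "Factorial_Ring.prime (Coset.order G)"
  shows "cyclic_group G"
proof -
  have fin: "finite (carrier G)" using assms by (metis order_gt_0_iff_finite prime_gt_0_nat)
  interpret fin_group G by unfold_locales (rule fin)
  have "carrier G \<noteq> {\<one>}" using assms by (auto simp: Coset.order_def)
  then obtain x where x: "x \<in> carrier G" "x \<noteq> \<one>" by blast
  have s: "subgroup (generate G {x}) G" using x by (intro generate_is_subgroup) auto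
  have "x \<in> generate G {x}" by (simp add: generate.incl)
  hence "card (generate G {x}) \<noteq> 1" using card_one_iff[OF s] x by auto
  hence "card (generate G {x}) = Coset.order G"
    using card_dvd_order[OF s] assms prime_nat_iff by blast
  hence "generate G {x} = carrier G"
    using sub_eq[OF subgroup_self, of "generate G {x}"] subgroup.subset[OF s] by (simp add: Coset.order_def)
  hence "subgroup_generated G {x} = G" using x by (simp add: subgroup_generated_def)
  thus ?thesis using x cyclic_group_def by blast
qed

section \<open>Normalisers and chains in p-groups\<close>

context fin_group
begin

lemma card_p_sub:
  assumes "subgroup A G" "subgroup P G" "A \<subseteq> P" "card P = p ^ n" "Factorial_Ring.prime (p::nat)"
  obtains a where "card A = p ^ a" "a \<le> n"
  using card_dvd[OF assms(1-3)] assms(4,5) divides_primepow_nat by metis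

lemma nrm_sub: "B \<subseteq> carrier G \<Longrightarrow> subgroup B G \<Longrightarrow> nrm (G\<lparr>carrier := B\<rparr>) A = nrm G A \<inter> B"
  by (auto simp: nrm_def cj_sub)

text \<open>\<open>A\<close> acts on its own cosets and fixes the coset \<open>A\<close>. The number
  of fixed cosets is divisible by \<open>p\<close>, so there is another one, and its representative
  gives an element of the normaliser outside \<open>A\<close>.\<close>

lemma normalizer_growth_whole:
  assumes "subgroup A G" "A \<noteq> carrier G" "card (carrier G) = p ^ b" "Factorial_Ring.prime p"
  shows "\<exists>x\<in>carrier G - A. x \<in> nrm G A"
proof -
  have Ac: "A \<subseteq> carrier G" using assms subgroup.subset by metis
  obtain a where a: "card A = p ^ a"
    using card_p_sub[OF assms(1) subgroup_self Ac assms(3,4)] by blast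
  have lag: "card (rcosets A) * card A = p ^ b" using lagrange[OF assms(1)] assms(3) by (simp add: Coset.order_def)
  hence "card (rcosets A) dvd p ^ b" by (metis dvd_triv_left)
  then obtain i where i: "card (rcosets A) = p ^ i" using assms(4) divides_primepow_nat by blast
  have "i \<noteq> 0"
  proof
    assume "i = 0"
    hence "card A = card (carrier G)" using lag i assms(3) by simp
    thus False using sub_eq[OF subgroup_self Ac] assms(2) by simp
  qed
  hence "p dvd card (rcosets A)" using i by simp
  hence dv: "p dvd card {C \<in> rcosets A. \<forall>r\<in>A. C #> inv r = C}"
    using prime_dvd_card_iff[OF assms(1) a assms(4,1)] by simp
  let ?F = "{C \<in> rcosets A. \<forall>r\<in>A. C #> inv r = C}"
  have "A #> \<one> = A" using Ac by simp
  hence "A \<in> rcosets A" using Ac rcosetsI[of A \<one>] by auto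
  moreover have "A #> inv r = A" if "r \<in> A" for r
    using that coset_join2[of "inv r" A] subgroup.m_inv_closed[OF assms(1)] subgroup.mem_carrier[OF assms(1)] assms(1) by auto
  ultimately have AF: "A \<in> ?F" by blast
  have "?F \<noteq> {A}" using dv assms(4) by (auto simp del: )
  then obtain C where C: "C \<in> ?F" "C \<noteq> A" using AF by blast
  then obtain x where x: "x \<in> carrier G" "C = A #> x" by (auto simp: RCOSETS_def)
  have "\<forall>r\<in>A. cj G (inv x) r \<in> A" using C x coset_fix_imp[OF assms(1) x(1)] Ac by blast
  hence "inv x \<in> nrm G A" using x by (simp add: nrm_def)
  moreover have "inv x \<notin> A"
  proof
    assume "inv x \<in> A"
    hence "x \<in> A" using subgroup.m_inv_closed[OF assms(1)] x by fastforce
    thus False using C x coset_join2[OF x(1) assms(1)] by simp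
  qed
  ultimately show ?thesis using x by blast
qed

lemma normalizer_growth:
  assumes "subgroup A G" "subgroup B G" "A \<subset> B" "card B = p ^ b" "Factorial_Ring.prime p"
  shows "\<exists>x\<in>B - A. x \<in> nrm G A"
proof -
  interpret B: fin_group "G\<lparr>carrier := B\<rparr>" using sub_fin_group assms by blast
  have "\<exists>x\<in>carrier (G\<lparr>carrier := B\<rparr>) - A. x \<in> nrm (G\<lparr>carrier := B\<rparr>) A"
    by (rule B.normalizer_growth_whole[of _ p b]) (use assms sub_sub[OF assms(2,1)] in auto)
  thus ?thesis using nrm_sub[OF subgroup.subset[OF assms(2)] assms(2), of A] by auto
qed

lemma step_exists:
  assumes "subgroup A G" "subgroup B G" "A \<subset> B" "card B = p ^ b" "Factorial_Ring.prime p"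
  shows "\<exists>C. subgroup C G \<and> A \<subseteq> C \<and> C \<subseteq> B \<and> card C = p * card A"
proof -
  obtain x where x: "x \<in> B" "x \<notin> A" "x \<in> nrm G A" using normalizer_growth[OF assms] by blast
  have "x [^] (p ^ b) \<in> A" using pow_order_sub[OF assms(2) x(1)] assms(4) subgroup.one_closed[OF assms(1)] by simp
  then obtain j where j: "x [^] (p ^ j) \<notin> A" "(x [^] (p ^ j)) [^] p \<in> A"
    using pow_step[of x A p b] x nrm_carrier by blast
  have y: "x [^] (p ^ j) \<in> nrm G A" "x [^] (p ^ j) \<in> B"
    using x nrm_pow subgroup.subset[OF assms(1)] pow_mem[OF assms(2)] by auto
  note ad = adjoin[OF assms(1) y(1) assms(5) j(2,1)]
  have "{a \<otimes> (x [^] p ^ j) [^] (i::nat) |a i. a \<in> A} \<subseteq> B"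
  proof clarify
    fix a and i :: nat assume "a \<in> A"
    hence "a \<in> B" using assms(3) by blast
    thus "a \<otimes> (x [^] p ^ j) [^] i \<in> B"
      by (rule subgroup.m_closed[OF assms(2)]) (rule pow_mem[OF assms(2) y(2)])
  qed
  thus ?thesis using ad by blast
qed

lemma step_between:
  assumes "subgroup A G" "subgroup B G" "A \<subseteq> B" "card A = p ^ a" "card B = p ^ b" "Factorial_Ring.prime p" "a \<le> i" "i \<le> b"
  shows "\<exists>C. subgroup C G \<and> A \<subseteq> C \<and> C \<subseteq> B \<and> card C = p ^ i"
  using assms(7,8)
proof (induction i rule: dec_induct)
  case base
  thus ?case using assms by blast
next
  case (step i)
  then obtain C where C: "subgroup C G" "A \<subseteq> C" "C \<subseteq> B" "card C = p ^ i" by force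
  have "card C < card B" using C step assms prime_gt_1_nat by simp
  hence "C \<subset> B" using C by auto
  from step_exists[OF C(1) assms(2) this assms(5,6)] C show ?case by auto
qed

text \<open>The normaliser of \<open>A\<close> in \<open>B\<close> is larger than \<open>A\<close>,
  and prime index leaves nothing strictly between \<open>A\<close> and \<open>B\<close>.\<close>

lemma index_p_normal:
  assumes "subgroup A G" "subgroup B G" "A \<subseteq> B" "card B = p * card A" "card B = p ^ b" "Factorial_Ring.prime p"
  shows "B \<subseteq> nrm G A"
proof -
  have "A \<noteq> B" using assms card_sub_pos[OF assms(1)] prime_gt_1_nat[OF assms(6)] by auto
  then obtain x where x: "x \<in> B" "x \<notin> A" "x \<in> nrm G A" using normalizer_growth[OF assms(1,2) _ assms(5,6)] assms(3) by blast
  let ?N = "nrm G A \<inter> B"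
  have N: "subgroup ?N G" by (rule subgroups_Inter_pair[OF subgroup_nrm[OF subgroup.subset[OF assms(1)]] assms(2)])
  have AN: "A \<subset> ?N" using sub_nrm[OF assms(1)] assms(3) x by blast
  obtain k where k: "card ?N = card A * k" using card_dvd[OF assms(1) N] AN by (auto elim: dvdE)
  have "k dvd p" using card_dvd[OF N assms(2)] k assms(4) card_sub_pos[OF assms(1)] by (auto simp: mult.commute)
  moreover have "k \<noteq> 1" using card_proper[OF N AN] k by auto
  ultimately have "k = p" using assms(6) prime_nat_iff by blast
  hence "?N = B" using sub_eq[OF assms(2), of ?N] k assms(4) by (simp add: mult.commute)
  thus ?thesis by blast
qed

lemma nrm_imp_normal: "subgroup A G \<Longrightarrow> subgroup B G \<Longrightarrow> A \<subseteq> B \<Longrightarrow> B \<subseteq> nrm G A \<Longrightarrow> A \<lhd> (G\<lparr>carrier := B\<rparr>)"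
proof -
  assume a: "subgroup A G" "subgroup B G" "A \<subseteq> B" "B \<subseteq> nrm G A"
  interpret B: fin_group "G\<lparr>carrier := B\<rparr>" using sub_fin_group a by blast
  show "A \<lhd> (G\<lparr>carrier := B\<rparr>)"
    unfolding B.normal_inv_iff using a sub_sub nrm_swap[OF a(1)] by auto
qed

lemma index_p_quotient:
  assumes "subgroup A G" "subgroup B G" "A \<subseteq> B" "card B = p * card A" "card B = p ^ b" "Factorial_Ring.prime p"
  shows "cyclic_group (G\<lparr>carrier := B\<rparr> Mod A)" "Coset.order (G\<lparr>carrier := B\<rparr> Mod A) = p"
proof -
  interpret B: fin_group "G\<lparr>carrier := B\<rparr>" using sub_fin_group assms by blast
  interpret N: normal A "G\<lparr>carrier := B\<rparr>" using nrm_imp_normal index_p_normal[OF assms] assms by blast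
  have "card (rcosets\<^bsub>G\<lparr>carrier := B\<rparr>\<^esub> A) * card A = p * card A"
    using B.lagrange[OF N.is_subgroup] assms by (simp add: Coset.order_def)
  thus o: "Coset.order (G\<lparr>carrier := B\<rparr> Mod A) = p"
    using card_sub_pos[OF assms(1)] by (simp add: FactGroup_def Coset.order_def)
  show "cyclic_group (G\<lparr>carrier := B\<rparr> Mod A)"
    by (rule group.prime_order_imp_cyclic[OF N.factorgroup_is_group]) (simp add: o assms)
qed

text \<open>The quotient of \<open>B\<close> by \<open>A\<close> has order \<open>p\<close>, so it
  is abelian of exponent \<open>p\<close>; hence \<open>A\<close> absorbs \<open>p\<close>-th powers
  and commutators.\<close>

lemma index_p_facts:
  assumes "subgroup A G" "subgroup B G" "A \<subseteq> B" "card B = p * card A" "card B = p ^ b" "Factorial_Ring.prime p"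
    and xy: "x \<in> B" "y \<in> B"
  shows "x [^] p \<in> A" "cj G y x \<otimes> inv x \<in> A"
proof -
  interpret B: fin_group "G\<lparr>carrier := B\<rparr>" using sub_fin_group assms by blast
  interpret N: normal A "G\<lparr>carrier := B\<rparr>" using nrm_imp_normal index_p_normal[OF assms(1-6)] assms by blast
  interpret Q: group "G\<lparr>carrier := B\<rparr> Mod A" by (rule N.factorgroup_is_group)
  note Bc = subgroup.mem_carrier[OF assms(2)]
  have cl: "A #> z \<in> carrier (G\<lparr>carrier := B\<rparr> Mod A)" if "z \<in> B" for z
    using that by (auto simp: FactGroup_def RCOSETS_def)
  have "(A #> x) [^]\<^bsub>G\<lparr>carrier := B\<rparr> Mod A\<^esub> p = A"
    using Q.pow_order_eq_1[OF cl[OF xy(1)]] index_p_quotient(2)[OF assms(1-6)] by simp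
  hence "A #> (x [^] p) = A" using N.FactGroup_pow[of x p] xy by (simp flip: nat_pow_consistent)
  thus "x [^] p \<in> A" using rcos_self[OF _ assms(1), of "x [^] p"] Bc[OF xy(1)] by simp
  have "comm_group (G\<lparr>carrier := B\<rparr> Mod A)"
    using index_p_quotient(1)[OF assms(1-6)] Q.cyclic_imp_abelian_group by blast
  hence "(A #> x) <#> (A #> y) = (A #> y) <#> (A #> x)"
    using cl xy comm_monoid.m_comm[OF comm_group.axioms(1), of "G\<lparr>carrier := B\<rparr> Mod A" "A #> x" "A #> y"] by simp
  hence e: "A #> (x \<otimes> y) = A #> (y \<otimes> x)" using N.rcos_sum[of x y] N.rcos_sum[of y x] xy by simp
  have "x \<otimes> y \<in> A #> (y \<otimes> x)" using e rcos_self[OF _ assms(1), of "x \<otimes> y"] Bc xy by auto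
  then obtain a where a: "a \<in> A" "x \<otimes> y = a \<otimes> (y \<otimes> x)" by (auto simp: r_coset_def)
  have ac: "a \<in> carrier G" using a subgroup.mem_carrier[OF assms(1)] by blast
  have "cj G y x \<otimes> inv x = cj G y a"
    using a(2) ac Bc[OF xy(1)] Bc[OF xy(2)] by (simp add: cj_def m_assoc)
  moreover have "y \<in> nrm G A" using index_p_normal[OF assms(1-6)] xy by blast
  ultimately show "cj G y x \<otimes> inv x \<in> A" using nrmD a by metis
qed

lemma card_mult_le:
  assumes "subgroup A G" "subgroup B G" "subgroup C G" "A \<subseteq> C" "B \<subseteq> C" "A \<inter> B = {\<one>}"
  shows "card A * card B \<le> card C"
proof -
  have "inj_on (\<lambda>(a, b). a \<otimes> b) (A \<times> B)"
  proof (rule inj_onI, clarsimp)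
    fix a b a' b' assume h: "a \<in> A" "b \<in> B" "a' \<in> A" "b' \<in> B" "a \<otimes> b = a' \<otimes> b'"
    have c: "a \<in> carrier G" "a' \<in> carrier G" "b \<in> carrier G" "b' \<in> carrier G"
      using h subgroup.mem_carrier[OF assms(1)] subgroup.mem_carrier[OF assms(2)] by auto
    have "inv a' \<otimes> (a \<otimes> b) = b'" using h(5) c by (simp add: inv_cancel)
    hence "inv a' \<otimes> a = b' \<otimes> inv b" using c by (auto simp: m_assoc)
    moreover have "inv a' \<otimes> a \<in> A" "b' \<otimes> inv b \<in> B"
      using h by (auto intro: subgroup.m_closed subgroup.m_inv_closed assms(1,2))
    ultimately have "inv a' \<otimes> a = \<one>" "b' \<otimes> inv b = \<one>" using assms(6) by auto
    thus "a = a' \<and> b = b'" using c inv_cancel(2)[of a' a] inv_equality[of b' "inv b"] by simp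
  qed
  hence "card A * card B = card ((\<lambda>(a, b). a \<otimes> b) ` (A \<times> B))" by (simp add: card_image card_cartesian_product)
  also have "\<dots> \<le> card C"
    by (rule card_mono)
      (use assms(4,5) in \<open>auto intro!: fin_sub assms(3) subgroup.m_closed[OF assms(3)]\<close>)
  finally show ?thesis .
qed

text \<open>This is \<open>G = S O^p(G)\<close>. For a prime \<open>q\<close> other than
  \<open>p\<close>, an element of a Sylow \<open>q\<close>-subgroup has order prime to
  \<open>p\<close> and its \<open>p ^ k\<close>-th power is in \<open>M\<close>, so it is in
  \<open>M\<close>. Thus \<open>M\<close> contains a Sylow subgroup for every prime.\<close>

lemma gen_all:
  assumes p: "Factorial_Ring.prime p" and S: "sylow_subgroup G p S" and M: "subgroup M G" "S \<subseteq> M"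
    and pw: "\<And>g. g \<in> carrier G \<Longrightarrow> g [^] (p ^ k :: nat) \<in> M"
  shows "M = carrier G"
proof -
  have pos: "Coset.order G \<noteq> 0" using fin order_gt_0_iff_finite by auto
  have "Coset.order G dvd card M"
  proof (rule multiplicity_le_imp_dvd[OF pos])
    fix q :: nat assume q: "Factorial_Ring.prime q"
    have "\<exists>Q. sylow_subgroup G q Q \<and> Q \<subseteq> M"
    proof (cases "q = p")
      case False
      obtain Q where Q: "sylow_subgroup G q Q" using sylow_exists q by blast
      have "y \<in> M" if "y \<in> Q" for y
      proof -
        have Qs: "subgroup Q G" using Q sylow_subgroup_def by blast
        have yc: "y \<in> carrier G" using that Qs subgroup.mem_carrier by metis
        have "y [^] card Q \<in> M" using pow_order_sub[OF Qs that] subgroup.one_closed[OF M(1)] by simp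
        moreover have "coprime (card Q) (p ^ k)"
          using Q primes_coprime[OF q p False] by (simp add: sylow_subgroup_def)
        ultimately show ?thesis using pow_coprime_mem[OF M(1) yc] pw yc by blast
      qed
      thus ?thesis using Q by blast
    qed (use S M in blast)
    then obtain Q where Q: "sylow_subgroup G q Q" "Q \<subseteq> M" by blast
    hence "q ^ multiplicity q (Coset.order G) dvd card M"
      using card_dvd[OF _ M(1) Q(2)] by (simp add: sylow_subgroup_def)
    thus "multiplicity q (Coset.order G) \<le> multiplicity q (card M)"
      using q card_sub_pos[OF M(1)] by (intro multiplicity_geI) auto
  qed
  hence "card (carrier G) \<le> card M" using card_sub_pos[OF M(1)] by (simp add: Coset.order_def dvd_imp_le)
  thus ?thesis using sub_eq[OF subgroup_self] subgroup.subset[OF M(1)] by blast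
qed

end

section \<open>Minimal normal subgroups and supplements\<close>

definition nml :: "('a, 'b) monoid_scheme \<Rightarrow> 'a set \<Rightarrow> bool" where
  "nml G N \<longleftrightarrow> subgroup N G \<and> carrier G \<subseteq> nrm G N"

definition minnml :: "('a, 'b) monoid_scheme \<Rightarrow> 'a set \<Rightarrow> bool" where
  "minnml G V \<longleftrightarrow> nml G V \<and> V \<noteq> {\<one>\<^bsub>G\<^esub>} \<and> (\<forall>W. nml G W \<longrightarrow> W \<subseteq> V \<longrightarrow> W = {\<one>\<^bsub>G\<^esub>} \<or> W = V)"

text \<open>A consequence of weak supplementation for \<open>p\<close>-subgroups \<open>H\<close> that passes to subgroups and quotients
  of \<open>G\<close>. The subgroup \<open>Y\<close> stands for \<open>H\<^sub>s\<^sub>G\<close>, that \<open>g\<close> to the power \<open>p\<^sup>k\<close> normalises \<open>Y\<close> says that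
  \<open>O\<^sup>p(G)\<close> does, and the intersection of the subgroups \<open>M\<close> replaces \<open>\<Phi>(H)H\<^sub>s\<^sub>G\<close>.\<close>

definition psup :: "('a, 'b) monoid_scheme \<Rightarrow> nat \<Rightarrow> 'a set \<Rightarrow> bool" where
  "psup G p H \<longleftrightarrow> (\<exists>K Y k. subgroup K G \<and> subgroup Y G \<and> Y \<subseteq> H \<and>
     (\<forall>g\<in>carrier G. g [^]\<^bsub>G\<^esub> (p ^ k :: nat) \<in> nrm G Y) \<and>
     (\<forall>g\<in>carrier G. \<exists>a\<in>K. \<exists>h\<in>H. g = a \<otimes>\<^bsub>G\<^esub> h) \<and>
     (\<forall>M. subgroup M G \<longrightarrow> Y \<subseteq> M \<longrightarrow> M \<subseteq> H \<longrightarrow> card H = p * card M \<longrightarrow> K \<inter> H \<subseteq> M))"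

context fin_group
begin

lemma nml_subgroup: "nml G N \<Longrightarrow> subgroup N G"
  by (simp add: nml_def)

lemma nml_cj: "nml G N \<Longrightarrow> g \<in> carrier G \<Longrightarrow> x \<in> N \<Longrightarrow> cj G g x \<in> N"
  using nrmD by (auto simp: nml_def)

lemma nmlI: "subgroup N G \<Longrightarrow> (\<And>g x. g \<in> carrier G \<Longrightarrow> x \<in> N \<Longrightarrow> cj G g x \<in> N) \<Longrightarrow> nml G N"
  by (auto simp: nml_def nrm_def)

lemma nml_Int: "nml G A \<Longrightarrow> nml G B \<Longrightarrow> nml G (A \<inter> B)"
  by (rule nmlI) (auto intro: subgroups_Inter_pair nml_subgroup nml_cj)

lemma nml_one: "nml G {\<one>}"
  by (rule nmlI) (auto simp: triv_subgroup)

lemma minnml_nml: "minnml G V \<Longrightarrow> nml G V"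
  by (simp add: minnml_def)

lemma minnml_cases:
  assumes "minnml G V" "nml G W"
  obtains "V \<subseteq> W" | "W \<inter> V = {\<one>}"
proof -
  have "nml G (W \<inter> V)" using assms nml_Int minnml_nml by blast
  thus ?thesis using assms(1) that unfolding minnml_def by blast
qed

lemma minnml_exists:
  assumes "nml G P" "P \<noteq> {\<one>}"
  shows "\<exists>V. minnml G V \<and> V \<subseteq> P"
proof -
  define Q where "Q V \<longleftrightarrow> nml G V \<and> V \<noteq> {\<one>} \<and> V \<subseteq> P" for V
  have "Q P" using assms by (simp add: Q_def)
  then obtain V where V: "Q V" "\<And>W. Q W \<Longrightarrow> card V \<le> card W" using ex_has_least_nat[of Q P card] by blast
  have "W = {\<one>} \<or> W = V" if "nml G W" "W \<subseteq> V" for W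
  proof (cases "W = {\<one>}")
    case False
    hence "card V \<le> card W" using V that unfolding Q_def by blast
    thus ?thesis using sub_eq[of V W] that V(1) nml_subgroup unfolding Q_def by blast
  qed auto
  thus ?thesis using V(1) unfolding minnml_def Q_def by blast
qed

section \<open>Chains of subgroups invariant under a p-group\<close>

lemma cj_coset:
  assumes "subgroup A G" "s \<in> nrm G A" "b \<in> carrier G"
  shows "cj G s ` (A #> b) = A #> cj G s b"
proof -
  have sc: "s \<in> carrier G" using assms nrm_carrier by blast
  have si: "inv s \<in> nrm G A" using nrm_inv[OF subgroup.subset[OF assms(1)] assms(2)] .
  note Ac = subgroup.mem_carrier[OF assms(1)]
  show ?thesis
  proof
    show "cj G s ` (A #> b) \<subseteq> A #> cj G s b"
      using nrmD[OF assms(2)] sc assms(3) Ac by (auto simp: r_coset_def cj_mult)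
    show "A #> cj G s b \<subseteq> cj G s ` (A #> b)"
    proof
      fix x assume "x \<in> A #> cj G s b"
      then obtain a where a: "a \<in> A" "x = a \<otimes> cj G s b" by (auto simp: r_coset_def)
      hence "x = cj G s (cj G (inv s) a \<otimes> b)" using sc assms(3) Ac by (simp add: cj_mult)
      moreover have "cj G (inv s) a \<otimes> b \<in> A #> b" using nrmD[OF si a(1)] by (auto simp: r_coset_def)
      ultimately show "x \<in> cj G s ` (A #> b)" by blast
    qed
  qed
qed

lemma card_coset_image:
  assumes "subgroup A G" "subgroup B G" "A \<subseteq> B"
  shows "card ((\<lambda>b. A #> b) ` B) * card A = card B"
proof -
  interpret B: fin_group "G\<lparr>carrier := B\<rparr>" using sub_fin_group assms by blast
  have "rcosets\<^bsub>G\<lparr>carrier := B\<rparr>\<^esub> A = (\<lambda>b. A #> b) ` B" by (auto simp: RCOSETS_def)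
  thus ?thesis using B.lagrange[OF sub_sub[OF assms(2,1,3)]] by (simp add: Coset.order_def)
qed

text \<open>\<open>S\<close> acts by conjugation on the cosets of \<open>A\<close> in
  \<open>B\<close>, whose number is divisible by \<open>p\<close>, so some coset
  \<open>A #> x\<close> other than \<open>A\<close> is fixed. A power \<open>y\<close> of
  \<open>x\<close> outside \<open>A\<close> with \<open>y [^] p\<close> in \<open>A\<close> has a
  fixed coset too, and adjoining it to \<open>A\<close> gives an invariant subgroup.\<close>

lemma inv_step:
  assumes A: "subgroup A G" and B: "subgroup B G" and AB: "A \<subset> B" and S: "subgroup S G" "card S = p ^ s" and p: "Factorial_Ring.prime p"
    and BS: "B \<subseteq> S" and SA: "S \<subseteq> nrm G A" and SB: "S \<subseteq> nrm G B"
  shows "\<exists>C. subgroup C G \<and> A \<subseteq> C \<and> C \<subseteq> B \<and> S \<subseteq> nrm G C \<and> card C = p * card A"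
proof -
  let ?E = "(\<lambda>b. A #> b) ` B"
  note Sc = subgroup.mem_carrier[OF S(1)]
  note Bc = subgroup.mem_carrier[OF B]
  note Ac = subgroup.mem_carrier[OF A]
  have si: "inv s \<in> S" if "s \<in> S" for s using that subgroup.m_inv_closed[OF S(1)] by blast
  obtain b where b: "card B = p ^ b" using card_p_sub[OF B S(1) BS S(2) p] by blast
  have cE: "card ?E * card A = p ^ b" using card_coset_image[OF A B] AB b by auto
  hence "card ?E dvd p ^ b" by (metis dvd_triv_left)
  then obtain i where i: "card ?E = p ^ i" using p divides_primepow_nat by blast
  have "i \<noteq> 0"
  proof
    assume "i = 0"
    thus False using card_proper[OF B AB] cE i b by simp
  qed
  hence pE: "p dvd card ?E" using i by simp
  have dv: "p dvd card {C \<in> ?E. \<forall>s\<in>S. cj G (inv s) ` C = C} \<longleftrightarrow> p dvd card ?E"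
  proof (rule pgroup_fixed[OF S p])
    show "finite ?E" using fin_sub[OF B] by blast
  next
    fix s C assume s: "s \<in> S" and "C \<in> ?E"
    then obtain x where x: "x \<in> B" "C = A #> x" by blast
    have "cj G (inv s) ` C = A #> cj G (inv s) x" using cj_coset[OF A, of "inv s" x] SA si[OF s] x Bc by auto
    moreover have "cj G (inv s) x \<in> B" using SB si[OF s] nrmD x by blast
    ultimately show "cj G (inv s) ` C \<in> ?E" by blast
  next
    fix C assume "C \<in> ?E"
    then obtain x where x: "x \<in> B" "C = A #> x" by blast
    hence "C \<subseteq> carrier G" using Ac Bc by (auto simp: r_coset_def)
    thus "cj G (inv \<one>) ` C = C" by (force simp: subset_iff image_iff)
  next
    fix g h C assume gh: "g \<in> S" "h \<in> S" and "C \<in> ?E"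
    then obtain x where x: "x \<in> B" "C = A #> x" by blast
    hence "C \<subseteq> carrier G" using Ac Bc by (auto simp: r_coset_def)
    thus "cj G (inv (g \<otimes> h)) ` C = cj G (inv g) ` (cj G (inv h) ` C)"
      using gh Sc by (auto simp: image_image inv_mult_group cj_cj subset_iff intro!: image_cong)
  qed
  let ?F = "{C \<in> ?E. \<forall>s\<in>S. cj G (inv s) ` C = C}"
  have one: "\<one> \<in> B" "A #> \<one> = A" using subgroup.one_closed[OF B] subgroup.subset[OF A] by auto
  hence "A \<in> ?E" by (metis image_eqI)
  moreover have "cj G (inv s) ` A = A" if "s \<in> S" for s
    using cj_coset[OF A, of "inv s" \<one>] SA si[OF that] one Sc that by auto
  ultimately have AF: "A \<in> ?F" by blast
  have "?F \<noteq> {A}"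
  proof
    assume "?F = {A}"
    hence "card ?F = 1" by simp
    thus False using dv pE p by simp
  qed
  then obtain C where C: "C \<in> ?F" "C \<noteq> A" using AF by blast
  then obtain x where x: "x \<in> B" "C = A #> x" by blast
  have xA: "x \<notin> A" using C x coset_join2[OF Bc[OF x(1)] A] by auto
  have fx: "cj G s x \<in> A #> x" if "s \<in> S" for s
  proof -
    have "cj G (inv (inv s)) ` C = C" using C si[OF that] by blast
    hence "cj G s ` (A #> x) = A #> x" using x Sc that by simp
    moreover have "x \<in> A #> x" using rcos_self[OF Bc[OF x(1)] A] .
    ultimately show ?thesis by blast
  qed
  have "x [^] (p ^ b) \<in> A" using pow_order_sub[OF B x(1)] b subgroup.one_closed[OF A] by simp
  then obtain j where j: "x [^] (p ^ j) \<notin> A" "(x [^] (p ^ j)) [^] p \<in> A"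
    using pow_step[OF Bc[OF x(1)] xA, of p b] by blast
  define y where "y = x [^] (p ^ j)"
  have xn: "x \<in> nrm G A" using x BS SA by blast
  have yn: "y \<in> nrm G A" unfolding y_def using nrm_pow[OF subgroup.subset[OF A] xn] .
  have yB: "y \<in> B" using pow_mem[OF B x(1)] by (simp add: y_def)
  have fy: "\<exists>a\<in>A. cj G s y = a \<otimes> y" if s: "s \<in> S" for s
  proof -
    obtain a where a: "a \<in> A" "cj G s x = a \<otimes> x" using fx[OF s] by (auto simp: r_coset_def)
    have "cj G s y = (a \<otimes> x) [^] (p ^ j)" using a Sc[OF s] Bc[OF x(1)] by (simp add: y_def cj_pow)
    thus ?thesis using coset_pow[OF A xn a(1)] y_def by metis
  qed
  let ?C = "{a \<otimes> y [^] (i::nat) |a i. a \<in> A}"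
  note ad = adjoin[OF A yn p j(2,1)[folded y_def]]
  have "?C \<subseteq> B"
  proof clarify
    fix a and i :: nat assume "a \<in> A"
    hence "a \<in> B" using AB by blast
    thus "a \<otimes> y [^] i \<in> B" using subgroup.m_closed[OF B] pow_mem[OF B yB] by blast
  qed
  moreover have "S \<subseteq> nrm G ?C"
  proof
    fix s assume s: "s \<in> S"
    have "cj G s (a \<otimes> y [^] i) \<in> ?C" if a: "a \<in> A" for a and i :: nat
    proof -
      obtain a1 where a1: "a1 \<in> A" "cj G s y = a1 \<otimes> y" using fy[OF s] by blast
      obtain a2 where a2: "a2 \<in> A" "(a1 \<otimes> y) [^] i = a2 \<otimes> y [^] i" using coset_pow[OF A yn a1(1)] by blast
      have "cj G s a \<in> A" using SA s nrmD a by blast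
      hence c: "cj G s a \<otimes> a2 \<in> A" using a2 subgroup.m_closed[OF A] by blast
      have "cj G s (a \<otimes> y [^] i) = cj G s a \<otimes> (a2 \<otimes> y [^] i)"
        using a1 a2 Sc[OF s] Ac a Bc yB by (simp add: cj_mult cj_pow)
      also have "\<dots> = (cj G s a \<otimes> a2) \<otimes> y [^] i" using Sc[OF s] Ac a a2 Bc yB by (simp add: m_assoc)
      finally show ?thesis using c by blast
    qed
    thus "s \<in> nrm G ?C" using Sc[OF s] by (auto simp: nrm_def)
  qed
  ultimately show ?thesis using ad by blast
qed

lemma inv_between:
  assumes A: "subgroup A G" and B: "subgroup B G" and AB: "A \<subseteq> B" and S: "subgroup S G" "card S = p ^ s" and p: "Factorial_Ring.prime p"
    and BS: "B \<subseteq> S" and SA: "S \<subseteq> nrm G A" and SB: "S \<subseteq> nrm G B" and c: "card A = p ^ a" "card B = p ^ b" and i: "a \<le> i" "i \<le> b"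
  shows "\<exists>C. subgroup C G \<and> A \<subseteq> C \<and> C \<subseteq> B \<and> S \<subseteq> nrm G C \<and> card C = p ^ i"
  using i
proof (induction i rule: dec_induct)
  case base
  thus ?case using assms by blast
next
  case (step i)
  then obtain C where C: "subgroup C G" "A \<subseteq> C" "C \<subseteq> B" "S \<subseteq> nrm G C" "card C = p ^ i" by force
  have "card C < card B" using C step c p prime_gt_1_nat by simp
  hence "C \<subset> B" using C by auto
  then obtain D where "subgroup D G" "C \<subseteq> D" "D \<subseteq> B" "S \<subseteq> nrm G D" "card D = p * card C"
    using inv_step[OF C(1) B _ S p BS C(4) SB] by blast
  thus ?case using C(2,5) by (intro exI[of _ D]) auto
qed

lemma sylow_pgroup: "sylow_subgroup G p S \<Longrightarrow> subgroup S G \<and> (\<exists>s. card S = p ^ s)"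
  by (auto simp: sylow_subgroup_def)

text \<open>Invariance under a Sylow \<open>p\<close>-subgroup and under \<open>O^p(G)\<close> adds
  up to normality.\<close>

lemma nml_gen:
  assumes "Factorial_Ring.prime p" "sylow_subgroup G p S" "subgroup Y G" "S \<subseteq> nrm G Y"
    "\<And>g. g \<in> carrier G \<Longrightarrow> g [^] (p ^ k :: nat) \<in> nrm G Y"
  shows "nml G Y"
  using gen_all[OF assms(1,2) subgroup_nrm[OF subgroup.subset[OF assms(3)]] assms(4,5)] assms(3) by (simp add: nml_def)

lemma normal_in_sylow:
  assumes "Factorial_Ring.prime p" "sylow_subgroup G p S" "nml G P" "card P = p ^ n"
  shows "P \<subseteq> S"
proof
  have P: "subgroup P G" using assms nml_subgroup by blast
  obtain g where g: "g \<in> carrier G" "\<forall>r\<in>P. cj G g r \<in> S" using sylow_conj[OF assms(1,2) P assms(4)] by blast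
  fix x assume x: "x \<in> P"
  have "cj G (inv g) x \<in> P" using nml_cj[OF assms(3) _ x] g by simp
  hence "cj G g (cj G (inv g) x) \<in> S" using g by blast
  thus "x \<in> S" using g subgroup.mem_carrier[OF P x] by simp
qed

lemma exists_order_p:
  assumes "subgroup P G" "card P = p ^ n" "P \<noteq> {\<one>}"
  shows "\<exists>z\<in>P. z \<noteq> \<one> \<and> z [^] (p::nat) = \<one>"
proof -
  obtain x where x: "x \<in> P" "x \<noteq> \<one>" using assms subgroup.one_closed by blast
  have xc: "x \<in> carrier G" using x subgroup.mem_carrier[OF assms(1)] by blast
  obtain j where "x [^] (p ^ j) \<notin> {\<one>}" "(x [^] (p ^ j)) [^] p \<in> {\<one>}"
    using pow_step[of x "{\<one>}" p n] x xc pow_order_sub[OF assms(1) x(1)] assms(2) by auto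
  thus ?thesis using pow_mem[OF assms(1) x(1)] by blast
qed

text \<open>The number of elements of \<open>V\<close> fixed by the \<open>p\<close>-group
  \<open>R\<close> is divisible by \<open>p\<close> because \<open>card V\<close> is, so the
  identity is not the only one.\<close>

lemma fixed_nontrivial:
  assumes R: "subgroup R G" "card R = p ^ r" and p: "Factorial_Ring.prime p"
    and V: "subgroup V G" "card V = p ^ n" "V \<noteq> {\<one>}" "R \<subseteq> nrm G V"
  shows "subgroup {v\<in>V. \<forall>x\<in>R. v \<otimes> x = x \<otimes> v} G" "{v\<in>V. \<forall>x\<in>R. v \<otimes> x = x \<otimes> v} \<noteq> {\<one>}"
proof -
  note Rc = subgroup.mem_carrier[OF R(1)]
  note Vc = subgroup.mem_carrier[OF V(1)]
  have ri: "inv s \<in> R" if "s \<in> R" for s using that subgroup.m_inv_closed[OF R(1)] by blast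
  show "subgroup {v\<in>V. \<forall>x\<in>R. v \<otimes> x = x \<otimes> v} G" using subgroup_centI[OF V(1)] Rc by blast
  have "p dvd card {v\<in>V. \<forall>g\<in>R. cj G (inv g) v = v} \<longleftrightarrow> p dvd card V"
  proof (rule pgroup_fixed[OF R p fin_sub[OF V(1)]])
    fix g x assume "g \<in> R" "x \<in> V"
    thus "cj G (inv g) x \<in> V" using nrmD ri V(4) by blast
  qed (auto simp: Vc Rc inv_mult_group cj_cj)
  moreover have "{v\<in>V. \<forall>g\<in>R. cj G (inv g) v = v} = {v\<in>V. \<forall>x\<in>R. v \<otimes> x = x \<otimes> v}"
  proof -
    have "cj G (inv g) v = v \<longleftrightarrow> v \<otimes> g = g \<otimes> v" if "g \<in> R" "v \<in> V" for g v
    proof -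
      have "cj G (inv g) v = v \<longleftrightarrow> cj G g v = v" using that Rc Vc by (metis cj_cj_inv cj_inv_cj)
      thus ?thesis using cj_fix_iff that Rc Vc by auto
    qed
    thus ?thesis by auto
  qed
  moreover have "p dvd card V" using V card_one_iff[OF V(1)] by (cases n) auto
  ultimately have "p dvd card {v\<in>V. \<forall>x\<in>R. v \<otimes> x = x \<otimes> v}" by simp
  moreover have "\<not> p dvd card {\<one>}" using not_prime_1 p by auto
  ultimately show "{v\<in>V. \<forall>x\<in>R. v \<otimes> x = x \<otimes> v} \<noteq> {\<one>}" by metis
qed

text \<open>The elements of \<open>V\<close> that centralise \<open>P\<close>, and then those with
  trivial \<open>p\<close>-th power, form nontrivial subgroups normal in \<open>G\<close>, so by
  minimality each is \<open>V\<close>. Centrality comes first because it makes the second set closed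
  under products.\<close>

lemma minnml_central:
  assumes p: "Factorial_Ring.prime p" and V: "minnml G V" "V \<subseteq> P" and P: "nml G P" "card P = p ^ n"
  shows "\<And>v x. v \<in> V \<Longrightarrow> x \<in> P \<Longrightarrow> v \<otimes> x = x \<otimes> v" "\<And>v. v \<in> V \<Longrightarrow> v [^] p = \<one>"
proof -
  have Ps: "subgroup P G" and Vs: "subgroup V G" and Vn: "nml G V" and V1: "V \<noteq> {\<one>}"
    using V P nml_subgroup by (auto simp: minnml_def)
  note Pc = subgroup.mem_carrier[OF Ps]
  note Vc = subgroup.mem_carrier[OF Vs]
  obtain m where m: "card V = p ^ m" using card_p_sub[OF Vs Ps V(2) P(2) p] by blast
  let ?W = "{v\<in>V. \<forall>x\<in>P. v \<otimes> x = x \<otimes> v}"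
  have PV: "P \<subseteq> nrm G V" using Vn Pc by (auto simp: nml_def)
  note W = fixed_nontrivial[OF Ps P(2) p Vs m V1 PV]
  have "nml G ?W"
  proof (rule nmlI[OF W(1)])
    fix g v assume g: "g \<in> carrier G" and v: "v \<in> ?W"
    have "cj G g v \<otimes> x = x \<otimes> cj G g v" if x: "x \<in> P" for x
    proof -
      have y: "cj G (inv g) x \<in> P" using nml_cj[OF P(1) _ x] g by simp
      hence "v \<otimes> cj G (inv g) x = cj G (inv g) x \<otimes> v" using v by blast
      hence "cj G g (v \<otimes> cj G (inv g) x) = cj G g (cj G (inv g) x \<otimes> v)" by simp
      thus ?thesis using g x v Pc Vc by (simp add: cj_mult)
    qed
    thus "cj G g v \<in> ?W" using nml_cj[OF Vn g] v by blast
  qed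
  hence WV: "?W = V" using W(2) V(1) unfolding minnml_def by blast
  show cm: "v \<otimes> x = x \<otimes> v" if "v \<in> V" "x \<in> P" for v x using that WV by blast
  let ?O = "{v\<in>V. v [^] p = \<one>}"
  have "subgroup ?O G"
  proof (rule fin_subgroupI)
    fix x y assume "x \<in> ?O" "y \<in> ?O"
    thus "x \<otimes> y \<in> ?O" using cm[of x y] V(2) Vc subgroup.m_closed[OF Vs]
      by (auto simp: pow_mult_distrib)
  qed (use Vc subgroup.one_closed[OF Vs] in auto)
  hence "nml G ?O"
  proof (rule nmlI)
    fix g x assume "g \<in> carrier G" "x \<in> ?O"
    thus "cj G g x \<in> ?O" using nml_cj[OF Vn] Vc by (auto simp flip: cj_pow)
  qed
  moreover have "?O \<noteq> {\<one>}" using exists_order_p[OF Vs m V1] by blast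
  ultimately have "?O = V" using V(1) unfolding minnml_def by blast
  thus "v [^] p = \<one>" if "v \<in> V" for v using that by blast
qed

text \<open>\<open>M\<close> is chosen of largest order among the subgroups above \<open>Y\<close>
  that avoid \<open>v\<close>. For \<open>t\<close> outside \<open>M\<close>, adjoining
  \<open>t\<close> captures \<open>v = a t^i\<close>. Here \<open>p\<close> does not divide
  \<open>i\<close>, or \<open>v\<close> would be in \<open>M\<close>; so \<open>t\<close> is
  recovered from \<open>M\<close> and \<open>v\<close>, and \<open>T\<close> is \<open>M\<close>
  with \<open>v\<close> adjoined.\<close>

lemma hyperplane:
  assumes T: "subgroup T G" and cm: "\<And>x y. x \<in> T \<Longrightarrow> y \<in> T \<Longrightarrow> x \<otimes> y = y \<otimes> x" and ex: "\<And>x. x \<in> T \<Longrightarrow> x [^] p = \<one>"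
    and Y: "subgroup Y G" "Y \<subseteq> T" and v: "v \<in> T" "v \<notin> Y" and p: "Factorial_Ring.prime (p::nat)"
  shows "\<exists>M. subgroup M G \<and> Y \<subseteq> M \<and> M \<subseteq> T \<and> v \<notin> M \<and> card T = p * card M"
proof -
  define Q where "Q M \<longleftrightarrow> subgroup M G \<and> Y \<subseteq> M \<and> M \<subseteq> T \<and> v \<notin> M" for M
  have "Q Y" using Y v by (auto simp: Q_def)
  moreover have "card M \<le> card T" if "Q M" for M using that card_mono[OF fin_sub[OF T], of M] by (simp add: Q_def)
  hence "\<forall>M. Q M \<longrightarrow> card M < Suc (card T)" by (simp add: less_Suc_eq_le)
  ultimately obtain M where M: "Q M" "\<And>L. Q L \<Longrightarrow> card L \<le> card M"
    using ex_has_greatest_nat[of Q Y card "Suc (card T)"] by blast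
  note Tc = subgroup.mem_carrier[OF T]
  have Ms: "subgroup M G" "M \<subseteq> T" "v \<notin> M" "Y \<subseteq> M" using M(1) by (auto simp: Q_def)
  have nr: "t \<in> nrm G M" if "t \<in> T" for t
  proof -
    have "cj G t a = a" if a: "a \<in> M" for a using cj_fix_iff[of t a] cm[of a t] a Ms \<open>t \<in> T\<close> Tc by auto
    thus ?thesis using that Tc by (auto simp: nrm_def)
  qed
  have pw: "t [^] p \<in> M" if "t \<in> T" for t using ex[OF that] subgroup.one_closed[OF Ms(1)] by simp
  have sub: "{a \<otimes> t [^] (i::nat) |a i. a \<in> M} \<subseteq> T" if t: "t \<in> T" for t
  proof clarify
    fix a and i :: nat assume "a \<in> M"
    hence "a \<in> T" using Ms by blast
    thus "a \<otimes> t [^] i \<in> T" using subgroup.m_closed[OF T] pow_mem[OF T t] by blast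
  qed
  note C = adjoin[OF Ms(1) nr[OF v(1)] p pw[OF v(1)] Ms(3)]
  let ?C = "{a \<otimes> v [^] (i::nat) |a i. a \<in> M}"
  have "t \<in> ?C" if t: "t \<in> T" for t
  proof (cases "t \<in> M")
    case False
    note D = adjoin[OF Ms(1) nr[OF t] p pw[OF t] False]
    let ?D = "{a \<otimes> t [^] (i::nat) |a i. a \<in> M}"
    have "\<not> card ?D \<le> card M" using D(2) card_sub_pos[OF Ms(1)] prime_gt_1_nat[OF p] by simp
    hence "v \<in> ?D" using M(2)[of ?D] D sub[OF t] Ms by (auto simp: Q_def)
    then obtain a i where ai: "v = a \<otimes> t [^] (i::nat)" "a \<in> M" by blast
    have ac: "a \<in> carrier G" using ai Ms Tc by blast
    have "coprime i p"
    proof (rule ccontr)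
      assume "\<not> coprime i p"
      hence "p dvd i" using p by (metis coprime_commute prime_imp_coprime)
      then obtain k where "i = p * k" by blast
      hence "t [^] i = \<one>" using ex[OF t] Tc[OF t] by (simp flip: nat_pow_pow)
      thus False using ai ac Ms by simp
    qed
    moreover have "t [^] i \<in> ?C"
    proof -
      have "inv a \<in> ?C" using subgroup.m_inv_closed[OF Ms(1) ai(2)] C(3) by blast
      moreover have "t [^] i = inv a \<otimes> v" using ai ac Tc[OF t] by (simp add: inv_cancel)
      ultimately show ?thesis using subgroup.m_closed[OF C(1) _ C(4), of "inv a"] by simp
    qed
    moreover have "t [^] p \<in> ?C" using pw[OF t] C(3) by blast
    ultimately show ?thesis using pow_coprime_mem[OF C(1) Tc[OF t]] by blast
  qed (use C(3) in blast)
  hence "T = ?C" using sub[OF v(1)] by blast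
  hence "card T = p * card M" using C(2) by simp
  thus ?thesis using Ms by blast
qed

text \<open>Sending \<open>v = a h\<close> to a chosen factor \<open>h\<close> is injective: if
  \<open>v\<close> and \<open>w\<close> have the same factor, then \<open>v w^-1\<close> lies in
  \<open>K\<close> and in \<open>V\<close>.\<close>

lemma cover_card:
  assumes K: "subgroup K G" and V: "subgroup V G" and H: "subgroup H G" and GKH: "\<And>g. g \<in> carrier G \<Longrightarrow> \<exists>a\<in>K. \<exists>h\<in>H. g = a \<otimes> h"
    and KV: "K \<inter> V = {\<one>}"
  shows "card V \<le> card H"
proof -
  note Vc = subgroup.mem_carrier[OF V]
  note Kc = subgroup.mem_carrier[OF K]
  note Hc = subgroup.mem_carrier[OF H]
  have "\<forall>v\<in>V. \<exists>h. h \<in> H \<and> (\<exists>a\<in>K. v = a \<otimes> h)" using GKH Vc by blast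
  then obtain f where f: "\<And>v. v \<in> V \<Longrightarrow> f v \<in> H \<and> (\<exists>a\<in>K. v = a \<otimes> f v)" by metis
  have "inj_on f V"
  proof (rule inj_onI)
    fix v w assume vw: "v \<in> V" "w \<in> V" "f v = f w"
    obtain a b where ab: "a \<in> K" "v = a \<otimes> f v" "b \<in> K" "w = b \<otimes> f v" using f[OF vw(1)] f[OF vw(2)] vw(3) by metis
    have h: "f v \<in> carrier G" using f[OF vw(1)] Hc by blast
    have "v \<otimes> inv w = a \<otimes> f v \<otimes> inv (b \<otimes> f v)" using ab by metis
    also have "\<dots> = a \<otimes> inv b" using h ab(1,3) Kc by (simp add: inv_mult_group m_assoc inv_cancel)
    finally have "v \<otimes> inv w = a \<otimes> inv b" .
    moreover have "a \<otimes> inv b \<in> K" using ab subgroup.m_closed[OF K] subgroup.m_inv_closed[OF K] by blast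
    moreover have "v \<otimes> inv w \<in> V" using vw subgroup.m_closed[OF V] subgroup.m_inv_closed[OF V] by blast
    ultimately have "v \<otimes> inv w = \<one>" using KV by auto
    thus "v = w" using vw Vc inv_equality[of v "inv w"] by simp
  qed
  thus ?thesis using card_inj_on_le[of f V H] f fin_sub[OF H] by blast
qed

lemma psupE:
  assumes "psup G p H" "subgroup H G"
  obtains K Y k where "subgroup K G" "subgroup Y G" "Y \<subseteq> H" "\<And>g. g \<in> carrier G \<Longrightarrow> g [^] (p ^ k :: nat) \<in> nrm G Y"
    "\<And>g. g \<in> carrier G \<Longrightarrow> \<exists>a\<in>K. \<exists>h\<in>H. g = a \<otimes> h"
    "\<And>M. subgroup M G \<Longrightarrow> Y \<subseteq> M \<Longrightarrow> M \<subseteq> H \<Longrightarrow> card H = p * card M \<Longrightarrow> K \<inter> H \<subseteq> M"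
  using assms unfolding psup_def by (elim exE conjE) blast

text \<open>A proper subgroup \<open>Y\<close> would lie in a subgroup of index \<open>p\<close> of
  \<open>H\<close>, which by the condition on \<open>M\<close> would contain
  \<open>K \<inter> H\<close>, that is all of \<open>H\<close>.\<close>

lemma psup_full:
  assumes p: "Factorial_Ring.prime p" and H: "subgroup H G" "card H = p ^ n" "H \<subseteq> K" and Y: "subgroup Y G" "Y \<subseteq> H"
    and M: "\<And>M. subgroup M G \<Longrightarrow> Y \<subseteq> M \<Longrightarrow> M \<subseteq> H \<Longrightarrow> card H = p * card M \<Longrightarrow> K \<inter> H \<subseteq> M"
  shows "Y = H"
proof (rule ccontr)
  assume "Y \<noteq> H"
  obtain a where a: "card Y = p ^ a" "a \<le> n" using card_p_sub[OF Y(1) H(1) Y(2) H(2) p] by blast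
  have "a \<noteq> n" using a sub_eq[OF H(1) Y(2)] \<open>Y \<noteq> H\<close> H(2) by auto
  hence "a \<le> n - 1" "n - 1 \<le> n" "n \<noteq> 0" using a by auto
  then obtain L where L: "subgroup L G" "Y \<subseteq> L" "L \<subseteq> H" "card L = p ^ (n - 1)"
    using step_between[OF Y(1) H(1) Y(2) a(1) H(2) p] by blast
  have cL: "card H = p * card L" using L H(2) \<open>n \<noteq> 0\<close> by (simp add: power_eq_if)
  hence "H \<subseteq> L" using M[OF L(1-3)] H(3) by blast
  hence "card H = card L" using L by simp
  thus False using cL card_sub_pos[OF L(1)] prime_gt_1_nat[OF p] by simp
qed

text \<open>In an elementary abelian group every subgroup is the intersection of the hyperplanes
  containing it, so the condition on all \<open>M\<close> becomes one on \<open>Y\<close>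
  itself.\<close>

lemma psup_elementary:
  assumes p: "Factorial_Ring.prime p" and H: "subgroup H G" and cm: "\<And>x y. x \<in> H \<Longrightarrow> y \<in> H \<Longrightarrow> x \<otimes> y = y \<otimes> x" and ex: "\<And>x. x \<in> H \<Longrightarrow> x [^] p = \<one>"
    and Y: "subgroup Y G" "Y \<subseteq> H"
    and M: "\<And>M. subgroup M G \<Longrightarrow> Y \<subseteq> M \<Longrightarrow> M \<subseteq> H \<Longrightarrow> card H = p * card M \<Longrightarrow> K \<inter> H \<subseteq> M"
  shows "K \<inter> H \<subseteq> Y"
proof
  fix v assume v: "v \<in> K \<inter> H"
  show "v \<in> Y"
  proof (rule ccontr)
    assume "v \<notin> Y"
    thus False using hyperplane[OF H cm ex Y _ _ p, of v] v M by blast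
  qed
qed

text \<open>\<open>V\<close> is abelian, so \<open>H\<close> centralises it, and as
  \<open>G = KH\<close> the subgroup \<open>K \<inter> V\<close> is normal in \<open>G\<close>. If
  it is trivial, then \<open>card V \<le> card H\<close>. If it is \<open>V\<close>, then
  \<open>H\<close> lies in \<open>K\<close>, so \<open>O^p(G)\<close> normalises \<open>H\<close>,
  as does \<open>S\<close>, and minimality applies.\<close>

lemma minnml_psup:
  assumes p: "Factorial_Ring.prime p" and S: "sylow_subgroup G p S" and V: "minnml G V" "card V = p ^ n"
    and H: "subgroup H G" "H \<subseteq> V" "H \<noteq> {\<one>}" "S \<subseteq> nrm G H" "psup G p H"
  shows "H = V"
proof -
  have Vn: "nml G V" and Vs: "subgroup V G" using V nml_subgroup by (auto simp: minnml_def)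
  note Vc = subgroup.mem_carrier[OF Vs]
  obtain h where h: "card H = p ^ h" using card_p_sub[OF H(1) Vs H(2) V(2) p] by blast
  obtain K Y k where K: "subgroup K G" "subgroup Y G" "Y \<subseteq> H" "\<And>g. g \<in> carrier G \<Longrightarrow> g [^] (p ^ k :: nat) \<in> nrm G Y"
    and KH: "\<And>g. g \<in> carrier G \<Longrightarrow> \<exists>a\<in>K. \<exists>h\<in>H. g = a \<otimes> h"
    and M: "\<And>M. subgroup M G \<Longrightarrow> Y \<subseteq> M \<Longrightarrow> M \<subseteq> H \<Longrightarrow> card H = p * card M \<Longrightarrow> K \<inter> H \<subseteq> M"
    using psupE[OF H(5,1)] by blast
  note Kc = subgroup.mem_carrier[OF K(1)]
  have "nml G (K \<inter> V)"
  proof (rule nmlI[OF subgroups_Inter_pair[OF K(1) Vs]])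
    fix g v assume g: "g \<in> carrier G" and v: "v \<in> K \<inter> V"
    obtain a b where ab: "a \<in> K" "b \<in> H" "g = a \<otimes> b" using KH[OF g] by blast
    have w: "cj G a v \<in> V" "cj G a v \<in> K" using nml_cj[OF Vn] v ab Kc cj_mem[OF K(1)] by auto
    have bV: "b \<in> V" using ab H(2) by blast
    have "cj G b (cj G a v) = cj G a v"
      using cj_fix_iff[of b "cj G a v"] w bV Vc minnml_central(1)[OF p V(1) order_refl Vn V(2), of "cj G a v" b] by auto
    thus "cj G g v \<in> K \<inter> V" using w ab Kc Vc bV v by (simp add: cj_cj)
  qed
  hence "K \<inter> V = {\<one>} \<or> K \<inter> V = V" using V(1) unfolding minnml_def by blast
  thus ?thesis
  proof
    assume "K \<inter> V = {\<one>}"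
    from cover_card[OF K(1) Vs H(1) KH this] show ?thesis using sub_eq[OF Vs H(2)] by simp
  next
    assume KV: "K \<inter> V = V"
    have "H \<subseteq> K" using KV H by blast
    hence "Y = H" using psup_full[OF p H(1) h _ K(2,3) M] by blast
    hence "nml G H" using nml_gen[OF p S H(1,4)] K(4) by blast
    thus ?thesis using V(1) H unfolding minnml_def by blast
  qed
qed

end

section \<open>Quotients and invariant series\<close>

locale quot = fin_group G + Q: fin_group Q
  for G :: "('a, 'b) monoid_scheme" (structure) and Q :: "('a, 'b) monoid_scheme" +
  fixes \<phi> :: "'a \<Rightarrow> 'a" and N :: "'a set"
  assumes hom: "\<phi> \<in> hom G Q" and surj: "\<phi> ` carrier G = carrier Q"
    and ker: "x \<in> carrier G \<Longrightarrow> \<phi> x = \<one>\<^bsub>Q\<^esub> \<longleftrightarrow> x \<in> N" and nmlN: "nml G N"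

lemma (in fin_group) nml_normal: "nml G N \<Longrightarrow> N \<lhd> G"
  using nrm_imp_normal[of N "carrier G"] subgroup_self subgroup.subset by (auto simp: nml_def)

text \<open>The quotient is built on coset representatives, not on cosets: keeping the type of \<open>G\<close> is what
  makes inductions over quotients possible.\<close>

lemma (in fin_group) quot_exists:
  assumes "nml G N"
  obtains Q \<phi> where "quot G Q \<phi> N"
proof -
  interpret normal N G using nml_normal assms by blast
  define r where "r g = (SOME x. x \<in> N #> g)" for g
  \<comment> \<open>Representatives multiply in \<open>G\<close> only up to \<open>N\<close>.
    Choosing the representative again after each product makes \<open>r\<close> a homomorphism into
    this auxiliary structure, whose unit is corrected in \<open>Q\<close>.\<close>
  define H where "H = G\<lparr>carrier := r ` carrier G, monoid.mult := \<lambda>x y. r (x \<otimes> y)\<rparr>"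
  define Q where "Q = H\<lparr>carrier := r ` carrier G, one := r \<one>\<rparr>"
  have sub: "subgroup N G" using assms nml_subgroup by blast
  have rin: "r g \<in> N #> g" if "g \<in> carrier G" for g
    unfolding r_def using rcos_self[OF that sub] by (rule someI)
  have rc: "r g \<in> carrier G" if "g \<in> carrier G" for g
    using rin[OF that] subgroup.elemrcos_carrier[OF sub is_group] that by blast
  have rr: "N #> r g = N #> g" if "g \<in> carrier G" for g
    using repr_independence[OF rin[OF that] that sub] by simp
  have cong: "r g = r h" if "N #> g = N #> h" for g h using that by (simp add: r_def)
  have rmult: "r (g \<otimes> h) = r (r g \<otimes> r h)" if "g \<in> carrier G" "h \<in> carrier G" for g h
    by (rule cong) (use that rcos_sum[of g h] rcos_sum[of "r g" "r h"] rr rc in simp)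
  have "r \<in> hom G H" using rmult by (auto simp: hom_def H_def)
  from hom_imp_img_group[OF this] have "group Q" by (simp add: Q_def)
  moreover have "r \<in> hom G Q" using rmult by (auto simp: hom_def H_def Q_def)
  moreover have "r ` carrier G = carrier Q" by (simp add: Q_def)
  moreover have "r x = \<one>\<^bsub>Q\<^esub> \<longleftrightarrow> x \<in> N" if "x \<in> carrier G" for x
  proof -
    have "r x = r \<one> \<longleftrightarrow> N #> x = N #> \<one>" using cong[of x \<one>] rr[of x] rr[of \<one>] that by auto
    also have "\<dots> \<longleftrightarrow> x \<in> N" using that sub coset_join1[OF _ _ sub] coset_join2[OF _ sub] subgroup.subset[OF sub] by auto
    finally show ?thesis by (simp add: Q_def)
  qed
  moreover have "finite (carrier Q)" using fin by (simp add: Q_def)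
  ultimately have "quot G Q r N"
    using assms fin_group_axioms by (simp add: quot_def quot_axioms_def fin_group_def fin_group_axioms_def)
  thus ?thesis using that by blast
qed

text \<open>The lower end is a parameter so that a series pulled back from a quotient, which starts
  at the kernel, can be joined to a series below the kernel.\<close>

inductive rchain :: "('a, 'b) monoid_scheme \<Rightarrow> nat \<Rightarrow> 'a set \<Rightarrow> 'a set \<Rightarrow> bool"
  for G :: "('a, 'b) monoid_scheme" and p :: nat and R :: "'a set" where
  rchain_base: "nml G R \<Longrightarrow> rchain G p R R"
| rchain_step: "rchain G p R A \<Longrightarrow> nml G B \<Longrightarrow> A \<subseteq> B \<Longrightarrow> card B = p * card A \<Longrightarrow> rchain G p R B"

context fin_group
begin

lemma rchain_nml: "rchain G p R P \<Longrightarrow> nml G P \<and> nml G R \<and> R \<subseteq> P"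
  by (induction rule: rchain.induct) auto

lemma rchain_card: "rchain G p R P \<Longrightarrow> \<exists>m. card P = p ^ m * card R"
proof (induction rule: rchain.induct)
  case rchain_base
  show ?case by (intro exI[of _ 0]) simp
next
  case (rchain_step A B)
  then obtain m where "card A = p ^ m * card R" by blast
  thus ?case using rchain_step by (intro exI[of _ "Suc m"]) simp
qed

lemma rchain_trans: "rchain G p B C \<Longrightarrow> rchain G p A B \<Longrightarrow> rchain G p A C"
  by (induction rule: rchain.induct) (auto intro: rchain.intros)

lemma rchain_mid:
  assumes "rchain G p R P" "Factorial_Ring.prime p"
  shows "card P = p ^ m * card R \<Longrightarrow> i \<le> m \<Longrightarrow> \<exists>T. T \<subseteq> P \<and> rchain G p R T \<and> card T = p ^ i * card R"
  using assms(1)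
proof (induction arbitrary: m rule: rchain.induct)
  case rchain_base
  moreover have "card R > 0" using rchain_base card_sub_pos nml_subgroup by blast
  ultimately have "p ^ m = 1" by simp
  hence "m = 0" using prime_gt_1_nat[OF assms(2)] by (cases m) auto
  hence "i = 0" using rchain_base by simp
  thus ?case using rchain_base rchain.intros(1) by (intro exI[of _ R]) simp
next
  case (rchain_step A B)
  show ?case
  proof (cases "i = m")
    case True
    thus ?thesis using rchain.intros(2)[OF rchain_step.hyps] rchain_step.prems by (intro exI[of _ B]) auto
  next
    case False
    hence m: "m = Suc (m - 1)" "i \<le> m - 1" using rchain_step by auto
    have "p * card A = p * (p ^ (m - 1) * card R)" 
      using rchain_step.prems(1) rchain_step.hyps(4) by (subst (asm) m(1)) auto
    hence "card A = p ^ (m - 1) * card R" using assms(2) by auto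
    then obtain T where "T \<subseteq> A" "rchain G p R T" "card T = p ^ i * card R"
      using rchain_step.IH m(2) by blast
    thus ?thesis using rchain_step.hyps(3) by blast
  qed
qed

text \<open>Let \<open>B\<close> be the first term containing \<open>V\<close> and \<open>A\<close>
  the term before it. Minimality gives trivial intersection of \<open>A\<close> and
  \<open>V\<close>, so \<open>card A * card V\<close> is at most
  \<open>card B = p * card A\<close>.\<close>

lemma rchain_min:
  assumes "rchain G p R P" "Factorial_Ring.prime p" "minnml G V" "V \<inter> R = {\<one>}" "card V = p ^ n" "V \<subseteq> P"
  shows "card V = p"
  using assms(1,6)
proof (induction rule: rchain.induct)
  case rchain_base
  thus ?case using assms unfolding minnml_def by blast
next
  case (rchain_step A B)
  have An: "nml G A" using rchain_nml rchain_step by blast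
  show ?case
  proof (cases rule: minnml_cases[OF assms(3) An])
    case 1
    thus ?thesis using rchain_step by blast
  next
    case 2
    have s: "subgroup A G" "subgroup B G" "subgroup V G"
      using rchain_step rchain_nml nml_subgroup assms(3) minnml_nml by blast+
    have "card A * card V \<le> p * card A" using card_mult_le[OF s(1,3,2)] rchain_step 2 by auto
    hence "p ^ n \<le> p ^ 1" using card_sub_pos[OF s(1)] assms(5) by (simp add: mult.commute)
    hence "n \<le> 1" using assms(2) prime_gt_1_nat power_le_imp_le_exp by blast
    moreover have "n \<noteq> 0" using assms(3,5) card_one_iff[OF s(3)] by (auto simp: minnml_def)
    ultimately have "n = 1" by simp
    thus ?thesis using assms(5) by simp
  qed
qed

end

section \<open>Images and preimages under the quotient map\<close>

context quot
begin

sublocale gh: group_hom G Q \<phi>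
  by unfold_locales (rule hom)

lemma hom_cj: "\<lbrakk>g \<in> carrier G; x \<in> carrier G\<rbrakk> \<Longrightarrow> \<phi> (cj G g x) = cj Q (\<phi> g) (\<phi> x)"
  by (simp add: cj_def)

lemma hom_eq_iff: "\<lbrakk>x \<in> carrier G; y \<in> carrier G\<rbrakk> \<Longrightarrow> \<phi> x = \<phi> y \<longleftrightarrow> x \<otimes> inv y \<in> N"
proof -
  assume a: "x \<in> carrier G" "y \<in> carrier G"
  have "x \<otimes> inv y \<in> N \<longleftrightarrow> \<phi> x \<otimes>\<^bsub>Q\<^esub> inv\<^bsub>Q\<^esub> \<phi> y = \<one>\<^bsub>Q\<^esub>" using ker[of "x \<otimes> inv y"] a by simp
  also have "\<dots> \<longleftrightarrow> \<phi> x = \<phi> y" using a Q.inv_equality[of "\<phi> x" "inv\<^bsub>Q\<^esub> \<phi> y"] by auto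
  finally show ?thesis by simp
qed

definition vim :: "'a set \<Rightarrow> 'a set" where
  "vim H = {x \<in> carrier G. \<phi> x \<in> H}"

lemma vim_subgroup: "subgroup H Q \<Longrightarrow> subgroup (vim H) G"
  by (rule fin_subgroupI) (auto simp: vim_def subgroup.one_closed subgroup.m_closed)

lemma img_subgroup: "subgroup H G \<Longrightarrow> subgroup (\<phi> ` H) Q"
  by (rule gh.subgroup_img_is_subgroup)

lemma N_vim:
  assumes "subgroup H Q"
  shows "N \<subseteq> vim H"
proof
  fix x assume x: "x \<in> N"
  hence xc: "x \<in> carrier G" using subgroup.mem_carrier[OF nml_subgroup[OF nmlN]] by blast
  hence "\<phi> x = \<one>\<^bsub>Q\<^esub>" using ker x by blast
  thus "x \<in> vim H" using xc subgroup.one_closed[OF assms] by (simp add: vim_def)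
qed

lemma img_vim: "H \<subseteq> carrier Q \<Longrightarrow> \<phi> ` vim H = H"
  using surj by (auto simp: vim_def)

lemma vim_img:
  assumes "subgroup H G" "N \<subseteq> H"
  shows "vim (\<phi> ` H) = H"
proof
  show "H \<subseteq> vim (\<phi> ` H)" using subgroup.subset[OF assms(1)] by (auto simp: vim_def)
  show "vim (\<phi> ` H) \<subseteq> H"
  proof
    fix x assume "x \<in> vim (\<phi> ` H)"
    then obtain h where h: "x \<in> carrier G" "h \<in> H" "\<phi> x = \<phi> h" by (auto simp: vim_def)
    have hc: "h \<in> carrier G" using h subgroup.mem_carrier[OF assms(1)] by blast
    have "x \<otimes> inv h \<in> H" using hom_eq_iff[OF h(1) hc] h assms(2) by auto
    hence "x \<otimes> inv h \<otimes> h \<in> H" using h subgroup.m_closed[OF assms(1)] by blast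
    thus "x \<in> H" using h hc by (simp add: m_assoc)
  qed
qed

lemma vim_one: "vim {\<one>\<^bsub>Q\<^esub>} = N"
  using ker subgroup.mem_carrier[OF nml_subgroup[OF nmlN]] by (auto simp: vim_def)

lemma vim_mono: "A \<subseteq> B \<Longrightarrow> vim A \<subseteq> vim B"
  by (auto simp: vim_def)

lemma img_card_Int:
  assumes "subgroup H G"
  shows "card H = card (H \<inter> N) * card (\<phi> ` H)"
proof -
  note Hc = subgroup.mem_carrier[OF assms(1)]
  have fib: "card {x\<in>H. \<phi> x = y} = card (H \<inter> N)" if y: "y \<in> \<phi> ` H" for y
  proof -
    obtain h where h: "h \<in> H" "y = \<phi> h" using y by blast
    have "bij_betw (\<lambda>n. n \<otimes> h) (H \<inter> N) {x\<in>H. \<phi> x = y}"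
    proof (rule bij_betwI[where g = "\<lambda>x. x \<otimes> inv h"])
      show "(\<lambda>n. n \<otimes> h) \<in> H \<inter> N \<rightarrow> {x\<in>H. \<phi> x = y}"
        using h Hc ker subgroup.m_closed[OF assms(1)] by auto
      show "(\<lambda>x. x \<otimes> inv h) \<in> {x\<in>H. \<phi> x = y} \<rightarrow> H \<inter> N"
        using hom_eq_iff h Hc subgroup.m_closed[OF assms(1)] subgroup.m_inv_closed[OF assms(1)] by auto
    qed (use h Hc in \<open>auto simp: m_assoc\<close>)
    thus ?thesis using bij_betw_same_card by metis
  qed
  have "card H = (\<Sum>y\<in>\<phi> ` H. card {x\<in>H. \<phi> x = y})"
    using sum.image_gen[OF fin_sub[OF assms(1)], of "\<lambda>_. 1::nat" \<phi>] by simp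
  also have "\<dots> = card (H \<inter> N) * card (\<phi> ` H)" using fib by simp
  finally show ?thesis .
qed

lemma img_card:
  assumes "subgroup H G" "N \<subseteq> H"
  shows "card H = card N * card (\<phi> ` H)"
  using img_card_Int[OF assms(1)] assms(2) by (simp add: Int_absorb1)

lemma img_card_p:
  assumes "subgroup R G" "card R = p ^ r" "Factorial_Ring.prime (p::nat)"
  obtains r' where "card (\<phi> ` R) = p ^ r'"
proof -
  have "card (\<phi> ` R) dvd p ^ r" using img_card_Int[OF assms(1)] assms(2) by (metis dvd_triv_right)
  thus ?thesis using assms(3) divides_primepow_nat that by blast
qed

lemma vim_card: "subgroup H Q \<Longrightarrow> card (vim H) = card N * card H"
  using img_card[OF vim_subgroup N_vim, of H] img_vim[OF subgroup.subset, of H] by simp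

lemma vim_nml: "nml Q H \<Longrightarrow> nml G (vim H)"
proof (rule nmlI)
  assume H: "nml Q H"
  show "subgroup (vim H) G" using vim_subgroup Q.nml_subgroup H by blast
  fix g x assume "g \<in> carrier G" "x \<in> vim H"
  thus "cj G g x \<in> vim H" using Q.nml_cj[OF H] by (auto simp: vim_def hom_cj)
qed

lemma img_nml: "nml G H \<Longrightarrow> nml Q (\<phi> ` H)"
proof (rule Q.nmlI)
  assume H: "nml G H"
  show "subgroup (\<phi> ` H) Q" using img_subgroup nml_subgroup H by blast
  fix g x assume "g \<in> carrier Q" "x \<in> \<phi> ` H"
  then obtain g' x' where g: "g' \<in> carrier G" "x' \<in> H" "g = \<phi> g'" "x = \<phi> x'" using surj by blast
  hence "x' \<in> carrier G" using subgroup.mem_carrier[OF nml_subgroup[OF H]] by blast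
  hence "cj Q g x = \<phi> (cj G g' x')" using g hom_cj by simp
  thus "cj Q g x \<in> \<phi> ` H" using nml_cj[OF H] g by blast
qed

text \<open>The witnesses are the images of \<open>K\<close> and \<open>Y\<close>. As
  \<open>N\<close> lies in \<open>H\<close>, subgroups of index \<open>p\<close> in the image pull
  back to subgroups of index \<open>p\<close> in \<open>H\<close>, and the images of
  \<open>K\<close> and \<open>H\<close> meet only in the image of
  \<open>K \<inter> H\<close>.\<close>

lemma psup_img:
  assumes H: "subgroup H G" and NH: "N \<subseteq> H" and ps: "psup G p H"
  shows "psup Q p (\<phi> ` H)"
proof -
  obtain K Y k where K: "subgroup K G" and Y: "subgroup Y G" "Y \<subseteq> H" 
    and nY: "\<And>g. g \<in> carrier G \<Longrightarrow> g [^] (p ^ k :: nat) \<in> nrm G Y"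
    and KH: "\<And>g. g \<in> carrier G \<Longrightarrow> \<exists>a\<in>K. \<exists>h\<in>H. g = a \<otimes> h"
    and M: "\<And>M. subgroup M G \<Longrightarrow> Y \<subseteq> M \<Longrightarrow> M \<subseteq> H \<Longrightarrow> card H = p * card M \<Longrightarrow> K \<inter> H \<subseteq> M"
    using psupE[OF ps H] by blast
  note Kc = subgroup.mem_carrier[OF K]
  note Hc = subgroup.mem_carrier[OF H]
  note Yc = subgroup.mem_carrier[OF Y(1)]
  show ?thesis unfolding psup_def
  proof (rule exI[of _ "\<phi> ` K"], rule exI[of _ "\<phi> ` Y"], rule exI[of _ k], intro conjI ballI allI impI)
    show "subgroup (\<phi> ` K) Q" "subgroup (\<phi> ` Y) Q" using img_subgroup K Y by blast+
    show "\<phi> ` Y \<subseteq> \<phi> ` H" using Y by blast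
  next
    fix g assume "g \<in> carrier Q"
    then obtain g' where g: "g' \<in> carrier G" "g = \<phi> g'" using surj by blast
    have e: "g [^]\<^bsub>Q\<^esub> (p ^ k) = \<phi> (g' [^] (p ^ k))" using g gh.hom_nat_pow by simp
    have "cj Q (g [^]\<^bsub>Q\<^esub> (p ^ k)) (\<phi> y) \<in> \<phi> ` Y" if "y \<in> Y" for y
    proof -
      have "cj Q (g [^]\<^bsub>Q\<^esub> (p ^ k)) (\<phi> y) = \<phi> (cj G (g' [^] (p ^ k)) y)" using that g Yc by (simp add: gh.hom_nat_pow hom_cj)
      thus ?thesis using nrmD[OF nY[OF g(1)] that] by blast
    qed
    thus "g [^]\<^bsub>Q\<^esub> (p ^ k) \<in> nrm Q (\<phi> ` Y)" using g by (auto simp: nrm_def e)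
    obtain a h where "a \<in> K" "h \<in> H" "g' = a \<otimes> h" using KH[OF g(1)] by blast
    thus "\<exists>a\<in>\<phi> ` K. \<exists>h\<in>\<phi> ` H. g = a \<otimes>\<^bsub>Q\<^esub> h" using g Kc Hc by auto
  next
    fix M' assume M': "subgroup M' Q" "\<phi> ` Y \<subseteq> M'" "M' \<subseteq> \<phi> ` H" "card (\<phi> ` H) = p * card M'"
    have "K \<inter> H \<subseteq> vim M'"
    proof (rule M[OF vim_subgroup[OF M'(1)]])
      show "Y \<subseteq> vim M'" using M'(2) Yc by (auto simp: vim_def)
      show "vim M' \<subseteq> H" using vim_mono[OF M'(3)] vim_img[OF H NH] by simp
      show "card H = p * card (vim M')" using img_card[OF H NH] vim_card[OF M'(1)] M'(4) by simp
    qed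
    moreover have "a \<in> H" if "a \<in> K" "\<phi> a \<in> \<phi> ` H" for a
      using that Kc vim_img[OF H NH] by (auto simp: vim_def)
    ultimately show "\<phi> ` K \<inter> \<phi> ` H \<subseteq> M'" by (fastforce simp: vim_def)
  qed
qed

lemma rchain_vim: "rchain Q p A B \<Longrightarrow> rchain G p (vim A) (vim B)"
proof (induction rule: rchain.induct)
  case rchain_base
  thus ?case using vim_nml rchain.intros(1) by blast
next
  case (rchain_step B C)
  have "subgroup B Q" "subgroup C Q" using Q.nml_subgroup Q.rchain_nml rchain_step.hyps by blast+
  hence "card (vim C) = p * card (vim B)" using vim_card rchain_step.hyps(4) by simp
  thus ?case
    using rchain.intros(2)[OF rchain_step.IH vim_nml[OF rchain_step.hyps(2)] vim_mono[OF rchain_step.hyps(3)]] by simp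
qed

end

text \<open>Equivalently, the group induced by \<open>G\<close> on \<open>P\<close> has a normal Sylow \<open>p\<close>-subgroup.\<close>

definition Wemb :: "('a, 'b) monoid_scheme \<Rightarrow> nat \<Rightarrow> 'a set \<Rightarrow> bool" where
  "Wemb G p P \<longleftrightarrow> (\<exists>N k. nml G N \<and> (\<forall>R a. subgroup R G \<longrightarrow> card R = p ^ a \<longrightarrow> R \<subseteq> N) \<and>
     (\<forall>g\<in>N. \<forall>x\<in>P. cj G (g [^]\<^bsub>G\<^esub> (p ^ k :: nat)) x = x))"

context fin_group
begin

lemma WembE:
  assumes "Wemb G p P"
  obtains N k where "nml G N" "\<And>R a. subgroup R G \<Longrightarrow> card R = p ^ a \<Longrightarrow> R \<subseteq> N"
    "\<And>g x. g \<in> N \<Longrightarrow> x \<in> P \<Longrightarrow> cj G (g [^] (p ^ k :: nat)) x = x"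
  using assms unfolding Wemb_def by (elim exE conjE) (rule that, assumption, blast, blast)

text \<open>\<open>N\<close> is shrunk to its elements acting trivially on \<open>B\<close> modulo
  \<open>A\<close>. All \<open>p\<close>-subgroups remain inside, since a \<open>p\<close>-group
  acts trivially on a group of order \<open>p\<close>. If \<open>h\<close> in the new subgroup also
  acts trivially on \<open>A\<close>, it maps \<open>w\<close> to \<open>u w\<close> with
  \<open>u\<close> in \<open>A\<close> fixed by \<open>h\<close>; so \<open>h [^] n\<close> maps
  \<open>w\<close> to \<open>u^n w\<close>, and \<open>n = card A\<close> gives the
  identity.\<close>

lemma Wemb_step:
  assumes p: "Factorial_Ring.prime p" and A: "nml G A" "card A = p ^ a" and B: "nml G B" "A \<subseteq> B" "card B = p * card A"
    and W: "Wemb G p A"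
  shows "Wemb G p B"
proof -
  obtain N k where N: "nml G N" "\<And>R a. subgroup R G \<Longrightarrow> card R = p ^ a \<Longrightarrow> R \<subseteq> N"
     "\<And>g x. g \<in> N \<Longrightarrow> x \<in> A \<Longrightarrow> cj G (g [^] (p ^ k :: nat)) x = x" by (rule WembE[OF W]) (rule that)
  have As: "subgroup A G" and Bs: "subgroup B G" and Ns: "subgroup N G" using A B N nml_subgroup by auto
  note Ac = subgroup.mem_carrier[OF As]
  note Bc = subgroup.mem_carrier[OF Bs]
  note Nc = subgroup.mem_carrier[OF Ns]
  obtain Q \<phi> where "quot G Q \<phi> A" using quot_exists A by blast
  then interpret q: quot G Q \<phi> A .
  let ?N = "{g\<in>N. \<forall>w\<in>B. \<phi> (cj G g w) = \<phi> w}"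
  have Nsub: "subgroup ?N G"
  proof (rule fin_subgroupI)
    show "\<one> \<in> ?N" using subgroup.one_closed[OF Ns] Bc by auto
    fix x y assume xy: "x \<in> ?N" "y \<in> ?N"
    have "\<phi> (cj G (x \<otimes> y) w) = \<phi> w" if "w \<in> B" for w
      using xy Nc Bc that nml_cj[OF B(1)] by (simp flip: cj_cj)
    thus "x \<otimes> y \<in> ?N" using xy subgroup.m_closed[OF Ns] by blast
  qed (use Nc in auto)
  have "nml G ?N"
  proof (rule nmlI[OF Nsub])
    fix x g assume x: "x \<in> carrier G" and g: "g \<in> ?N"
    have "\<phi> (cj G (cj G x g) w) = \<phi> w" if w: "w \<in> B" for w
    proof -
      have gc: "g \<in> carrier G" using g Nc by blast
      have u: "cj G (inv x) w \<in> B" using nml_cj[OF B(1)] x w by simp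
      have "cj G (cj G x g) w = cj G x (cj G g (cj G (inv x) w))"
        using x gc Bc[OF w] by (simp add: cj_cj) (simp add: cj_def)
      hence "\<phi> (cj G (cj G x g) w) = cj Q (\<phi> x) (\<phi> (cj G g (cj G (inv x) w)))"
        using x gc Bc[OF w] by (simp add: q.hom_cj)
      also have "\<phi> (cj G g (cj G (inv x) w)) = \<phi> (cj G (inv x) w)" using g u by blast
      also have "cj Q (\<phi> x) (\<phi> (cj G (inv x) w)) = \<phi> w" using x Bc[OF w] by (simp flip: q.hom_cj)
      finally show ?thesis .
    qed
    thus "cj G x g \<in> ?N" using nml_cj[OF N(1) x] g by blast
  qed
  moreover have "R \<subseteq> ?N" if R: "subgroup R G" "card R = p ^ r" for R r
  proof
    fix s assume s: "s \<in> R"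
    have Rs: "subgroup (\<phi> ` R) Q" using q.img_subgroup R by blast
    obtain r' where r': "card (\<phi> ` R) = p ^ r'" using q.img_card_p[OF R p] by blast
    have Bi: "nml Q (\<phi> ` B)" using q.img_nml B by blast
    have cB: "card (\<phi> ` B) = p ^ 1" using q.img_card[OF Bs B(2)] B(3) card_sub_pos[OF As] by simp
    have "\<phi> ` R \<subseteq> nrm Q (\<phi> ` B)" using Bi subgroup.subset[OF Rs] by (auto simp: nml_def)
    moreover have "\<phi> ` B \<noteq> {\<one>\<^bsub>Q\<^esub>}"
    proof
      assume "\<phi> ` B = {\<one>\<^bsub>Q\<^esub>}"
      thus False using cB p by auto
    qed
    ultimately have F: "subgroup {v \<in> \<phi> ` B. \<forall>x\<in>\<phi> ` R. v \<otimes>\<^bsub>Q\<^esub> x = x \<otimes>\<^bsub>Q\<^esub> v} Q" (is "subgroup ?F Q")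
       "{v \<in> \<phi> ` B. \<forall>x\<in>\<phi> ` R. v \<otimes>\<^bsub>Q\<^esub> x = x \<otimes>\<^bsub>Q\<^esub> v} \<noteq> {\<one>\<^bsub>Q\<^esub>}"
      using q.Q.fixed_nontrivial[OF Rs r' p q.Q.nml_subgroup[OF Bi] cB] by blast+
    have "card ?F dvd p" using q.Q.card_dvd[OF F(1) q.Q.nml_subgroup[OF Bi]] cB by auto
    moreover have "card ?F \<noteq> 1" using q.Q.card_one_iff[OF F(1)] F(2) by blast
    ultimately have "card ?F = card (\<phi> ` B)" using p cB prime_nat_iff by auto
    hence FB: "?F = \<phi> ` B" using q.Q.sub_eq[OF q.Q.nml_subgroup[OF Bi], of ?F] by auto
    have "\<phi> (cj G s w) = \<phi> w" if w: "w \<in> B" for w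
    proof -
      have "\<phi> w \<in> ?F" using FB w by blast
      hence "\<phi> w \<otimes>\<^bsub>Q\<^esub> \<phi> s = \<phi> s \<otimes>\<^bsub>Q\<^esub> \<phi> w" using s by blast
      thus ?thesis using q.Q.cj_fix_iff[of "\<phi> s" "\<phi> w"] w s Bc subgroup.mem_carrier[OF R(1)] by (simp add: q.hom_cj)
    qed
    thus "s \<in> ?N" using N(2)[OF R] s by blast
  qed
  moreover have "cj G (g [^] (p ^ (k + a) :: nat)) w = w" if g: "g \<in> ?N" and w: "w \<in> B" for g w
  proof -
    define h where "h = g [^] (p ^ k)"
    have h: "h \<in> ?N" using pow_mem[OF Nsub g] by (simp add: h_def)
    have gc: "g \<in> carrier G" using g Nc by blast
    hence hc: "h \<in> carrier G" by (simp add: h_def)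
    define u where "u = cj G h w \<otimes> inv w"
    have uA: "u \<in> A" using h w Bc[OF w] hc q.hom_eq_iff[of "cj G h w" w] by (auto simp: u_def)
    have hu: "cj G h u = u" using N(3)[of g u] g uA by (simp add: h_def)
    have hw: "cj G h w = u \<otimes> w" using Bc[OF w] hc by (simp add: u_def m_assoc)
    have "cj G (h [^] n) w = u [^] n \<otimes> w" for n :: nat
    proof (induction n)
      case (Suc n)
      have "cj G (h [^] Suc n) w = cj G h (cj G (h [^] n) w)" using hc Bc[OF w] by (simp add: cj_cj)
      also have "\<dots> = cj G h (u [^] n \<otimes> w)" using Suc by simp
      also have "\<dots> = u [^] n \<otimes> (u \<otimes> w)" using hc Bc[OF w] Ac[OF uA] hu hw by (simp add: cj_mult cj_pow)
      finally show ?case using Bc[OF w] Ac[OF uA] by (simp add: m_assoc)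
    qed (use Bc[OF w] in simp)
    moreover have "u [^] (p ^ a) = \<one>" using pow_order_sub[OF As uA] A(2) by simp
    ultimately have "cj G (h [^] (p ^ a)) w = w" using Bc[OF w] by simp
    thus ?thesis using gc by (simp add: h_def nat_pow_pow power_add)
  qed
  ultimately show ?thesis unfolding Wemb_def by blast
qed

lemma rchain_Wemb:
  assumes "rchain G p {\<one>} P" "Factorial_Ring.prime p"
  shows "Wemb G p P"
  using assms(1)
proof (induction rule: rchain.induct)
  case rchain_base
  have "nml G (carrier G)" by (rule nmlI) (auto simp: subgroup_self)
  thus ?case unfolding Wemb_def using subgroup.subset
    by (intro exI[of _ "carrier G"] exI[of _ 0]) auto
next
  case (rchain_step A B)
  obtain m where "card A = p ^ m" using rchain_card[OF rchain_step.hyps(1)] by auto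
  thus ?case using Wemb_step[OF assms(2) _ _ rchain_step.hyps(2-4) rchain_step.IH] rchain_nml[OF rchain_step.hyps(1)] by blast
qed

end

section \<open>Coprime action\<close>

context fin_group
begin

text \<open>Conjugation by \<open>y [^] i\<close> maps \<open>w\<close> to \<open>u^i w\<close>. For
  \<open>i = m\<close> this gives \<open>u [^] m = \<one>\<close>, and \<open>m\<close> is coprime
  to \<open>n\<close>.\<close>

lemma coprime_fix:
  assumes "y \<in> carrier G" "w \<in> carrier G" "u \<in> carrier G" "y [^] (m::nat) = \<one>" "u [^] (n::nat) = \<one>" "coprime m n"
    and "cj G y w = u \<otimes> w" "cj G y u = u"
  shows "u = \<one>"
proof -
  have "cj G (y [^] i) w = u [^] i \<otimes> w" for i :: nat
  proof (induction i)
    case (Suc i)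
    have "cj G (y [^] Suc i) w = cj G y (cj G (y [^] i) w)" using assms by (simp add: cj_cj)
    also have "\<dots> = u [^] i \<otimes> (u \<otimes> w)" using assms Suc by (simp add: cj_mult cj_pow)
    finally show ?case using assms by (simp add: m_assoc)
  qed (use assms in simp)
  hence "u [^] m \<otimes> w = w" using assms(2,4) by (metis cj_one_left)
  hence "u [^] m = \<one>" using assms(2,3) by simp
  thus ?thesis using pow_coprime_one assms by blast
qed

text \<open>Calculation in nilpotency class 2: \<open>t\<close> is the commutator of
  \<open>b\<close> and \<open>a\<close>, and commutes with both. The exponent
  \<open>\<Sum>{..<n}\<close> is \<open>n(n-1)/2\<close>, the number of times a factor
  \<open>b\<close> is moved past a factor \<open>a\<close>.\<close>

lemma class2_pow:
  assumes a: "a \<in> carrier G" and b: "b \<in> carrier G" and t: "t \<in> carrier G"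
    and ba: "b \<otimes> a = a \<otimes> b \<otimes> t" and ta: "t \<otimes> a = a \<otimes> t" and tb: "t \<otimes> b = b \<otimes> t"
  shows "b [^] (n::nat) \<otimes> a = a \<otimes> b [^] n \<otimes> t [^] n"
    and "b \<otimes> a [^] (n::nat) = a [^] n \<otimes> b \<otimes> t [^] n"
    and "(a \<otimes> b) [^] (n::nat) = a [^] n \<otimes> b [^] n \<otimes> t [^] (\<Sum>{..<n})"
proof -
  have tna: "t [^] k \<otimes> a = a \<otimes> t [^] k" for k :: nat using group_commutes_pow[OF ta t a] .
  have tnb: "t [^] k \<otimes> b = b \<otimes> t [^] k" for k :: nat using group_commutes_pow[OF tb t b] .
  have tnb': "t [^] k \<otimes> (b \<otimes> z) = b \<otimes> (t [^] k \<otimes> z)" if "z \<in> carrier G" for k :: nat and z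
    using tnb[of k] b t that by (simp flip: m_assoc)
  show 1: "b [^] n \<otimes> a = a \<otimes> b [^] n \<otimes> t [^] n" for n :: nat
  proof (induction n)
    case (Suc n)
    have "b [^] Suc n \<otimes> a = b [^] n \<otimes> (b \<otimes> a)" using a b by (simp add: m_assoc)
    also have "\<dots> = b [^] n \<otimes> a \<otimes> (b \<otimes> t)" using a b t by (simp add: ba m_assoc)
    also have "\<dots> = a \<otimes> b [^] n \<otimes> (t [^] n \<otimes> b) \<otimes> t" using a b t by (simp add: Suc m_assoc)
    also have "\<dots> = a \<otimes> b [^] Suc n \<otimes> t [^] Suc n" using a b t by (simp add: tnb tnb' m_assoc)
    finally show ?case .
  qed (use a b in simp)
  show "b \<otimes> a [^] n = a [^] n \<otimes> b \<otimes> t [^] n" for n :: nat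
  proof (induction n)
    case (Suc n)
    have "b \<otimes> a [^] Suc n = a [^] n \<otimes> b \<otimes> (t [^] n \<otimes> a)" using a b t by (simp add: Suc flip: m_assoc)
    also have "\<dots> = a [^] n \<otimes> (b \<otimes> a) \<otimes> t [^] n" using a b t by (simp add: tna m_assoc)
    also have "\<dots> = a [^] Suc n \<otimes> b \<otimes> (t \<otimes> t [^] n)" using a b t by (simp add: ba m_assoc)
    finally show ?case using nat_pow_Suc2[OF t, of n] by simp
  qed (use a b in simp)
  show "(a \<otimes> b) [^] n = a [^] n \<otimes> b [^] n \<otimes> t [^] (\<Sum>{..<n})"
  proof (induction n)
    case (Suc n)
    let ?e = "\<Sum>{..<n}"
    have "(a \<otimes> b) [^] Suc n = a [^] n \<otimes> b [^] n \<otimes> (t [^] ?e \<otimes> a) \<otimes> b" using a b t by (simp add: Suc m_assoc)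
    also have "\<dots> = a [^] n \<otimes> (b [^] n \<otimes> a) \<otimes> (t [^] ?e \<otimes> b)" using a b t by (simp add: tna m_assoc)
    also have "\<dots> = a [^] Suc n \<otimes> b [^] n \<otimes> (t [^] n \<otimes> b) \<otimes> t [^] ?e" using a b t by (simp add: 1 tnb tnb' m_assoc)
    also have "\<dots> = a [^] Suc n \<otimes> b [^] Suc n \<otimes> (t [^] n \<otimes> t [^] ?e)" using a b t by (simp add: tnb tnb' m_assoc)
    finally show ?case using t by (simp add: nat_pow_mult add.commute)
  qed (use a b in simp)
qed

lemma index_p_exists:
  assumes "subgroup P G" "card P = p ^ n" "P \<noteq> {\<one>}" "Factorial_Ring.prime p"
  shows "\<exists>M. subgroup M G \<and> M \<subseteq> P \<and> card P = p * card M"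
proof -
  have n: "n \<noteq> 0" using assms card_one_iff[OF assms(1)] by auto
  have one: "{\<one>} \<subseteq> P" "card {\<one>} = p ^ 0" using subgroup.one_closed[OF assms(1)] by auto
  obtain C where C: "subgroup C G" "C \<subseteq> P" "card C = p ^ (n - 1)"
    using step_between[OF triv_subgroup assms(1) one assms(2,4), of "n - 1"] by auto
  have "card P = p * card C" using C(3) assms(2) n by (simp add: power_eq_if)
  thus ?thesis using C by blast
qed

lemma vimage_cj:
  assumes y: "y \<in> carrier G" and M: "subgroup M G"
  shows "subgroup {z\<in>carrier G. cj G y z \<in> M} G" "card {z\<in>carrier G. cj G y z \<in> M} = card M"
proof -
  note Mc = subgroup.mem_carrier[OF M]
  show "subgroup {z\<in>carrier G. cj G y z \<in> M} G"
    by (rule fin_subgroupI) (use y in \<open>auto simp: cj_mult subgroup.one_closed[OF M] subgroup.m_closed[OF M]\<close>)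
  have "bij_betw (cj G y) {z\<in>carrier G. cj G y z \<in> M} M"
    by (rule bij_betwI[where g = "cj G (inv y)"]) (use y Mc in auto)
  thus "card {z\<in>carrier G. cj G y z \<in> M} = card M" by (rule bij_betw_same_card)
qed

text \<open>For a \<open>p\<close>-group \<open>P\<close> this is its Frattini subgroup, because the
  maximal subgroups of a \<open>p\<close>-group are those of index \<open>p\<close>. Counting the
  index keeps everything inside the ambient group.\<close>

definition Phi :: "nat \<Rightarrow> 'a set \<Rightarrow> 'a set" where
  "Phi p P = {x\<in>P. \<forall>M. subgroup M G \<longrightarrow> M \<subseteq> P \<longrightarrow> card P = p * card M \<longrightarrow> x \<in> M}"

lemma Phi_facts:
  assumes P: "subgroup P G" "card P = p ^ n" and p: "Factorial_Ring.prime p"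
  shows "subgroup (Phi p P) G" "Phi p P \<subseteq> P" "P \<noteq> {\<one>} \<Longrightarrow> Phi p P \<noteq> P" "P \<subseteq> nrm G (Phi p P)"
    "\<And>x. x \<in> P \<Longrightarrow> x [^] p \<in> Phi p P" "\<And>x y. x \<in> P \<Longrightarrow> y \<in> P \<Longrightarrow> cj G y x \<otimes> inv x \<in> Phi p P"
    "\<And>y. y \<in> nrm G P \<Longrightarrow> y \<in> nrm G (Phi p P)"
proof -
  note Pc = subgroup.mem_carrier[OF P(1)]
  show sub: "Phi p P \<subseteq> P" by (auto simp: Phi_def)
  show "subgroup (Phi p P) G"
    by (rule fin_subgroupI) (auto simp: Phi_def Pc subgroup.one_closed P subgroup.m_closed)
  show "Phi p P \<noteq> P" if ne: "P \<noteq> {\<one>}"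
  proof
    assume e: "Phi p P = P"
    obtain M where M: "subgroup M G" "M \<subseteq> P" "card P = p * card M" using index_p_exists[OF P ne p] by blast
    hence "P \<subseteq> M" using e unfolding Phi_def by blast
    hence "M = P" using M(2) by blast
    thus False using M(3) card_sub_pos[OF P(1)] prime_gt_1_nat[OF p] by simp
  qed
  show "x [^] p \<in> Phi p P" if "x \<in> P" for x
    using index_p_facts(1)[OF _ P(1) _ _ P(2) p that that] pow_mem[OF P(1) that] by (auto simp: Phi_def)
  show "cj G y x \<otimes> inv x \<in> Phi p P" if "x \<in> P" "y \<in> P" for x y
    using index_p_facts(2)[OF _ P(1) _ _ P(2) p that] cj_mem[OF P(1) that] that
    by (auto simp: Phi_def intro: subgroup.m_closed[OF P(1)] subgroup.m_inv_closed[OF P(1)])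
  show y: "y \<in> nrm G (Phi p P)" if "y \<in> nrm G P" for y
  proof -
    have yc: "y \<in> carrier G" using that nrm_carrier by blast
    have "cj G y x \<in> M" if x: "x \<in> Phi p P" and M: "subgroup M G" "M \<subseteq> P" "card P = p * card M" for x M
    proof -
      let ?M = "{z\<in>carrier G. cj G y z \<in> M}"
      have "?M \<subseteq> P" using nrm_iff[OF subgroup.subset[OF P(1)] \<open>y \<in> nrm G P\<close>] M(2) by blast
      hence "x \<in> ?M" using x vimage_cj[OF yc M(1)] M(3) unfolding Phi_def by auto
      thus ?thesis by blast
    qed
    thus ?thesis using that nrmD[OF that] yc by (auto simp: nrm_def Phi_def)
  qed
  show "P \<subseteq> nrm G (Phi p P)" using y sub_nrm[OF P(1)] by blast
qed

text \<open>In a minimal counterexample \<open>P\<close>, the element \<open>y\<close> centralises \<open>\<Phi>(P)\<close>, hence the elements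
  \<open>u = w\<^sup>y w\<^sup>-\<^sup>1\<close> centralise \<open>\<Phi>(P)\<close> too, which forces \<open>\<Phi>(P)\<close> to be central. Then \<open>P\<close> has class at most 2
  and \<open>u\<close> has order \<open>p\<close> (or 4), so \<open>y\<close> fixes \<open>u\<close>.\<close>

theorem coprime_centralizes:
  assumes p: "Factorial_Ring.prime p" and y: "y \<in> carrier G" "y [^] (m::nat) = \<one>" "coprime m p"
  shows "\<lbrakk>subgroup P G; card P = p ^ n; y \<in> nrm G P; \<And>w. w \<in> P \<Longrightarrow> w [^] p = \<one> \<Longrightarrow> cj G y w = w;
    p = 2 \<Longrightarrow> (\<forall>w\<in>P. w [^] (4::nat) = \<one> \<longrightarrow> cj G y w = w) \<or> (\<forall>a\<in>P. \<forall>b\<in>P. a \<otimes> b = b \<otimes> a); w \<in> P\<rbrakk> \<Longrightarrow> cj G y w = w"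
proof (induction n arbitrary: P w rule: less_induct)
  case (less n)
  note P = less.prems(1,2) and yP = less.prems(3) and o1 = less.prems(4) and o2 = less.prems(5) and w = less.prems(6)
  note F = Phi_facts[OF P p]
  let ?F = "Phi p P"
  note Pc = subgroup.mem_carrier[OF P(1)]
  have smaller: "cj G y x = x" if R: "subgroup R G" "R \<subset> P" "y \<in> nrm G R" "x \<in> R" for R x
  proof -
    obtain r where r: "card R = p ^ r" using card_p_sub[OF R(1) P(1) _ P(2) p] R(2) by blast
    have "p ^ r < p ^ n" using card_proper[OF P(1) R(2)] r P(2) by simp
    hence rn: "r < n" using prime_gt_1_nat[OF p] by simp
    show ?thesis
      by (rule less.IH[OF rn R(1) r R(3) _ _ R(4)]) (use o1 o2 R(2) in blast)+
  qed
  show ?case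
  proof (cases "P = {\<one>}")
    case True
    thus ?thesis using w y by simp
  next
    case False
    have FP: "?F \<subset> P" using F(2) F(3)[OF False] by blast
    have Ff: "cj G y c = c" if "c \<in> ?F" for c using smaller[OF F(1) FP F(7)[OF yP] that] .
    define a where "a = cj G y w"
    define u where "u = a \<otimes> inv w"
    have aP: "a \<in> P" using nrmD[OF yP w] by (simp add: a_def)
    have wi: "inv w \<in> P" using subgroup.m_inv_closed[OF P(1) w] .
    have uP: "u \<in> P" using aP wi subgroup.m_closed[OF P(1)] by (simp add: u_def)
    have c: "a \<in> carrier G" "w \<in> carrier G" "u \<in> carrier G" using aP w uP Pc by auto
    \<comment> \<open>Since \<open>y\<close> acts trivially on \<open>?F\<close>, the conjugate
      \<open>a\<close> of \<open>w\<close> by \<open>y\<close> acts on \<open>?F\<close> as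
      \<open>w\<close> does; so \<open>u = a w^-1\<close> acts trivially.\<close>
    have uc: "u \<otimes> c = c \<otimes> u" if "c \<in> ?F" for c
    proof -
      have cc: "c \<in> carrier G" using that F(2) Pc by blast
      have cw: "cj G w c \<in> ?F" using F(4) w nrmD that by blast
      have "cj G (inv y) c = c" using Ff[OF that] y(1) cc by (metis cj_inv_cj)
      moreover have "a = inv y \<otimes> w \<otimes> y" by (simp add: a_def cj_def)
      ultimately have "cj G a c = cj G y (cj G w c)" using y(1) cc c by (simp flip: cj_cj)
      also have "\<dots> = cj G w c" using Ff cw by blast
      finally have "cj G u c = c" using cc c by (simp add: u_def flip: cj_cj)
      thus ?thesis using cj_fix_iff[of u c] cc c by metis
    qed
    let ?Z = "{x\<in>P. \<forall>c\<in>?F. x \<otimes> c = c \<otimes> x}"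
    have Zs: "subgroup ?Z G" using subgroup_centI[OF P(1)] F(2) Pc by blast
    have uZ: "u \<in> ?Z" using uP uc by blast
    \<comment> \<open>A proper \<open>?Z\<close> is invariant under \<open>y\<close>, so the
      induction hypothesis applies to it. Otherwise \<open>?F\<close> is central in
      \<open>P\<close>.\<close>
    have "cj G y u = u"
    proof (cases "?Z = P")
      case False
      have "y \<in> nrm G ?Z"
      proof -
        have "cj G y x \<in> ?Z" if x: "x \<in> ?Z" for x
        proof -
          have "cj G y x \<otimes> c = c \<otimes> cj G y x" if cF: "c \<in> ?F" for c
          proof -
            have "c \<in> carrier G" "x \<in> carrier G" using cF x F(2) Pc by auto
            moreover have "x \<otimes> c = c \<otimes> x" using x cF by blast
            ultimately have "cj G y x \<otimes> cj G y c = cj G y c \<otimes> cj G y x" using y(1) by (simp flip: cj_mult)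
            thus ?thesis using Ff[OF cF] by simp
          qed
          thus ?thesis using nrmD[OF yP] x by blast
        qed
        thus ?thesis using y(1) by (simp add: nrm_def)
      qed
      moreover have "?Z \<subset> P" using False by blast
      ultimately show ?thesis using smaller[OF Zs _ _ uZ] by blast
    next
      case True
      have cen: "x \<otimes> c = c \<otimes> x" if "x \<in> P" "c \<in> ?F" for x c using True that by blast
      define b where "b = inv w"
      define t where "t = cj G a b \<otimes> inv b"
      have bP: "b \<in> P" and bc: "b \<in> carrier G" using wi Pc by (auto simp: b_def)
      have tF: "t \<in> ?F" using F(6)[OF bP aP] by (simp add: t_def)
      have tc: "t \<in> carrier G" using tF F(2) Pc by blast
      have ta: "t \<otimes> a = a \<otimes> t" "t \<otimes> b = b \<otimes> t" using cen[OF aP tF] cen[OF bP tF] by simp_all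
      have "b \<otimes> a = a \<otimes> cj G a b" using c bc by (simp add: cj_def m_assoc inv_cancel)
      also have "cj G a b = t \<otimes> b" using c bc by (simp add: t_def m_assoc)
      finally have ba: "b \<otimes> a = a \<otimes> b \<otimes> t" using ta c bc tc by (simp add: m_assoc)
      note cl = class2_pow[OF c(1) bc tc ba ta]
      have apw: "a [^] p = w [^] p" using Ff[OF F(5)[OF w]] y(1) c by (simp add: a_def cj_pow)
      have abp: "a [^] k \<otimes> b [^] k = \<one>" if "a [^] k = w [^] k" for k :: nat
        using that c by (simp add: b_def nat_pow_inv)
      \<comment> \<open>The power is central, so the formula for moving \<open>b\<close> past it
        leaves \<open>t [^] p\<close> trivial.\<close>
      have "a [^] p \<in> ?F" using F(5)[OF aP] .
      hence "a [^] p \<otimes> b \<otimes> t [^] p = a [^] p \<otimes> b" using cl(2)[of p] cen[OF bP] by metis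
      hence tp: "t [^] p = \<one>" using c bc tc by simp
      \<comment> \<open>For odd \<open>p\<close>, \<open>p\<close> divides \<open>p(p-1)/2\<close>,
        so the \<open>p\<close>-th power of \<open>u = a b\<close> is \<open>a^p b^p\<close>, which
        is trivial. For \<open>p = 2\<close> that exponent is 1 and leaves a factor
        \<open>t\<close>; unless \<open>P\<close> is abelian, the fourth power is taken, where the
        exponent is 6.\<close>
      have "(\<exists>k. u [^] k = \<one> \<and> (k = p \<or> p = 2 \<and> k = 4 \<and> (\<forall>w\<in>P. w [^] (4::nat) = \<one> \<longrightarrow> cj G y w = w)))"
      proof (cases "p = 2")
        case False
        hence "odd p" using p primes_dvd_imp_eq two_is_prime_nat by blast
        then obtain q where q: "p - 1 = 2 * q" by (metis dvd_def odd_two_times_div_two_nat)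
        have "\<Sum>{..<p} = p * q"
        proof -
          have "2 * \<Sum>{..<p} = p * (p - 1)" using gauss_sum_nat[of "p - 1"] prime_gt_0_nat[OF p]
            by (cases p) (auto simp: lessThan_Suc_atMost atLeast0AtMost)
          thus ?thesis using q by simp
        qed
        hence "t [^] \<Sum>{..<p} = \<one>" using tp tc by (simp flip: nat_pow_pow)
        hence "u [^] p = a [^] p \<otimes> b [^] p" using cl(3)[of p] c bc by (simp add: u_def b_def)
        thus ?thesis using abp[OF apw] by auto
      next
        case p2: True
        consider "\<forall>w\<in>P. w [^] (4::nat) = \<one> \<longrightarrow> cj G y w = w" | "\<forall>a\<in>P. \<forall>b\<in>P. a \<otimes> b = b \<otimes> a" using o2[OF p2] by blast
        thus ?thesis
        proof cases
          case 1
          have "\<Sum>{..<4::nat} = 2 * 3" by (simp add: lessThan_nat_numeral)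
          hence "t [^] \<Sum>{..<4::nat} = \<one>" using tp p2 tc by (metis nat_pow_one nat_pow_pow)
          moreover have "a [^] (4::nat) = w [^] (4::nat)"
          proof -
            have "a [^] (2 * 2::nat) = w [^] (2 * 2::nat)" using apw p2 c by (metis nat_pow_pow)
            thus ?thesis by simp
          qed
          ultimately have "u [^] (4::nat) = \<one>" using cl(3)[of 4] abp[of 4] c bc by (simp add: u_def b_def)
          thus ?thesis using 1 p2 by blast
        next
          case 2
          have "a \<otimes> b = b \<otimes> a" using 2 aP bP by blast
          hence "u [^] p = \<one>" using pow_mult_distrib[of a b p] abp[OF apw] c bc by (simp add: u_def b_def)
          thus ?thesis by blast
        qed
      qed
      thus ?thesis using o1[OF uP] uP by blast
    qed
    moreover have "cj G y w = u \<otimes> w" using c by (simp add: u_def a_def m_assoc)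
    moreover have "u [^] (p ^ n) = \<one>" using pow_order_sub[OF P(1) uP] P(2) by simp
    moreover have "coprime m (p ^ n)" using y(3) by simp
    ultimately have "u = \<one>" using coprime_fix[OF y(1) c(2,3) y(2)] by blast
    thus ?thesis using \<open>cj G y w = u \<otimes> w\<close> c by simp
  qed
qed

end

section \<open>Abelian actions of exponent dividing p - 1\<close>

text \<open>The geometric sum times \<open>r^k - 1\<close> is \<open>r^(k(p-1)) - 1\<close>, a
  multiple of \<open>p\<close>, whereas \<open>r^k - 1\<close> is not one because \<open>r\<close>
  has order \<open>p - 1\<close> modulo \<open>p\<close>.\<close>

lemma primroot_sums:
  assumes p: "Factorial_Ring.prime (p::nat)"
  obtains r where "coprime r p" "\<And>k. 0 < k \<Longrightarrow> k < p - 1 \<Longrightarrow> p dvd (\<Sum>m<p-1. r ^ (m * k))"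
proof -
  obtain r where r: "residue_primroot p r" using prime_primitive_root_exists[of p] p prime_gt_1_nat by auto
  hence cop: "coprime p r" and o: "Pocklington.ord p r = p - 1" by (auto simp: residue_primroot_def totient_prime p)
  have "p dvd (\<Sum>m<p-1. r ^ (m * k))" if k: "0 < k" "k < p - 1" for k
  proof -
    have nd: "\<not> int p dvd int r ^ k - 1"
    proof
      assume "int p dvd int r ^ k - 1"
      hence "[int r ^ k = 1] (mod int p)" by (simp add: cong_iff_dvd_diff)
      hence "[r ^ k = 1] (mod p)" by (metis cong_int_iff of_nat_1 of_nat_power)
      hence "p - 1 dvd k" using ord_divides[of r k p] o by simp
      thus False using k by (simp add: nat_dvd_not_less)
    qed
    have "[r ^ (p - 1) = 1] (mod p)" using ord[of r p] o by simp
    hence "[(r ^ (p - 1)) ^ k = 1 ^ k] (mod p)" by (rule cong_pow)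
    hence "[(int r ^ k) ^ (p - 1) = 1] (mod int p)"
      by (metis cong_int_iff of_nat_1 of_nat_power power_commutes power_mult mult.commute power_one)
    hence "int p dvd (int r ^ k) ^ (p - 1) - 1" by (simp add: cong_iff_dvd_diff)
    also have "(int r ^ k) ^ (p - 1) - 1 = (int r ^ k - 1) * (\<Sum>m<p-1. (int r ^ k) ^ m)"
      by (rule power_diff_1_eq)
    finally have "int p dvd (\<Sum>m<p-1. (int r ^ k) ^ m)"
      using nd p prime_dvd_mult_iff[of "int p"] by auto
    also have "(\<Sum>m<p-1. (int r ^ k) ^ m) = int (\<Sum>m<p-1. r ^ (m * k))"
      by (simp add: mult.commute flip: power_mult)
    finally show ?thesis by (simp only: int_dvd_int_iff)
  qed
  thus ?thesis using that cop by (simp add: coprime_commute)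
qed

text \<open>\<open>G\<close> is not commutative, so the factors have a fixed order; they may be
  rearranged only when they lie in an abelian subgroup.\<close>

primrec iprod :: "('a, 'b) monoid_scheme \<Rightarrow> (nat \<Rightarrow> 'a) \<Rightarrow> nat \<Rightarrow> 'a" where
  "iprod G f 0 = \<one>\<^bsub>G\<^esub>"
| "iprod G f (Suc n) = iprod G f n \<otimes>\<^bsub>G\<^esub> f n"

locale abelian_sub = fin_group +
  fixes V
  assumes subV: "subgroup V G" and cmV: "x \<in> V \<Longrightarrow> y \<in> V \<Longrightarrow> x \<otimes> y = y \<otimes> x"
begin

lemma Vc: "x \<in> V \<Longrightarrow> x \<in> carrier G"
  using subgroup.mem_carrier[OF subV] .

lemma Vm: "x \<in> V \<Longrightarrow> y \<in> V \<Longrightarrow> x \<otimes> y \<in> V"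
  using subgroup.m_closed[OF subV] .

lemma iprod_closed: "(\<And>i. f i \<in> V) \<Longrightarrow> iprod G f n \<in> V"
  by (induction n) (auto simp: Vm subgroup.one_closed[OF subV])

lemma mult_swap_middle: "\<lbrakk>a \<in> V; b \<in> V; c \<in> V; d \<in> V\<rbrakk> \<Longrightarrow> a \<otimes> b \<otimes> (c \<otimes> d) = a \<otimes> c \<otimes> (b \<otimes> d)"
proof -
  assume h: "a \<in> V" "b \<in> V" "c \<in> V" "d \<in> V"
  have "a \<otimes> b \<otimes> (c \<otimes> d) = a \<otimes> (b \<otimes> c) \<otimes> d" using h Vc by (simp add: m_assoc)
  also have "b \<otimes> c = c \<otimes> b" using h cmV by blast
  finally show ?thesis using h Vc by (simp add: m_assoc)
qed

lemma iprod_mult: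
  assumes "\<And>i. f i \<in> V" "\<And>i. h i \<in> V"
  shows "iprod G (\<lambda>i. f i \<otimes> h i) n = iprod G f n \<otimes> iprod G h n"
proof (induction n)
  case (Suc n)
  thus ?case using mult_swap_middle[OF iprod_closed[of f, OF assms(1), where n = n] assms(1)[of n] iprod_closed[of h, OF assms(2), where n = n] assms(2)[of n]]
      mult_swap_middle[OF iprod_closed[of f, OF assms(1), where n = n] iprod_closed[of h, OF assms(2), where n = n] assms(1)[of n] assms(2)[of n]] by simp
qed simp

lemma iprod_swap:
  assumes "\<And>i j. f i j \<in> V"
  shows "iprod G (\<lambda>i. iprod G (f i) m) n = iprod G (\<lambda>j. iprod G (\<lambda>i. f i j) n) m"
proof (induction n)
  case 0
  show ?case by (induction m) auto
next
  case (Suc n)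
  thus ?case using iprod_mult[of "\<lambda>j. iprod G (\<lambda>i. f i j) n" "f n" m] iprod_closed assms by simp
qed

lemma iprod_cj: "\<lbrakk>g \<in> carrier G; \<And>i. f i \<in> V\<rbrakk> \<Longrightarrow> cj G g (iprod G f n) = iprod G (\<lambda>i. cj G g (f i)) n"
  by (induction n) (auto simp: cj_mult Vc iprod_closed)

lemma iprod_pow:
  assumes "\<And>i. f i \<in> V"
  shows "iprod G f n [^] (k::nat) = iprod G (\<lambda>i. f i [^] k) n"
proof (induction n)
  case (Suc n)
  have "(iprod G f n \<otimes> f n) [^] k = iprod G f n [^] k \<otimes> f n [^] k"
    using assms iprod_closed[OF assms] cmV Vc by (intro pow_mult_distrib) auto
  thus ?case using Suc by simp
qed simp

lemma iprod_shift:
  assumes "\<And>i. f i \<in> V"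
  shows "f 0 \<otimes> iprod G (\<lambda>i. f (Suc i)) n = iprod G f n \<otimes> f n"
proof (induction n)
  case (Suc n)
  have "f 0 \<otimes> iprod G (\<lambda>i. f (Suc i)) (Suc n) = f 0 \<otimes> iprod G (\<lambda>i. f (Suc i)) n \<otimes> f (Suc n)"
    using assms iprod_closed[of "\<lambda>i. f (Suc i)"] Vc by (simp add: m_assoc)
  thus ?case using Suc by simp
qed (use assms Vc in simp)

lemma iprod_exp: "x \<in> V \<Longrightarrow> iprod G (\<lambda>i. x [^] (c i :: nat)) n = x [^] (\<Sum>i<n. c i)"
  by (induction n) (auto simp: nat_pow_mult Vc)

lemma iprod_first: "\<lbrakk>\<And>i. f i \<in> V; \<And>i. 0 < i \<Longrightarrow> i < n \<Longrightarrow> f i = \<one>; n > 0\<rbrakk> \<Longrightarrow> iprod G f n = f 0"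
proof (induction n)
  case (Suc n)
  thus ?case using Vc[of "f 0"] by (cases n) auto
qed simp

end

text \<open>The group induced by \<open>G\<close> on \<open>P\<close> is an extension of a \<open>p\<close>-group by an abelian group of exponent
  dividing \<open>p - 1\<close>.\<close>

definition Uemb :: "('a, 'b) monoid_scheme \<Rightarrow> nat \<Rightarrow> 'a set \<Rightarrow> bool" where
  "Uemb G p P \<longleftrightarrow> (\<exists>N k. nml G N \<and> (\<forall>g\<in>carrier G. \<forall>h\<in>carrier G. cj G h g \<otimes>\<^bsub>G\<^esub> inv\<^bsub>G\<^esub> g \<in> N) \<and>
     (\<forall>g\<in>carrier G. g [^]\<^bsub>G\<^esub> (p - 1) \<in> N) \<and> (\<forall>g\<in>N. \<forall>x\<in>P. cj G (g [^]\<^bsub>G\<^esub> (p ^ k :: nat)) x = x))"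

context fin_group
begin

lemma minnml_eq: "minnml G V \<Longrightarrow> nml G W \<Longrightarrow> W \<subseteq> V \<Longrightarrow> x \<in> W \<Longrightarrow> x \<noteq> \<one> \<Longrightarrow> W = V"
  unfolding minnml_def by blast

text \<open>For a primitive root \<open>r\<close> the products \<open>e m\<close> of the conjugates of \<open>v\<close> by \<open>g ^ k\<close> raised to \<open>r ^ (m * k)\<close> are the
  projections of \<open>v\<close> to the eigenspaces of \<open>g\<close>. Their product is \<open>v\<^sup>-\<^sup>1\<close>, so one of them is nontrivial, and
  its eigenspace is all of \<open>V\<close> by minimality.\<close>

lemma eigenvector_power:
  assumes p: "Factorial_Ring.prime (p::nat)" and V: "minnml G V" and cm: "\<And>x y. x \<in> V \<Longrightarrow> y \<in> V \<Longrightarrow> x \<otimes> y = y \<otimes> x"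
    and ex: "\<And>v. v \<in> V \<Longrightarrow> v [^] p = \<one>"
    and N: "\<And>g h v. g \<in> carrier G \<Longrightarrow> h \<in> carrier G \<Longrightarrow> v \<in> V \<Longrightarrow> cj G g (cj G h v) = cj G h (cj G g v)"
       "\<And>g v. g \<in> carrier G \<Longrightarrow> v \<in> V \<Longrightarrow> cj G (g [^] (p - 1)) v = v"
    and g: "g \<in> carrier G"
  shows "\<exists>i::nat. \<forall>v\<in>V. cj G g v = v [^] i"
proof -
  have Vn: "nml G V" and Vs: "subgroup V G" and V1: "V \<noteq> {\<one>}" using V nml_subgroup by (auto simp: minnml_def)
  interpret abelian_sub G V by (intro abelian_sub.intro fin_group_axioms abelian_sub_axioms.intro Vs cm)
  have gV: "cj G x v \<in> V" if "x \<in> carrier G" "v \<in> V" for x v using nml_cj[OF Vn] that by blast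
  have pwV: "v [^] (k::nat) \<in> V" if "v \<in> V" for v k using pow_mem[OF Vs that] .
  have red: "v [^] (i::nat) = v [^] (j::nat)" if v: "v \<in> V" and "[i = j] (mod p)" for v i j
  proof -
    have "v [^] k = v [^] (k mod p)" for k :: nat
    proof -
      have "v [^] k = v [^] (p * (k div p) + k mod p)" by simp
      also have "\<dots> = (v [^] p) [^] (k div p) \<otimes> v [^] (k mod p)"
        using Vc[OF v] by (simp only: nat_pow_mult nat_pow_pow)
      finally show ?thesis using ex[OF v] Vc[OF v] by simp
    qed
    thus ?thesis using that(2) unfolding cong_def by metis
  qed
  obtain v where v: "v \<in> V" "v \<noteq> \<one>" using V1 subgroup.one_closed[OF Vs] by blast
  obtain r where r: "coprime r p" "\<And>k. 0 < k \<Longrightarrow> k < p - 1 \<Longrightarrow> p dvd (\<Sum>m<p-1. r ^ (m * k))"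
    using primroot_sums[OF p] by blast
  define f where "f m k = cj G (g [^] k) v [^] (r ^ (m * k))" for m k
  define e where "e m = iprod G (f m) (p - 1)" for m
  have fV: "f m k \<in> V" for m k using gV pwV v g by (simp add: f_def)
  have eV: "e m \<in> V" for m using iprod_closed[OF fV] by (simp add: e_def)
  have fermat: "[r ^ (m * (p - 1)) = 1] (mod p)" for m
  proof -
    have "\<not> p dvd r"
    proof
      assume "p dvd r"
      hence "is_unit p" by (rule coprime_common_divisor[OF r(1) _ dvd_refl])
      thus False using not_prime_unit p by blast
    qed
    hence "[r ^ (p - 1) = 1] (mod p)" using fermat_theorem[OF p] by blast
    hence "[(r ^ (p - 1)) ^ m = 1 ^ m] (mod p)" by (rule cong_pow)
    thus ?thesis by (simp add: mult.commute flip: power_mult)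
  qed
  \<comment> \<open>Conjugation by \<open>g\<close> followed by the power \<open>r ^ m\<close> maps
    the factor with index \<open>k\<close> to the one with index \<open>k + 1\<close>. The factors
    with index 0 and \<open>p - 1\<close> agree, by Fermat and since \<open>g [^] (p - 1)\<close>
    acts trivially, so the product is only permuted cyclically.\<close>
  have eig: "cj G g (e m) [^] (r ^ m) = e m" for m
  proof -
    have ff: "cj G g (f m k) [^] (r ^ m) = f m (Suc k)" for k
    proof -
      have "cj G g (f m k) = cj G (g [^] Suc k) v [^] (r ^ (m * k))"
        using g v Vc by (simp add: f_def cj_pow cj_cj)
      hence "cj G g (f m k) [^] (r ^ m) = cj G (g [^] Suc k) v [^] (r ^ (m * k) * r ^ m)"
        using g Vc[OF v(1)] by (simp only: nat_pow_pow cj_closed nat_pow_closed)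
      also have "r ^ (m * k) * r ^ m = r ^ (m * Suc k)" by (simp add: power_add mult.commute)
      finally show ?thesis by (simp only: f_def)
    qed
    have "cj G g (e m) [^] (r ^ m) = iprod G (\<lambda>k. cj G g (f m k) [^] (r ^ m)) (p - 1)"
      unfolding e_def using iprod_cj[OF g fV] iprod_pow[of "\<lambda>k. cj G g (f m k)"] gV[OF g fV] by simp
    also have "\<dots> = iprod G (\<lambda>k. f m (Suc k)) (p - 1)" by (simp only: ff)
    finally have 1: "f m 0 \<otimes> cj G g (e m) [^] (r ^ m) = e m \<otimes> f m (p - 1)"
      using iprod_shift[of "f m" "p - 1"] fV by (simp add: e_def)
    have "f m (p - 1) = v [^] (r ^ (m * (p - 1)))" using N(2)[OF g v(1)] by (simp add: f_def)
    also have "\<dots> = v" using red[OF v(1) fermat] Vc[OF v(1)] by simp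
    finally have "f m (p - 1) = v" .
    moreover have "f m 0 = v" using v Vc by (simp add: f_def)
    moreover have "e m \<otimes> v = v \<otimes> e m" using cm eV v by blast
    ultimately have "v \<otimes> cj G g (e m) [^] (r ^ m) = v \<otimes> e m" using 1 by simp
    thus ?thesis using Vc eV[of m] v g by (metis cj_closed l_cancel nat_pow_closed)
  qed
  \<comment> \<open>Interchanging the products collects the conjugates by \<open>g [^] k\<close> for
    each \<open>k\<close>. Their total exponent is divisible by \<open>p\<close> unless
    \<open>k = 0\<close>, where it is \<open>p - 1\<close>; so if all \<open>e m\<close> were
    trivial, \<open>v [^] (p - 1)\<close> would be.\<close>
  have "\<exists>m. e m \<noteq> \<one>"
  proof (rule ccontr)
    assume "\<nexists>m. e m \<noteq> \<one>"
    hence all1: "e m = \<one>" for m by blast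
    have "iprod G e n = \<one>" for n by (induction n) (simp_all add: all1)
    hence "iprod G e (p - 1) = \<one>" by blast
    hence h0: "\<one> = iprod G (\<lambda>k. iprod G (\<lambda>m. f m k) (p - 1)) (p - 1)"
      unfolding e_def using iprod_swap[of f, OF fV, where m = "p - 1" and n = "p - 1"] by simp
    have h1: "iprod G (\<lambda>m. f m k) (p - 1) = cj G (g [^] k) v [^] (\<Sum>m<p-1. r ^ (m * k))" for k
      unfolding f_def using iprod_exp[of "cj G (g [^] k) v"] gV v g by simp
    have h2: "iprod G (\<lambda>k. cj G (g [^] k) v [^] (\<Sum>m<p-1. r ^ (m * k))) (p - 1) = v [^] (p - 1)"
    proof -
      have z: "cj G (g [^] k) v [^] (\<Sum>m<p-1. r ^ (m * k)) = \<one>" if "0 < k" "k < p - 1" for k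
      proof -
        have w: "cj G (g [^] k) v \<in> V" using gV v g by simp
        have "[(\<Sum>m<p-1. r ^ (m * k)) = 0] (mod p)" using r(2)[OF that] by (simp add: cong_0_iff)
        from red[OF w this] show ?thesis by simp
      qed
      have "iprod G (\<lambda>k. cj G (g [^] k) v [^] (\<Sum>m<p-1. r ^ (m * k))) (p - 1) = cj G (g [^] (0::nat)) v [^] (\<Sum>m<p-1. r ^ (m * 0))"
        by (rule iprod_first) (use gV pwV v g z prime_gt_1_nat[OF p] in auto)
      thus ?thesis using v Vc by simp
    qed
    have "v [^] (p - 1) = \<one>" using h0 unfolding h1 h2 by (rule sym)
    moreover have "coprime (p - 1) p" by (rule coprime_diff_one_left_nat[OF prime_gt_0_nat[OF p]])
    ultimately show False using pow_coprime_one[OF Vc[OF v(1)] _ ex[OF v(1)]] v(2) by blast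
  qed
  then obtain m where m: "e m \<noteq> \<one>" by blast
  \<comment> \<open>The eigenspace for the inverse of \<open>r ^ m\<close>; it is normal in
    \<open>G\<close> because the conjugations commute on \<open>V\<close>.\<close>
  define E where "E = {w\<in>V. cj G g w [^] (r ^ m) = w}"
  have "subgroup E G"
  proof (rule fin_subgroupI)
    show "E \<subseteq> carrier G" using Vc by (auto simp: E_def)
    show "\<one> \<in> E" using g by (simp add: E_def subgroup.one_closed[OF Vs])
    fix x y assume xy: "x \<in> E" "y \<in> E"
    hence xV: "x \<in> V" "y \<in> V" by (auto simp: E_def)
    have "cj G g (x \<otimes> y) [^] (r ^ m) = (cj G g x \<otimes> cj G g y) [^] (r ^ m)" using xV Vc g by (simp add: cj_mult)
    also have "\<dots> = cj G g x [^] (r ^ m) \<otimes> cj G g y [^] (r ^ m)"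
      using cm gV[OF g] xV Vc by (intro pow_mult_distrib) auto
    finally show "x \<otimes> y \<in> E" using xy Vm by (auto simp: E_def)
  qed
  hence En: "nml G E"
  proof (rule nmlI)
    fix h x assume h: "h \<in> carrier G" and x: "x \<in> E"
    have xV: "x \<in> V" using x by (auto simp: E_def)
    have "cj G g (cj G h x) [^] (r ^ m) = cj G h (cj G g x) [^] (r ^ m)" using N(1)[OF g h xV] by simp
    also have "\<dots> = cj G h (cj G g x [^] (r ^ m))" using h g Vc[OF xV] by (simp add: cj_pow)
    finally show "cj G h x \<in> E" using x gV[OF h xV] by (simp add: E_def)
  qed
  have "e m \<in> E" using eig eV by (simp add: E_def)
  moreover have "E \<subseteq> V" unfolding E_def by blast
  ultimately have EV: "E = V" using minnml_eq[OF V En _ _ m] by blast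
  \<comment> \<open>By Fermat, \<open>r ^ (m * (p - 2))\<close> is inverse to \<open>r ^ m\<close>
    modulo \<open>p\<close>.\<close>
  have "cj G g w = w [^] (r ^ (m * (p - 2)))" if w: "w \<in> V" for w
  proof -
    have "w \<in> E" using w EV by blast
    hence "cj G g w [^] (r ^ m) = w" unfolding E_def by blast
    hence "w [^] (r ^ (m * (p - 2))) = (cj G g w [^] (r ^ m)) [^] (r ^ (m * (p - 2)))" by (simp only:)
    also have "\<dots> = cj G g w [^] (r ^ (m * (p - 1)))"
    proof -
      obtain q where "p = 2 + q" using le_Suc_ex[OF prime_ge_2_nat[OF p]] by blast
      hence "m + m * (p - 2) = m * (p - 1)" by simp
      thus ?thesis using gV[OF g w] Vc by (simp add: nat_pow_pow flip: power_add)
    qed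
    also have "\<dots> = cj G g w" using red[OF gV[OF g w] fermat] gV[OF g w] Vc by simp
    finally show ?thesis by simp
  qed
  thus ?thesis by blast
qed

section \<open>From power actions to invariant series\<close>

lemma sylow_in_sub:
  assumes "Factorial_Ring.prime p" "sylow_subgroup G p S" "subgroup L G" "S \<subseteq> L"
  shows "sylow_subgroup (G\<lparr>carrier := L\<rparr>) p S"
proof -
  let ?a = "multiplicity p (Coset.order G)"
  have S: "subgroup S G" "card S = p ^ ?a" using assms by (auto simp: sylow_subgroup_def)
  have pos: "Coset.order G \<noteq> 0" using fin order_gt_0_iff_finite by auto
  have "p ^ ?a dvd card L" using card_dvd[OF S(1) assms(3,4)] S(2) by simp
  hence "?a \<le> multiplicity p (card L)" using assms(1) card_sub_pos[OF assms(3)] by (intro multiplicity_geI) auto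
  moreover have "multiplicity p (card L) \<le> ?a"
    by (rule dvd_imp_multiplicity_le[OF card_dvd_order[OF assms(3)] pos])
  ultimately show ?thesis using S sub_sub[OF assms(3) S(1) assms(4)] by (simp add: sylow_subgroup_def Coset.order_def)
qed

lemma gen_all_sub:
  assumes p: "Factorial_Ring.prime p" and S: "sylow_subgroup G p S" and L: "subgroup L G" "S \<subseteq> L" and M: "subgroup M G" "S \<subseteq> M" "M \<subseteq> L"
    and pw: "\<And>g. g \<in> L \<Longrightarrow> g [^] (p ^ k :: nat) \<in> M"
  shows "M = L"
proof -
  interpret L: fin_group "G\<lparr>carrier := L\<rparr>" using sub_fin_group L by blast
  have "M = carrier (G\<lparr>carrier := L\<rparr>)"
    by (rule L.gen_all[OF p sylow_in_sub[OF p S L] sub_sub[OF L(1) M(1,3)] M(2), of k])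
      (use pw in \<open>simp flip: nat_pow_consistent\<close>)
  thus ?thesis by simp
qed

text \<open>A Sylow \<open>p\<close>-subgroup lies in \<open>N\<close> and fixes some
  \<open>v\<close> other than the identity. Together with the \<open>p ^ k\<close>-th powers, which
  act trivially on \<open>V\<close>, it generates \<open>N\<close>; so \<open>N\<close> fixes
  \<open>v\<close>, and by minimality all of \<open>V\<close>. Thus \<open>G\<close> acts on
  \<open>V\<close> through an abelian group of exponent dividing \<open>p - 1\<close>, hence by
  power maps, and \<open>v\<close> generates a normal subgroup.\<close>

lemma minnml_Uemb_card:
  assumes p: "Factorial_Ring.prime p" and V: "minnml G V" "card V = p ^ n" and U: "Uemb G p V"
  shows "card V = p"
proof -
  obtain N k where N: "nml G N" "\<And>g h. g \<in> carrier G \<Longrightarrow> h \<in> carrier G \<Longrightarrow> cj G h g \<otimes> inv g \<in> N"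
     "\<And>g. g \<in> carrier G \<Longrightarrow> g [^] (p - 1) \<in> N" "\<And>g x. g \<in> N \<Longrightarrow> x \<in> V \<Longrightarrow> cj G (g [^] (p ^ k :: nat)) x = x"
    using U unfolding Uemb_def by (elim exE conjE) (rule that, assumption, blast, blast, blast)
  have Vn: "nml G V" and Vs: "subgroup V G" and V1: "V \<noteq> {\<one>}" and Ns: "subgroup N G" using V N nml_subgroup by (auto simp: minnml_def)
  note Vc = subgroup.mem_carrier[OF Vs]
  note Nc = subgroup.mem_carrier[OF Ns]
  note cen = minnml_central[OF p V(1) order_refl Vn V(2)]
  obtain S where S: "sylow_subgroup G p S" using sylow_exists[OF p] by blast
  then obtain s where Ss: "subgroup S G" "card S = p ^ s" using sylow_pgroup by blast
  have cop: "coprime (p - 1) (p ^ s)" using coprime_diff_one_left_nat[OF prime_gt_0_nat[OF p]] by simp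
  have SN: "S \<subseteq> N"
  proof
    fix x assume x: "x \<in> S"
    have xc: "x \<in> carrier G" using x subgroup.mem_carrier[OF Ss(1)] by blast
    have "x [^] (p ^ s) \<in> N" using pow_order_sub[OF Ss(1) x] Ss(2) subgroup.one_closed[OF Ns] by simp
    thus "x \<in> N" using pow_coprime_mem[OF Ns xc N(3)[OF xc] _ cop] by blast
  qed
  have "S \<subseteq> nrm G V" using Vn subgroup.subset[OF Ss(1)] by (auto simp: nml_def)
  note F = fixed_nontrivial[OF Ss p Vs V(2) V1 this]
  then obtain v where v: "v \<in> V" "v \<noteq> \<one>" "\<And>x. x \<in> S \<Longrightarrow> v \<otimes> x = x \<otimes> v"
    using subgroup.one_closed[OF F(1)] by blast
  have NN: "{g\<in>N. \<forall>c\<in>{v}. g \<otimes> c = c \<otimes> g} = N"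
  proof (rule gen_all_sub[OF p S Ns SN])
    show "subgroup {g\<in>N. \<forall>c\<in>{v}. g \<otimes> c = c \<otimes> g} G" using subgroup_centI[OF Ns] v Vc by blast
    show "S \<subseteq> {g\<in>N. \<forall>c\<in>{v}. g \<otimes> c = c \<otimes> g}" using SN v by auto
    fix g assume g: "g \<in> N"
    have "v \<otimes> g [^] (p ^ k) = g [^] (p ^ k) \<otimes> v"
      using N(4)[OF g v(1)] cj_fix_iff[of "g [^] (p ^ k)" v] g Nc Vc v by simp
    thus "g [^] (p ^ k) \<in> {g\<in>N. \<forall>c\<in>{v}. g \<otimes> c = c \<otimes> g}" using pow_mem[OF Ns g] by simp
  qed auto
  let ?W = "{w\<in>V. \<forall>c\<in>N. w \<otimes> c = c \<otimes> w}"
  have "subgroup ?W G" using subgroup_centI[OF Vs] Nc by blast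
  hence "nml G ?W"
  proof (rule nmlI)
    fix x w assume x: "x \<in> carrier G" and w: "w \<in> ?W"
    have "cj G x w \<otimes> c = c \<otimes> cj G x w" if c: "c \<in> N" for c
    proof -
      have y: "cj G (inv x) c \<in> N" using nml_cj[OF N(1) _ c] x by simp
      hence "w \<otimes> cj G (inv x) c = cj G (inv x) c \<otimes> w" using w by blast
      hence "cj G x (w \<otimes> cj G (inv x) c) = cj G x (cj G (inv x) c \<otimes> w)" by simp
      thus ?thesis using x c w Vc Nc by (simp add: cj_mult)
    qed
    thus "cj G x w \<in> ?W" using nml_cj[OF Vn x] w by blast
  qed
  moreover have "v \<in> ?W"
  proof -
    have "c \<otimes> v = v \<otimes> c" if "c \<in> N" for c using NN that by blast
    thus ?thesis using v(1) by simp
  qed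
  ultimately have "?W = V" using minnml_eq[OF V(1) _ _ _ v(2), of ?W] by blast
  hence NV: "cj G c w = w" if "c \<in> N" "w \<in> V" for c w
    using that cj_fix_iff[of c w] Nc Vc by auto
  have comm: "cj G g (cj G h w) = cj G h (cj G g w)" if gh: "g \<in> carrier G" "h \<in> carrier G" "w \<in> V" for g h w
  proof -
    let ?c = "cj G h g \<otimes> inv g"
    have cN: "?c \<in> N" using N(2) gh by blast
    have hw: "cj G h w \<in> V" using nml_cj[OF Vn] gh by blast
    have "g \<otimes> h = h \<otimes> ?c \<otimes> g" using gh by (simp add: cj_def m_assoc inv_cancel)
    hence "cj G h (cj G g w) = cj G g (cj G ?c (cj G h w))" using gh Vc by (simp add: cj_cj)
    thus ?thesis using NV[OF cN hw] by simp
  qed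
  have pw: "\<exists>i::nat. \<forall>v\<in>V. cj G g v = v [^] i" if "g \<in> carrier G" for g
    by (rule eigenvector_power[OF p V(1) cen _ _ that]) (use comm NV N(3) in auto)
  have one: "subgroup {\<one>} G" "v \<in> nrm G {\<one>}" "v [^] p \<in> {\<one>}" "v \<notin> {\<one>}"
    using triv_subgroup cen(2) v Vc by (auto simp: nrm_def)
  let ?C = "{a \<otimes> v [^] (i::nat) |a i. a \<in> {\<one>}}"
  note C = adjoin[OF one(1,2) p one(3,4)]
  have "nml G ?C"
  proof (rule nmlI[OF C(1)])
    fix g x assume g: "g \<in> carrier G" and "x \<in> ?C"
    then obtain i :: nat where x: "x = v [^] i" using v Vc by auto
    obtain j :: nat where "cj G g v = v [^] j" using pw[OF g] v by blast
    hence "cj G g x = v [^] (j * i)" using x g v Vc by (simp add: cj_pow nat_pow_pow)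
    thus "cj G g x \<in> ?C" using v Vc by (auto intro!: exI[of _ "j * i"])
  qed
  moreover have "?C \<subseteq> V" using v Vc pow_mem[OF Vs v(1)] by auto
  ultimately have "?C = V" using minnml_eq[OF V(1) _ _ C(4) v(2)] by blast
  thus ?thesis using C(2) by simp
qed

text \<open>The induction on the order of \<open>P\<close> replaces \<open>G\<close> by its quotient
  modulo a minimal normal subgroup, so the induction hypothesis ranges over all groups of the same
  type.\<close>

lemma Uemb_rchain_step:
  assumes p: "Factorial_Ring.prime p" and P: "nml G P" "card P = p ^ n" and U: "Uemb G p P"
    and IH: "\<And>(Q :: ('a, 'b) monoid_scheme) R m. m < n \<Longrightarrow> fin_group Q \<Longrightarrow> nml Q R \<Longrightarrow> card R = p ^ m \<Longrightarrow> Uemb Q p R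
      \<Longrightarrow> rchain Q p {\<one>\<^bsub>Q\<^esub>} R"
  shows "rchain G p {\<one>} P"
proof -
  have Ps: "subgroup P G" using P nml_subgroup by blast
  show ?thesis
  proof (cases "P = {\<one>}")
    case True
    thus ?thesis using nml_one rchain.intros(1) by blast
  next
    case False
    obtain V where V: "minnml G V" "V \<subseteq> P" using minnml_exists[OF P(1) False] by blast
    have Vn: "nml G V" and Vs: "subgroup V G" using V nml_subgroup by (auto simp: minnml_def)
    obtain m where m: "card V = p ^ m" using card_p_sub[OF Vs Ps V(2) P(2) p] by blast
    obtain N k where N: "nml G N" "\<And>g h. g \<in> carrier G \<Longrightarrow> h \<in> carrier G \<Longrightarrow> cj G h g \<otimes> inv g \<in> N"
       "\<And>g. g \<in> carrier G \<Longrightarrow> g [^] (p - 1) \<in> N" "\<And>g x. g \<in> N \<Longrightarrow> x \<in> P \<Longrightarrow> cj G (g [^] (p ^ k :: nat)) x = x"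
      using U unfolding Uemb_def by (elim exE conjE) (rule that, assumption, blast, blast, blast)
    have "Uemb G p V" unfolding Uemb_def using N V(2) by blast
    hence cV: "card V = p" using minnml_Uemb_card[OF p V(1) m] by blast
    obtain Q \<phi> where "quot G Q \<phi> V" using quot_exists Vn by blast
    then interpret q: quot G Q \<phi> V .
    have cP: "p * card (\<phi> ` P) = p ^ n" using q.img_card[OF Ps V(2)] cV P(2) by simp
    have n0: "n \<noteq> 0" using cP prime_gt_1_nat[OF p] by (cases n) auto
    hence cP': "card (\<phi> ` P) = p ^ (n - 1)" using cP p by (cases n) auto
    note Nc = subgroup.mem_carrier[OF nml_subgroup[OF N(1)]]
    note Pc = subgroup.mem_carrier[OF Ps]
    have "Uemb Q p (\<phi> ` P)"
      unfolding Uemb_def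
    proof (rule exI[of _ "\<phi> ` N"], rule exI[of _ k], intro conjI ballI)
      show "nml Q (\<phi> ` N)" using q.img_nml N by blast
    next
      fix g h assume "g \<in> carrier Q" "h \<in> carrier Q"
      then obtain g' h' where gh: "g' \<in> carrier G" "h' \<in> carrier G" "g = \<phi> g'" "h = \<phi> h'" using q.surj by blast
      hence "cj Q h g \<otimes>\<^bsub>Q\<^esub> inv\<^bsub>Q\<^esub> g = \<phi> (cj G h' g' \<otimes> inv g')" by (simp add: q.hom_cj)
      thus "cj Q h g \<otimes>\<^bsub>Q\<^esub> inv\<^bsub>Q\<^esub> g \<in> \<phi> ` N" using N(2) gh by blast
    next
      fix g assume "g \<in> carrier Q"
      then obtain g' where g: "g' \<in> carrier G" "g = \<phi> g'" using q.surj by blast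
      hence "g [^]\<^bsub>Q\<^esub> (p - 1) = \<phi> (g' [^] (p - 1))" using q.gh.hom_nat_pow by simp
      thus "g [^]\<^bsub>Q\<^esub> (p - 1) \<in> \<phi> ` N" using N(3) g by blast
    next
      fix g x assume "g \<in> \<phi> ` N" "x \<in> \<phi> ` P"
      then obtain g' x' where g: "g' \<in> N" "g = \<phi> g'" "x' \<in> P" "x = \<phi> x'" by blast
      hence "cj Q (g [^]\<^bsub>Q\<^esub> (p ^ k)) x = \<phi> (cj G (g' [^] (p ^ k)) x')" using Nc Pc by (simp add: q.hom_cj q.gh.hom_nat_pow)
      thus "cj Q (g [^]\<^bsub>Q\<^esub> (p ^ k)) x = x" using N(4) g by simp
    qed
    hence "rchain Q p {\<one>\<^bsub>Q\<^esub>} (\<phi> ` P)"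
      using IH[of "n - 1" Q "\<phi> ` P"] n0 q.Q.fin_group_axioms q.img_nml[OF P(1)] cP' by simp
    hence "rchain G p V P" using q.rchain_vim[of p "{\<one>\<^bsub>Q\<^esub>}" "\<phi> ` P"] q.vim_one q.vim_img[OF Ps V(2)] by simp
    moreover have "rchain G p {\<one>} V"
      using rchain.intros(2)[OF rchain.intros(1)[OF nml_one] Vn, of p] subgroup.one_closed[OF Vs] cV by simp
    ultimately show ?thesis using rchain_trans by blast
  qed
qed

end

theorem Uemb_rchain:
  assumes p: "Factorial_Ring.prime p"
  shows "fin_group G \<Longrightarrow> nml G P \<Longrightarrow> card P = p ^ n \<Longrightarrow> Uemb G p P \<Longrightarrow> rchain G p {\<one>\<^bsub>G\<^esub>} P"
proof (induction n arbitrary: G P rule: less_induct)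
  case (less n)
  show ?case by (rule fin_group.Uemb_rchain_step[OF less.prems(1) p less.prems(2-4)]) (rule less.IH)
qed

section \<open>Subgroups of order p\<close>

text \<open>In the finite groups considered, natural exponents already give all powers.\<close>

definition cyc :: "('a, 'b) monoid_scheme \<Rightarrow> 'a \<Rightarrow> 'a set" where
  "cyc G x = range (\<lambda>i::nat. x [^]\<^bsub>G\<^esub> i)"

context fin_group
begin

lemma cyc_self: "x \<in> carrier G \<Longrightarrow> x \<in> cyc G x"
  unfolding cyc_def by (rule range_eqI[of _ _ 1]) simp

lemma cyc_subgroup: "x \<in> carrier G \<Longrightarrow> subgroup (cyc G x) G"
proof (rule fin_subgroupI)
  assume x: "x \<in> carrier G"
  show "cyc G x \<subseteq> carrier G" using x by (auto simp: cyc_def)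
  show "\<one> \<in> cyc G x" unfolding cyc_def by (rule range_eqI[of _ _ 0]) simp
  fix a b assume "a \<in> cyc G x" "b \<in> cyc G x"
  then obtain i j :: nat where "a = x [^] i" "b = x [^] j" by (auto simp: cyc_def)
  hence "a \<otimes> b = x [^] (i + j)" using x by (simp add: nat_pow_mult)
  thus "a \<otimes> b \<in> cyc G x" by (auto simp: cyc_def)
qed

lemma cyc_least: "subgroup H G \<Longrightarrow> x \<in> H \<Longrightarrow> cyc G x \<subseteq> H"
  using pow_mem by (auto simp: cyc_def)

lemma cyc_card_p:
  assumes "x \<in> carrier G" "x [^] p = \<one>" "x \<noteq> \<one>" "Factorial_Ring.prime (p::nat)"
  shows "card (cyc G x) = p"
proof -
  have "card {a \<otimes> x [^] (i::nat) |a i. a \<in> {\<one>}} = p * card {\<one>}"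
    by (rule adjoin(2)[OF triv_subgroup]) (use assms in \<open>auto simp: nrm_def\<close>)
  moreover have "{a \<otimes> x [^] (i::nat) |a i. a \<in> {\<one>}} = cyc G x" using assms by (auto simp: cyc_def)
  ultimately show ?thesis by simp
qed

lemma cyc_card_4:
  assumes x: "x \<in> carrier G" and x4: "x [^] (4::nat) = \<one>" and x2: "x [^] (2::nat) \<noteq> \<one>"
  shows "card (cyc G x) = 4"
proof -
  let ?z = "x [^] (2::nat)"
  have z: "?z \<in> carrier G" "?z [^] (2::nat) = \<one>" using x x4 by (simp_all add: nat_pow_pow)
  note A = cyc_subgroup[OF z(1)]
  have cA: "card (cyc G ?z) = 2" using cyc_card_p[OF z x2] by simp
  have xn: "x \<in> nrm G (cyc G ?z)"
  proof -
    have "cj G x a = a" if a: "a \<in> cyc G ?z" for a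
    proof -
      obtain i :: nat where "a = ?z [^] i" using a by (auto simp: cyc_def)
      hence "a = x [^] (2 * i)" using x by (simp add: nat_pow_pow)
      thus ?thesis using x cj_pow[OF x x, of "2 * i"] cj_fix_iff[OF x x] by simp
    qed
    thus ?thesis using x by (simp add: nrm_def)
  qed
  have nx: "x \<notin> cyc G ?z"
  proof
    assume "x \<in> cyc G ?z"
    then obtain i :: nat where "x = ?z [^] i" by (auto simp: cyc_def)
    hence "?z = (?z [^] i) [^] (2::nat)" by simp
    also have "\<dots> = (?z [^] (2::nat)) [^] i" using z(1) by (simp add: nat_pow_pow mult.commute)
    finally show False using z(2) x2 by simp
  qed
  have "?z \<in> cyc G ?z" using cyc_self z by blast
  note C = adjoin[OF A xn two_is_prime_nat this nx]
  have "{a \<otimes> x [^] (i::nat) |a i. a \<in> cyc G ?z} = cyc G x"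
  proof
    show "{a \<otimes> x [^] (i::nat) |a i. a \<in> cyc G ?z} \<subseteq> cyc G x"
    proof clarify
      fix a and i :: nat assume "a \<in> cyc G ?z"
      hence "a \<in> cyc G x" using cyc_least[OF cyc_subgroup[OF x], of ?z] pow_mem[OF cyc_subgroup[OF x] cyc_self[OF x]] by blast
      thus "a \<otimes> x [^] i \<in> cyc G x"
        using subgroup.m_closed[OF cyc_subgroup[OF x]] pow_mem[OF cyc_subgroup[OF x] cyc_self[OF x]] by blast
    qed
    show "cyc G x \<subseteq> {a \<otimes> x [^] (i::nat) |a i. a \<in> cyc G ?z}" by (rule cyc_least[OF C(1,4)])
  qed
  thus ?thesis using C(2) cA by simp
qed

lemma pow_p_cong:
  assumes "x \<in> carrier G" "x [^] p = \<one>" "[i = j] (mod (p::nat))"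
  shows "x [^] i = x [^] j"
proof -
  have "x [^] k = x [^] (k mod p)" for k :: nat
  proof -
    have "x [^] k = x [^] (p * (k div p) + k mod p)" by simp
    also have "\<dots> = (x [^] p) [^] (k div p) \<otimes> x [^] (k mod p)"
      using assms(1) by (simp only: nat_pow_mult nat_pow_pow nat_pow_closed)
    finally show ?thesis using assms by simp
  qed
  thus ?thesis using assms(3) unfolding cong_def by metis
qed

lemma pow_p_cong_iff:
  assumes x: "x \<in> carrier G" "x [^] p = \<one>" "x \<noteq> \<one>" and p: "Factorial_Ring.prime (p::nat)"
  shows "x [^] i = x [^] j \<longleftrightarrow> [i = j] (mod p)"
proof
  have key: "[i = j] (mod p)" if "i \<le> j" "x [^] i = x [^] j" for i j :: nat
  proof (rule ccontr)
    assume nc: "\<not> [i = j] (mod p)"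
    have "x [^] j = x [^] i \<otimes> x [^] (j - i)" using x that(1) by (simp add: nat_pow_mult)
    hence 1: "x [^] (j - i) = \<one>" using that(2) x by simp
    have "\<not> p dvd j - i" using nc that(1) cong_altdef_nat'[of i j p] by (metis cong_sym cong_altdef_nat)
    hence "coprime p (j - i)" using p prime_imp_coprime by blast
    thus False using pow_coprime_one[OF x(1,2) 1] x(3) by blast
  qed
  assume "x [^] i = x [^] j"
  thus "[i = j] (mod p)" using key[of i j] key[of j i] cong_sym by (metis nle_le)
qed (rule pow_p_cong[OF x(1,2)])

text \<open>A maximal \<open>K\<close>-invariant proper subgroup \<open>Y\<close> of \<open>P\<close> above \<open>K \<inter> P\<close> is normalised by \<open>P\<close>, as normalisers
  grow, hence normal in \<open>G\<close>; as \<open>P / Y\<close> is cyclic, its index is \<open>p\<close>.\<close>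

lemma index_p_nml:
  assumes p: "Factorial_Ring.prime p" and P: "nml G P" "card P = p ^ n" and x: "x \<in> P"
    and K: "subgroup K G" "K \<noteq> carrier G" and KH: "\<And>g. g \<in> carrier G \<Longrightarrow> \<exists>a\<in>K. \<exists>h\<in>cyc G x. g = a \<otimes> h"
  shows "\<exists>M. nml G M \<and> M \<subseteq> P \<and> card P = p * card M"
proof -
  have Ps: "subgroup P G" using P nml_subgroup by blast
  note Pc = subgroup.mem_carrier[OF Ps]
  note Kc = subgroup.mem_carrier[OF K(1)]
  have xc: "x \<in> carrier G" using x Pc by blast
  have cP: "cyc G x \<subseteq> P" using cyc_least[OF Ps x] .
  define R where "R Y \<longleftrightarrow> subgroup Y G \<and> K \<inter> P \<subseteq> Y \<and> Y \<subset> P \<and> K \<subseteq> nrm G Y" for Y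
  \<comment> \<open>Dedekind's law: \<open>P\<close> is the product of \<open>K \<inter> P\<close>
    and \<open>cyc G x\<close>.\<close>
  have PK: "\<exists>a\<in>K\<inter>P. \<exists>i::nat. g = a \<otimes> x [^] i" if g: "g \<in> P" for g
  proof -
    obtain a h where ah: "a \<in> K" "h \<in> cyc G x" "g = a \<otimes> h" using KH[OF Pc[OF g]] by blast
    have "a = g \<otimes> inv h" using ah Kc Pc cP by (auto simp: m_assoc)
    hence "a \<in> P" using g ah(2) cP subgroup.m_closed[OF Ps] subgroup.m_inv_closed[OF Ps] by blast
    thus ?thesis using ah by (auto simp: cyc_def)
  qed
  have "R (K \<inter> P)"
  proof -
    have "K \<inter> P \<noteq> P"
    proof
      assume "K \<inter> P = P"
      hence "cyc G x \<subseteq> K" using cP by blast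
      hence "g \<in> K" if "g \<in> carrier G" for g using KH[OF that] subgroup.m_closed[OF K(1)] by blast
      thus False using K Kc by blast
    qed
    moreover have "K \<subseteq> nrm G (K \<inter> P)" using Kc cj_mem[OF K(1)] nml_cj[OF P(1)] by (auto simp: nrm_def)
    ultimately show ?thesis using subgroups_Inter_pair[OF K(1) Ps] unfolding R_def by blast
  qed
  moreover have "\<forall>Y. R Y \<longrightarrow> card Y < Suc (card P)" using card_proper[OF Ps] unfolding R_def by (simp add: less_SucI)
  ultimately obtain Y where Y: "R Y" "\<And>Z. R Z \<Longrightarrow> card Z \<le> card Y"
    using ex_has_greatest_nat[of R "K \<inter> P" card "Suc (card P)"] by blast
  have Ys: "subgroup Y G" "K \<inter> P \<subseteq> Y" "Y \<subset> P" "K \<subseteq> nrm G Y" using Y(1) unfolding R_def by blast+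
  note Yc = subgroup.mem_carrier[OF Ys(1)]
  have max: "Z = P" if Z: "subgroup Z G" "Y \<subset> Z" "Z \<subseteq> P" "K \<subseteq> nrm G Z" for Z
  proof (rule ccontr)
    assume "Z \<noteq> P"
    hence "R Z" using Z Ys unfolding R_def by blast
    thus False using Y(2) card_proper[OF Z(1,2)] by (simp add: leD)
  qed
  have PY: "P \<subseteq> nrm G Y"
  proof -
    let ?N = "nrm G Y \<inter> P"
    have "subgroup ?N G" by (rule subgroups_Inter_pair[OF subgroup_nrm[OF subgroup.subset[OF Ys(1)]] Ps])
    moreover have "Y \<subset> ?N" using normalizer_growth[OF Ys(1) Ps Ys(3) P(2) p] sub_nrm[OF Ys(1)] Ys(3) by blast
    moreover have "K \<subseteq> nrm G ?N"
    proof
      fix k assume k: "k \<in> K"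
      have kc: "k \<in> carrier G" using k Kc by blast
      have ki: "inv k \<in> nrm G Y" using subgroup.m_inv_closed[OF K(1) k] Ys(4) by blast
      have "cj G k z \<in> ?N" if z: "z \<in> ?N" for z
      proof -
        have zc: "z \<in> carrier G" using z Pc by blast
        have "cj G (cj G k z) y \<in> Y" if y: "y \<in> Y" for y
        proof -
          have "cj G (cj G k z) y = cj G k (cj G z (cj G (inv k) y))"
            using kc zc Yc[OF y] by (simp add: cj_cj) (simp add: cj_def)
          thus ?thesis using nrmD[OF ki y] z nrmD Ys(4) k by (metis IntD1 subsetD)
        qed
        thus ?thesis using nml_cj[OF P(1) kc] z kc zc by (auto simp: nrm_def)
      qed
      thus "k \<in> nrm G ?N" using kc by (simp add: nrm_def)
    qed
    ultimately have "?N = P" using max by blast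
    thus ?thesis by blast
  qed
  have "carrier G \<subseteq> nrm G Y"
  proof
    fix g assume "g \<in> carrier G"
    then obtain a h where "a \<in> K" "h \<in> cyc G x" "g = a \<otimes> h" using KH by blast
    thus "g \<in> nrm G Y" using Ys(4) PY cP subgroup.m_closed[OF subgroup_nrm[OF subgroup.subset[OF Ys(1)]]] by blast
  qed
  hence Yn: "nml G Y" using Ys by (simp add: nml_def)
  have xY: "x \<notin> Y"
  proof
    assume xY: "x \<in> Y"
    have "g \<in> Y" if "g \<in> P" for g using PK[OF that] Ys(2) pow_mem[OF Ys(1) xY] subgroup.m_closed[OF Ys(1)] by blast
    thus False using Ys(3) by blast
  qed
  have "x [^] (p ^ n) \<in> Y" using pow_order_sub[OF Ps x] P(2) subgroup.one_closed[OF Ys(1)] by simp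
  then obtain j where j: "x [^] (p ^ j) \<notin> Y" "(x [^] (p ^ j)) [^] p \<in> Y" using pow_step[OF xc xY] by blast
  define z where "z = x [^] (p ^ j)"
  have zP: "z \<in> P" using pow_mem[OF Ps x] by (simp add: z_def)
  have zn: "z \<in> nrm G Y" using PY zP by blast
  let ?C = "{a \<otimes> z [^] (i::nat) |a i. a \<in> Y}"
  note C = adjoin[OF Ys(1) zn p j(2,1)[folded z_def]]
  have "?C \<subseteq> P"
  proof clarify
    fix a and i :: nat assume "a \<in> Y"
    hence "a \<in> P" using Ys(3) by blast
    thus "a \<otimes> z [^] i \<in> P" using subgroup.m_closed[OF Ps] pow_mem[OF Ps zP] by blast
  qed
  moreover have "Y \<subset> ?C" using C(3,4) j(1) z_def by blast
  \<comment> \<open>Because \<open>K \<inter> P\<close> lies in \<open>Y\<close>, conjugation by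
    \<open>K\<close> moves \<open>x\<close> into a coset of \<open>Y\<close> containing some
    \<open>x [^] i\<close>, hence \<open>z\<close> into the coset of \<open>z [^] i\<close>.\<close>
  moreover have "K \<subseteq> nrm G ?C"
  proof
    fix k assume k: "k \<in> K"
    have kc: "k \<in> carrier G" using k Kc by blast
    obtain a i where ai: "a \<in> K \<inter> P" "cj G k x = a \<otimes> x [^] (i::nat)" using PK[OF nml_cj[OF P(1) kc x]] by blast
    have aY: "a \<in> Y" using ai Ys(2) by blast
    have "x [^] i \<in> nrm G Y" using PY pow_mem[OF Ps x] by blast
    from coset_pow[OF Ys(1) this aY, of "p ^ j"] obtain a' where a': "a' \<in> Y" "(a \<otimes> x [^] i) [^] (p ^ j) = a' \<otimes> (x [^] i) [^] (p ^ j)" by blast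
    have "cj G k z = a' \<otimes> (x [^] i) [^] (p ^ j)" using a' ai(2) kc xc by (simp add: z_def cj_pow)
    also have "(x [^] i) [^] (p ^ j) = z [^] i" using xc by (simp add: z_def nat_pow_pow mult.commute)
    finally have kz: "cj G k z \<in> ?C" using a'(1) by blast
    have "cj G k (y \<otimes> z [^] l) \<in> ?C" if y: "y \<in> Y" for y and l :: nat
    proof -
      have "cj G k y \<in> ?C" using nrmD Ys(4) k y C(3) by blast
      moreover have "cj G k z [^] l \<in> ?C" using pow_mem[OF C(1) kz] .
      ultimately have "cj G k y \<otimes> cj G k z [^] l \<in> ?C" by (rule subgroup.m_closed[OF C(1)])
      thus ?thesis using kc Yc[OF y] Pc[OF zP] by (simp add: cj_mult cj_pow)
    qed
    thus "k \<in> nrm G ?C" using kc unfolding nrm_def by blast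
  qed
  ultimately have "?C = P" using max[OF C(1)] by blast
  hence "card P = p * card Y" using C(2) by simp
  thus ?thesis using Yn Ys(3) by blast
qed

text \<open>A proper supplement would yield a normal subgroup of index \<open>p\<close> by
  \<open>index_p_nml\<close>. So the supplement is \<open>G\<close>, and then
  \<open>psup_full\<close> makes the subgroup normalised by \<open>O^p(G)\<close> all of
  \<open>cyc G x\<close>.\<close>

lemma psup_dichotomy:
  assumes p: "Factorial_Ring.prime p" and P: "nml G P" "card P = p ^ n" and x: "x \<in> P" and ps: "psup G p (cyc G x)"
    and no: "\<not> (\<exists>M. nml G M \<and> M \<subseteq> P \<and> card P = p * card M)"
  shows "\<exists>k. \<forall>g\<in>carrier G. g [^] (p ^ k :: nat) \<in> nrm G (cyc G x)"
proof -
  have Ps: "subgroup P G" using P nml_subgroup by blast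
  have xc: "x \<in> carrier G" using subgroup.mem_carrier[OF Ps x] .
  note H = cyc_subgroup[OF xc]
  obtain h where h: "card (cyc G x) = p ^ h" using card_p_sub[OF H Ps cyc_least[OF Ps x] P(2) p] by blast
  obtain K Y k where K: "subgroup K G" and Y: "subgroup Y G" "Y \<subseteq> cyc G x" 
    and nY: "\<And>g. g \<in> carrier G \<Longrightarrow> g [^] (p ^ k :: nat) \<in> nrm G Y"
    and KH: "\<And>g. g \<in> carrier G \<Longrightarrow> \<exists>a\<in>K. \<exists>h\<in>cyc G x. g = a \<otimes> h"
    and M: "\<And>M. subgroup M G \<Longrightarrow> Y \<subseteq> M \<Longrightarrow> M \<subseteq> cyc G x \<Longrightarrow> card (cyc G x) = p * card M \<Longrightarrow> K \<inter> cyc G x \<subseteq> M"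
    by (rule psupE[OF ps H]) (rule that)
  have "K = carrier G" using index_p_nml[OF p P x K _ KH] no by blast
  hence "Y = cyc G x" using psup_full[OF p H h _ Y M] subgroup.subset[OF H] by blast
  thus ?thesis using nY by blast
qed


text \<open>A \<open>p'\<close>-element of the centraliser of a central \<open>z\<close> of order \<open>p\<close> normalises \<open>\<langle>w\<rangle>\<close> and \<open>\<langle>wz\<rangle>\<close> for each \<open>w\<close>
  of order \<open>p\<close>, hence centralises \<open>w\<close>; so it centralises \<open>P\<close>.\<close>

lemma scalar_Uemb:
  assumes p: "Factorial_Ring.prime p" and P: "nml G P" "card P = p ^ n" "P \<noteq> {\<one>}"
    and S1: "\<And>x. x \<in> P \<Longrightarrow> x \<noteq> \<one> \<Longrightarrow> x [^] p = \<one> \<Longrightarrow> \<exists>k. \<forall>g\<in>carrier G. g [^] (p ^ k :: nat) \<in> nrm G (cyc G x)"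
    and S2: "p = 2 \<Longrightarrow> (\<forall>a\<in>P. \<forall>b\<in>P. a \<otimes> b = b \<otimes> a) \<or>
      (\<forall>x\<in>P. x [^] (4::nat) = \<one> \<longrightarrow> x [^] (2::nat) \<noteq> \<one> \<longrightarrow> (\<exists>k. \<forall>g\<in>carrier G. g [^] (p ^ k :: nat) \<in> nrm G (cyc G x)))"
  shows "Uemb G p P"
proof -
  have Ps: "subgroup P G" using P nml_subgroup by blast
  note Pc = subgroup.mem_carrier[OF Ps]
  obtain S where S: "sylow_subgroup G p S" using sylow_exists[OF p] by blast
  then obtain s where Ss: "subgroup S G" "card S = p ^ s" using sylow_pgroup by blast
  have PS: "P \<subseteq> S" using normal_in_sylow[OF p S P(1,2)] .
  have "S \<subseteq> nrm G P" using P(1) subgroup.subset[OF Ss(1)] by (auto simp: nml_def)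
  note F = fixed_nontrivial[OF Ss p Ps P(2,3) this]
  let ?F = "{v \<in> P. \<forall>x\<in>S. v \<otimes> x = x \<otimes> v}"
  have "?F \<subseteq> P" by blast
  then obtain f where "card ?F = p ^ f" using card_p_sub[OF F(1) Ps _ P(2) p] by blast
  then obtain z where z0: "z \<in> ?F" "z \<noteq> \<one>" "z [^] p = \<one>" using exists_order_p[OF F(1) _ F(2)] by blast
  hence z: "z \<in> P" "z \<noteq> \<one>" "z [^] p = \<one>" and zS: "\<And>x. x \<in> S \<Longrightarrow> z \<otimes> x = x \<otimes> z" by blast+
  have zc: "z \<in> carrier G" using z Pc by blast
  note Sc = subgroup.mem_carrier[OF Ss(1)]
  have Zn: "nml G (cyc G z)"
  proof -
    obtain k where "\<And>g. g \<in> carrier G \<Longrightarrow> g [^] (p ^ k :: nat) \<in> nrm G (cyc G z)" using S1[OF z] by blast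
    moreover have "S \<subseteq> nrm G (cyc G z)"
    proof
      fix x assume x: "x \<in> S"
      have "cj G x z = z" using zS[OF x] cj_fix_iff[of x z] x Sc zc by blast
      hence "cj G x (z [^] i) = z [^] i" for i :: nat using x Sc zc by (simp add: cj_pow)
      thus "x \<in> nrm G (cyc G z)" using x Sc by (auto simp: nrm_def cyc_def)
    qed
    ultimately show ?thesis using nml_gen[OF p S cyc_subgroup[OF zc]] by blast
  qed
  have act: "\<exists>i::nat. cj G g z = z [^] i" if "g \<in> carrier G" for g
    using nml_cj[OF Zn that cyc_self[OF zc]] by (auto simp: cyc_def)
  \<comment> \<open>\<open>G\<close> acts on the normal subgroup \<open>cyc G z\<close> of order
    \<open>p\<close> through a cyclic group of order dividing \<open>p - 1\<close>. The kernel
    \<open>N\<close> is therefore the candidate for \<open>Uemb\<close>.\<close>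
  define N where "N = {g \<in> carrier G. \<forall>c\<in>{z}. g \<otimes> c = c \<otimes> g}"
  have Ns: "subgroup N G" unfolding N_def by (rule subgroup_centI[OF subgroup_self]) (use zc in simp)
  have Niff: "g \<in> N \<longleftrightarrow> cj G g z = z" if "g \<in> carrier G" for g
    using that cj_fix_iff[OF that zc] by (auto simp: N_def)
  have comm: "cj G h g \<otimes> inv g \<in> N" if gh: "g \<in> carrier G" "h \<in> carrier G" for g h
  proof -
    obtain m where m: "cj G (inv h) z = z [^] (m::nat)" using act gh by blast
    obtain i where i: "cj G g z = z [^] (i::nat)" using act gh by blast
    obtain j where j: "cj G h z = z [^] (j::nat)" using act gh by blast
    obtain l where l: "cj G (inv g) z = z [^] (l::nat)" using act gh by blast
    have "cj G h (cj G (inv h) z) = z" using gh zc by simp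
    hence 1: "z [^] (j * m) = z" using m j gh zc by (simp add: cj_pow nat_pow_pow)
    have "cj G (inv g) (cj G g z) = z" using gh zc by simp
    hence 2: "z [^] (l * i) = z" using i l gh zc by (simp add: cj_pow nat_pow_pow)
    have "cj G (cj G h g \<otimes> inv g) z = cj G (inv g) (cj G h (cj G g (cj G (inv h) z)))"
      using gh zc by (simp add: cj_cj) (simp add: cj_def m_assoc)
    also have "\<dots> = z [^] (l * j * i * m)" using m i j l gh zc by (simp add: cj_pow nat_pow_pow mult.assoc)
    also have "\<dots> = (z [^] (j * m)) [^] (l * i)" using zc by (simp add: nat_pow_pow mult_ac)
    also have "\<dots> = z" using 1 2 by simp
    finally show ?thesis using Niff[of "cj G h g \<otimes> inv g"] gh by simp
  qed
  have "nml G N"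
  proof (rule nmlI[OF Ns])
    fix g x assume g: "g \<in> carrier G" and x: "x \<in> N"
    have xc: "x \<in> carrier G" using x by (simp add: N_def)
    have "cj G g x \<otimes> inv x \<otimes> x \<in> N" using subgroup.m_closed[OF Ns comm[OF xc g] x] .
    thus "cj G g x \<in> N" using g xc by (simp add: m_assoc)
  qed
  moreover have "g [^] (p - 1) \<in> N" if g: "g \<in> carrier G" for g
  proof -
    obtain i where i: "cj G g z = z [^] (i::nat)" using act g by blast
    have pw: "cj G (g [^] k) z = z [^] (i ^ k)" for k :: nat
    proof (induction k)
      case (Suc k)
      have "cj G (g [^] Suc k) z = cj G g (cj G (g [^] k) z)" using g zc by (simp add: cj_cj)
      also have "\<dots> = z [^] (i ^ Suc k)" using Suc i g zc by (simp add: cj_pow nat_pow_pow mult.commute)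
      finally show ?case .
    qed (use zc in simp)
    have "\<not> p dvd i"
    proof
      assume "p dvd i"
      hence "[i = 0] (mod p)" by (simp add: cong_0_iff)
      hence "cj G g z = \<one>" using pow_p_cong[OF zc z(3), of i 0] i by simp
      thus False using g zc z(2) by simp
    qed
    hence "[i ^ (p - 1) = 1] (mod p)" using fermat_theorem[OF p] by blast
    hence "cj G (g [^] (p - 1)) z = z" using pow_p_cong[OF zc z(3)] pw zc by simp
    thus ?thesis using Niff g by simp
  qed
  moreover have "\<exists>k. \<forall>g\<in>N. \<forall>w\<in>P. cj G (g [^] (p ^ k :: nat)) w = w"
  proof -
    \<comment> \<open>\<open>p ^ ?k\<close> is the full \<open>p\<close>-part of the group order, so
      \<open>p ^ ?k\<close>-th powers are \<open>p'\<close>-elements.\<close>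
    let ?k = "multiplicity p (Coset.order G)"
    have "Coset.order G \<noteq> 0" using fin order_gt_0_iff_finite by auto
    then obtain m where m: "Coset.order G = p ^ ?k * m" "\<not> p dvd m"
      using p by (metis multiplicity_decompose' not_prime_unit)
    have cop: "coprime m p" using m(2) p prime_imp_coprime coprime_commute by blast
    have "cj G (g [^] (p ^ ?k)) w = w" if g: "g \<in> N" and w: "w \<in> P" for g w
    proof -
      define y where "y = g [^] (p ^ ?k)"
      have gc: "g \<in> carrier G" using g by (simp add: N_def)
      have yN: "y \<in> N" using pow_mem[OF Ns g] by (simp add: y_def)
      have yc: "y \<in> carrier G" using gc by (simp add: y_def)
      have ym: "y [^] m = \<one>" using pow_order_eq_1[OF gc] m(1) gc by (simp add: y_def nat_pow_pow)
      have yz: "cj G y z = z" using Niff yN yc by blast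
      have ynrm: "y \<in> nrm G H" if H: "subgroup H G" and ek: "\<exists>k. \<forall>g\<in>carrier G. g [^] (p ^ k :: nat) \<in> nrm G H" for H
      proof -
        obtain k where k: "y [^] (p ^ k :: nat) \<in> nrm G H" using ek yc by blast
        have NH: "subgroup (nrm G H) G" by (rule subgroup_nrm[OF subgroup.subset[OF H]])
        have "y [^] m \<in> nrm G H" using ym subgroup.one_closed[OF NH] by simp
        moreover have "coprime m (p ^ k)" using cop by simp
        ultimately show ?thesis using pow_coprime_mem[OF NH yc _ k] by blast
      qed
      have act_y: "\<exists>i::nat. cj G y v = v [^] i" if v: "v \<in> P" "y \<in> nrm G (cyc G v)" for v
        using nrmD[OF v(2) cyc_self] v(1) Pc by (auto simp: cyc_def)
      have o1: "cj G y v = v" if v: "v \<in> P" "v [^] p = \<one>" for v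
      proof (cases "v \<in> cyc G z")
        case True
        then obtain i :: nat where "v = z [^] i" by (auto simp: cyc_def)
        thus ?thesis using yz yc zc by (simp add: cj_pow)
      next
        case False
        have vc: "v \<in> carrier G" using v Pc by blast
        have v1: "v \<noteq> \<one>" using False subgroup.one_closed[OF cyc_subgroup[OF zc]] by blast
        have vz: "v \<otimes> z = z \<otimes> v" using zS[of v] v PS by auto
        have prod: "v \<otimes> z \<in> P" "(v \<otimes> z) [^] p = \<one>"
          using v z subgroup.m_closed[OF Ps] vc zc vz by (auto simp: pow_mult_distrib)
        have prod1: "v \<otimes> z \<noteq> \<one>"
        proof
          assume "v \<otimes> z = \<one>"
          hence "v = inv z" using vc zc by (simp add: inv_equality[symmetric])
          thus False using False subgroup.m_inv_closed[OF cyc_subgroup[OF zc] cyc_self[OF zc]] by blast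
        qed
        obtain i :: nat where i: "cj G y v = v [^] i"
          using act_y[OF v(1) ynrm[OF cyc_subgroup[OF vc] S1[OF v(1) v1 v(2)]]] by blast
        obtain j :: nat where j: "cj G y (v \<otimes> z) = (v \<otimes> z) [^] j"
          using act_y[OF prod(1) ynrm[OF cyc_subgroup S1[OF prod(1) prod1 prod(2)]]] vc zc by blast
        have e: "v [^] i \<otimes> z = v [^] j \<otimes> z [^] j"
        proof -
          have "v [^] i \<otimes> z = cj G y (v \<otimes> z)" using i yz yc vc zc by (simp add: cj_mult)
          also have "\<dots> = v [^] j \<otimes> z [^] j" by (simp only: j pow_mult_distrib[OF vz vc zc])
          finally show ?thesis .
        qed
        \<comment> \<open>Otherwise \<open>z z^-j\<close> would be a nontrivial element common to
          \<open>cyc G z\<close> and \<open>cyc G v\<close>. Both have order \<open>p\<close>, so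
          they would coincide, although \<open>v\<close> is not in \<open>cyc G z\<close>.\<close>
        have zj: "z = z [^] j"
        proof (rule ccontr)
          assume ne: "z \<noteq> z [^] j"
          let ?q = "z \<otimes> inv (z [^] j)"
          have "v [^] i \<otimes> ?q = v [^] j"
          proof -
            have "v [^] i \<otimes> ?q = v [^] j \<otimes> z [^] j \<otimes> inv (z [^] j)" using vc zc by (simp add: e flip: m_assoc)
            thus ?thesis using vc zc by (simp add: m_assoc)
          qed
          hence "?q = inv (v [^] i) \<otimes> v [^] j" using vc zc inv_cancel(1)[of "v [^] i" ?q] by simp
          moreover have "inv (v [^] i) \<otimes> v [^] j \<in> cyc G v"
            using subgroup.m_closed[OF cyc_subgroup[OF vc]] subgroup.m_inv_closed[OF cyc_subgroup[OF vc]] by (simp add: cyc_def)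
          ultimately have qv: "?q \<in> cyc G v" by simp
          have qz: "?q \<in> cyc G z"
            using subgroup.m_closed[OF cyc_subgroup[OF zc] cyc_self[OF zc]] subgroup.m_inv_closed[OF cyc_subgroup[OF zc]]
              pow_mem[OF cyc_subgroup[OF zc] cyc_self[OF zc]] by blast
          have qc: "?q \<in> carrier G" using zc by simp
          have q1: "?q \<noteq> \<one>"
          proof
            assume "?q = \<one>"
            hence "z = inv (inv (z [^] j))" using zc inv_equality[of z "inv (z [^] j)"] by simp
            thus False using ne zc by simp
          qed
          obtain l :: nat where "?q = z [^] l" using qz by (auto simp: cyc_def)
          hence qp: "?q [^] p = \<one>" using z(3) zc by (metis nat_pow_one nat_pow_pow mult.commute)
          have sub: "cyc G ?q \<subseteq> cyc G z" "cyc G ?q \<subseteq> cyc G v"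
            using cyc_least[OF cyc_subgroup[OF zc] qz] cyc_least[OF cyc_subgroup[OF vc] qv] by auto
          have "card (cyc G ?q) = p" "card (cyc G z) = p" "card (cyc G v) = p"
            using cyc_card_p[OF qc qp q1 p] cyc_card_p[OF zc z(3,2) p] cyc_card_p[OF vc v(2) v1 p] by auto
          hence "cyc G ?q = cyc G z" "cyc G ?q = cyc G v"
            using sub_eq[OF cyc_subgroup[OF zc] sub(1)] sub_eq[OF cyc_subgroup[OF vc] sub(2)] by auto
          thus False using False cyc_self[OF vc] by simp
        qed
        hence "z [^] (1::nat) = z [^] j" using zc by simp
        hence "[1 = j] (mod p)" using pow_p_cong_iff[OF zc z(3,2) p] by blast
        hence vj: "v [^] j = v" using pow_p_cong[OF vc v(2), of 1 j] vc by simp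
        have "v [^] i \<otimes> z = v [^] j \<otimes> z" using e zj by simp
        hence "v [^] i = v [^] j" using vc zc by simp
        thus ?thesis using i vj by simp
      qed
      have o2: "(\<forall>v\<in>P. v [^] (4::nat) = \<one> \<longrightarrow> cj G y v = v) \<or> (\<forall>a\<in>P. \<forall>b\<in>P. a \<otimes> b = b \<otimes> a)" if p2: "p = 2"
      proof (cases "\<forall>a\<in>P. \<forall>b\<in>P. a \<otimes> b = b \<otimes> a")
        case False
        have "cj G y v = v" if v: "v \<in> P" "v [^] (4::nat) = \<one>" for v
        proof (cases "v [^] (2::nat) = \<one>")
          case True
          thus ?thesis using o1 v p2 by simp
        next
          case v2: False
          have vc: "v \<in> carrier G" using v Pc by blast
          have "\<exists>k. \<forall>g\<in>carrier G. g [^] (p ^ k :: nat) \<in> nrm G (cyc G v)" using S2[OF p2] False v v2 by blast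
          then obtain i :: nat where i: "cj G y v = v [^] i" using act_y[OF v(1) ynrm[OF cyc_subgroup[OF vc]]] by blast
          have red: "v [^] (4 * q + r) = v [^] r" for q r :: nat
          proof -
            have "v [^] (4 * q + r) = (v [^] (4::nat)) [^] q \<otimes> v [^] r" using vc by (simp only: nat_pow_mult nat_pow_pow nat_pow_closed)
            thus ?thesis using v(2) vc by simp
          qed
          \<comment> \<open>For odd \<open>i\<close> the square is 1 modulo 4, so
            \<open>y [^] 2\<close> centralises \<open>v\<close>; since \<open>y [^] m\<close> is
            trivial with \<open>m\<close> odd, \<open>y\<close> centralises \<open>v\<close> as
            well.\<close>
          have "odd i"
          proof
            assume "even i"
            then obtain l where "i = 2 * l" by blast
            hence "cj G y (v [^] (2::nat)) = v [^] (4 * l)" using i yc vc by (simp add: cj_pow nat_pow_pow)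
            also have "\<dots> = \<one>" using red[of l 0] by simp
            finally show False using v2 yc vc by simp
          qed
          then obtain l where l: "i = 2 * l + 1" by (metis oddE)
          have "cj G y (cj G y v) = v [^] (i * i)" using i yc vc by (simp add: cj_pow nat_pow_pow)
          also have "i * i = 4 * (l * l + l) + 1" by (simp add: l algebra_simps)
          also have "v [^] \<dots> = v" using red[of "l * l + l" 1] vc by simp
          finally have y2: "cj G (y [^] (2::nat)) v = v" using yc vc by (simp add: cj_cj numeral_2_eq_2)
          let ?C = "{g \<in> carrier G. \<forall>c\<in>{v}. g \<otimes> c = c \<otimes> g}"
          have Cs: "subgroup ?C G" by (rule subgroup_centI[OF subgroup_self]) (use vc in simp)
          have "y [^] (2::nat) \<in> ?C" using y2 cj_fix_iff[of "y [^] (2::nat)" v] yc vc by auto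
          moreover have "y [^] m \<in> ?C" using ym subgroup.one_closed[OF Cs] by simp
          moreover have "coprime m 2" using cop p2 by simp
          ultimately have "y \<in> ?C" using pow_coprime_mem[OF Cs yc] by blast
          thus ?thesis using cj_fix_iff[OF yc vc] by auto
        qed
        thus ?thesis by blast
      qed blast
      have "y \<in> nrm G P" using P(1) yc by (auto simp: nml_def)
      hence "cj G y w = w" using coprime_centralizes[OF p yc ym cop Ps P(2) _ o1 o2 w] by blast
      thus ?thesis by (simp add: y_def)
    qed
    thus ?thesis by blast
  qed
  ultimately show ?thesis using comm unfolding Uemb_def by blast
qed

text \<open>Both conditions on cyclic subgroups are inherited by smaller subgroups, so a normal
  subgroup of index \<open>p\<close> is treated by induction. If there is none,
  \<open>psup_dichotomy\<close> makes \<open>O^p(G)\<close> normalise the cyclic subgroups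
  concerned, and \<open>scalar_Uemb\<close> applies.\<close>

lemma order_p_rchain:
  assumes p: "Factorial_Ring.prime p"
  shows "\<lbrakk>nml G P; card P = p ^ n; \<And>H. subgroup H G \<Longrightarrow> H \<subseteq> P \<Longrightarrow> card H = p \<Longrightarrow> psup G p H;
    p = 2 \<Longrightarrow> (\<forall>a\<in>P. \<forall>b\<in>P. a \<otimes> b = b \<otimes> a) \<or>
      (\<forall>x\<in>P. card (cyc G x) = 4 \<longrightarrow> psup G p (cyc G x))\<rbrakk> \<Longrightarrow> rchain G p {\<one>} P"
proof (induction n arbitrary: P)
  case 0
  hence "P = {\<one>}" using card_one_iff nml_subgroup by simp
  thus ?case using rchain.intros(1)[OF nml_one] by simp
next
  case (Suc n)
  note P = Suc.prems(1,2) and h1 = Suc.prems(3) and h2 = Suc.prems(4)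
  have Ps: "subgroup P G" using P nml_subgroup by blast
  note Pc = subgroup.mem_carrier[OF Ps]
  show ?case
  proof (cases "\<exists>M. nml G M \<and> M \<subseteq> P \<and> card P = p * card M")
    case True
    then obtain M where M: "nml G M" "M \<subseteq> P" "card P = p * card M" by blast
    have "card M = p ^ n" using M(3) P(2) p by auto
    hence "rchain G p {\<one>} M"
    proof (rule Suc.IH[OF M(1)])
      show "psup G p H" if "subgroup H G" "H \<subseteq> M" "card H = p" for H using h1 that M(2) by blast
      show "(\<forall>a\<in>M. \<forall>b\<in>M. a \<otimes> b = b \<otimes> a) \<or> (\<forall>x\<in>M. card (cyc G x) = 4 \<longrightarrow> psup G p (cyc G x))" if "p = 2"
        using h2[OF that] M(2) by blast
    qed
    thus ?thesis by (rule rchain.intros(2)[OF _ P(1) M(2,3)])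
  next
    case False
    have "P \<noteq> {\<one>}" using P(2) prime_gt_1_nat[OF p] by auto
    hence "Uemb G p P"
    proof (rule scalar_Uemb[OF p P])
      fix x assume x: "x \<in> P" "x \<noteq> \<one>" "x [^] p = \<one>"
      have "psup G p (cyc G x)"
        by (rule h1[OF cyc_subgroup[OF Pc[OF x(1)]] cyc_least[OF Ps x(1)] cyc_card_p[OF Pc[OF x(1)] x(3,2) p]])
      thus "\<exists>k. \<forall>g\<in>carrier G. g [^] (p ^ k :: nat) \<in> nrm G (cyc G x)" using psup_dichotomy[OF p P x(1)] False by blast
    next
      assume p2: "p = 2"
      show "(\<forall>a\<in>P. \<forall>b\<in>P. a \<otimes> b = b \<otimes> a) \<or>
        (\<forall>x\<in>P. x [^] (4::nat) = \<one> \<longrightarrow> x [^] (2::nat) \<noteq> \<one> \<longrightarrow> (\<exists>k. \<forall>g\<in>carrier G. g [^] (p ^ k :: nat) \<in> nrm G (cyc G x)))"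
        using h2[OF p2] psup_dichotomy[OF p P _ _ False] cyc_card_4 Pc by blast
    qed
    thus ?thesis using Uemb_rchain[OF p fin_group_axioms P] by blast
  qed
qed

end

section \<open>Subgroups of larger order\<close>

text \<open>The exponent \<open>d\<close> stands for \<open>|D| = p ^ d\<close>. Dividing by a
  normal subgroup of order \<open>p ^ e\<close> shifts both orders alike, giving the condition for
  \<open>d - e\<close>.\<close>

definition hypd :: "('a, 'b) monoid_scheme \<Rightarrow> nat \<Rightarrow> nat \<Rightarrow> 'a set \<Rightarrow> bool" where
  "hypd G p d P \<longleftrightarrow> (\<forall>H. subgroup H G \<longrightarrow> H \<subseteq> P \<longrightarrow> card H = p ^ d \<or> card H = p ^ Suc d \<longrightarrow>
     (\<forall>a\<in>H. \<forall>b\<in>H. a \<otimes>\<^bsub>G\<^esub> b = b \<otimes>\<^bsub>G\<^esub> a) \<and> psup G p H)"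

lemma (in quot) hypd_img:
  assumes "hypd G p d P" "subgroup P G" "N \<subseteq> P" "card N = p ^ e" "e \<le> d"
  shows "hypd Q p (d - e) (\<phi> ` P)"
  unfolding hypd_def
proof (intro allI impI)
  fix H assume H: "subgroup H Q" "H \<subseteq> \<phi> ` P" "card H = p ^ (d - e) \<or> card H = p ^ Suc (d - e)"
  have s: "subgroup (vim H) G" using vim_subgroup H by blast
  have "vim H \<subseteq> P" using vim_mono[OF H(2)] vim_img[OF assms(2,3)] by simp
  moreover have "card (vim H) = p ^ d \<or> card (vim H) = p ^ Suc d"
    using vim_card[OF H(1)] H(3) assms(4,5) by (auto simp flip: power_add power_Suc)
  ultimately have h: "\<forall>a\<in>vim H. \<forall>b\<in>vim H. a \<otimes> b = b \<otimes> a" "psup G p (vim H)"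
    using assms(1) s unfolding hypd_def by blast+
  have im: "\<phi> ` vim H = H" using img_vim subgroup.subset[OF H(1)] by blast
  have "psup Q p H" using psup_img[OF s N_vim[OF H(1)] h(2)] im by simp
  moreover have "a \<otimes>\<^bsub>Q\<^esub> b = b \<otimes>\<^bsub>Q\<^esub> a" if ab: "a \<in> H" "b \<in> H" for a b
  proof -
    obtain a' b' where a: "a' \<in> vim H" "b' \<in> vim H" "a = \<phi> a'" "b = \<phi> b'" using im ab by blast
    hence c: "a' \<in> carrier G" "b' \<in> carrier G" by (auto simp: vim_def)
    have "\<phi> (a' \<otimes> b') = \<phi> (b' \<otimes> a')" using h(1) a by simp
    thus ?thesis using a c by simp
  qed
  ultimately show "(\<forall>a\<in>H. \<forall>b\<in>H. a \<otimes>\<^bsub>Q\<^esub> b = b \<otimes>\<^bsub>Q\<^esub> a) \<and> psup Q p H" by blast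
qed

context fin_group
begin

lemma hypdD:
  assumes "hypd G p d P" "subgroup H G" "H \<subseteq> P" "card H = p ^ d \<or> card H = p ^ Suc d"
  shows "\<And>a b. a \<in> H \<Longrightarrow> b \<in> H \<Longrightarrow> a \<otimes> b = b \<otimes> a" "psup G p H"
  using assms unfolding hypd_def by blast+

text \<open>This is the start of the induction on \<open>d\<close>: for \<open>p = 2\<close> the
  cyclic subgroups of order 4 have order \<open>p ^ Suc 1\<close>, so \<open>hypd\<close> supplies
  their supplements.\<close>

lemma hypd_1_rchain:
  assumes p: "Factorial_Ring.prime p" and P: "nml G P" "card P = p ^ n" and h: "hypd G p 1 P"
  shows "rchain G p {\<one>} P"
proof (rule order_p_rchain[OF p P])
  have Ps: "subgroup P G" using P nml_subgroup by blast
  show "psup G p H" if "subgroup H G" "H \<subseteq> P" "card H = p" for H using hypdD(2)[OF h that(1,2)] that(3) by simp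
  show "(\<forall>a\<in>P. \<forall>b\<in>P. a \<otimes> b = b \<otimes> a) \<or> (\<forall>x\<in>P. card (cyc G x) = 4 \<longrightarrow> psup G p (cyc G x))" if "p = 2"
  proof -
    have "psup G p (cyc G x)" if x: "x \<in> P" and c: "card (cyc G x) = 4" for x
      by (rule hypdD(2)[OF h cyc_subgroup[OF subgroup.mem_carrier[OF Ps x]] cyc_least[OF Ps x]])
        (use c \<open>p = 2\<close> in simp)
    thus ?thesis by blast
  qed
qed

text \<open>The \<open>p\<close>-th power of an element outside the last elementary term of the series would generate a
  normal subgroup of order \<open>p\<close>.\<close>

lemma elementary_chain:
  assumes p: "Factorial_Ring.prime (p::nat)" and ch: "rchain G p R T" and cT: "card T = p ^ t" and cm: "\<And>x y. x \<in> T \<Longrightarrow> y \<in> T \<Longrightarrow> x \<otimes> y = y \<otimes> x"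
    and R: "\<And>x. x \<in> R \<Longrightarrow> x [^] p = \<one>"
    and no: "\<not> (\<exists>V. nml G V \<and> V \<subseteq> T \<and> card V = p)"
  shows "x \<in> T \<Longrightarrow> x [^] p = \<one>"
proof -
  have Ts: "subgroup T G" using rchain_nml[OF ch] nml_subgroup by blast
  note Tc = subgroup.mem_carrier[OF Ts]
  have "rchain G p R A \<Longrightarrow> A \<subseteq> T \<Longrightarrow> \<forall>x\<in>A. x [^] p = \<one>" for A
  proof (induction rule: rchain.induct)
    case rchain_base
    thus ?case using R by blast
  next
    case (rchain_step A B)
    have An: "nml G A" using rchain_nml rchain_step.hyps(1) by blast
    hence As: "subgroup A G" and Bs: "subgroup B G" using nml_subgroup rchain_step.hyps by blast+
    obtain b where b: "card B = p ^ b" using card_p_sub[OF Bs Ts rchain_step.prems cT p] by blast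
    show ?case
    proof (rule ballI, rule ccontr)
      fix x assume x: "x \<in> B" and ne: "x [^] p \<noteq> \<one>"
      have xA: "x \<notin> A" using rchain_step ne by blast
      have xc: "x \<in> carrier G" using x rchain_step.prems Tc by blast
      define z where "z = x [^] p"
      have zA: "z \<in> A" using index_p_facts(1)[OF As Bs rchain_step.hyps(3,4) b p x x] by (simp add: z_def)
      have xn: "x \<in> nrm G A" using An xc by (auto simp: nml_def)
      let ?C = "{a \<otimes> x [^] (i::nat) |a i. a \<in> A}"
      note C = adjoin[OF As xn p zA[unfolded z_def] xA]
      have "?C \<subseteq> B"
      proof clarify
        fix a and i :: nat assume "a \<in> A"
        hence "a \<in> B" using rchain_step.hyps(3) by blast
        thus "a \<otimes> x [^] i \<in> B" using subgroup.m_closed[OF Bs] pow_mem[OF Bs x] by blast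
      qed
      hence CB: "?C = B" using sub_eq[OF Bs] C(2) rchain_step.hyps(4) by simp
      have zp: "z [^] p = \<one>" using rchain_step.IH rchain_step.hyps(3) rchain_step.prems zA by blast
      have zc: "z \<in> carrier G" using xc by (simp add: z_def)
      have "nml G (cyc G z)"
      proof (rule nmlI[OF cyc_subgroup[OF zc]])
        fix g y assume g: "g \<in> carrier G" and "y \<in> cyc G z"
        then obtain l :: nat where y: "y = z [^] l" by (auto simp: cyc_def)
        have "cj G g x \<in> ?C" using nml_cj[OF rchain_step.hyps(2) g x] CB by simp
        then obtain a i where ai: "cj G g x = a \<otimes> x [^] (i::nat)" "a \<in> A" by blast
        have aT: "a \<in> T" using ai(2) rchain_step.hyps(3) rchain_step.prems by blast
        have xT: "x [^] i \<in> T" using pow_mem[OF Ts] x rchain_step.prems by blast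
        \<comment> \<open>\<open>T\<close> is abelian and \<open>A\<close> has exponent
          \<open>p\<close>, so the factor \<open>a\<close> disappears and only a power of
          \<open>z\<close> remains.\<close>
        have "cj G g z = (a \<otimes> x [^] i) [^] p" using ai g xc by (simp add: z_def cj_pow)
        also have "\<dots> = a [^] p \<otimes> (x [^] i) [^] p"
          by (rule pow_mult_distrib[OF cm[OF aT xT] Tc[OF aT] Tc[OF xT]])
        also have "a [^] p = \<one>" using rchain_step.IH rchain_step.hyps(3) rchain_step.prems ai(2) by blast
        also have "\<one> \<otimes> (x [^] i) [^] p = z [^] i" using xc by (simp add: z_def nat_pow_pow mult.commute)
        finally have "cj G g y = z [^] (i * l)" using y g zc by (simp add: cj_pow nat_pow_pow)
        thus "cj G g y \<in> cyc G z" by (auto simp: cyc_def)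
      qed
      moreover have "cyc G z \<subseteq> T" using cyc_least[OF Ts] zA rchain_step.hyps(3) rchain_step.prems by blast
      moreover have "card (cyc G z) = p" using cyc_card_p[OF zc zp _ p] ne by (simp add: z_def)
      ultimately show False using no by blast
    qed
  qed
  thus "x \<in> T \<Longrightarrow> x [^] p = \<one>" using ch by blast
qed

text \<open>If \<open>P\<close> has no normal subgroup of order \<open>p\<close>, then a minimal normal subgroup \<open>N\<close> lies in a normal
  elementary abelian \<open>T\<close> of order \<open>p ^ (d + 1)\<close>. The contradiction comes from a hyperplane \<open>H\<close> of \<open>T\<close> that
  meets \<open>N\<close> in a Sylow-invariant hyperplane \<open>N1\<close> of \<open>N\<close>: its supplement either contains \<open>N\<close>, making \<open>N1\<close>
  normal, or yields a second minimal normal subgroup, modulo which \<open>N\<close> must have order \<open>p\<close>.\<close>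

lemma hypd_step:
  assumes p: "Factorial_Ring.prime p" and P: "nml G P" "card P = p ^ n" and d: "2 \<le> d" "d < n" and h: "hypd G p d P"
    and IH: "\<And>(Q :: ('a, 'b) monoid_scheme) R m d'. 1 \<le> d' \<Longrightarrow> d' < d \<Longrightarrow> fin_group Q \<Longrightarrow> nml Q R \<Longrightarrow> card R = p ^ m \<Longrightarrow> d' < m
      \<Longrightarrow> hypd Q p d' R \<Longrightarrow> rchain Q p {\<one>\<^bsub>Q\<^esub>} R"
  shows "rchain G p {\<one>} P"
proof -
  have p1: "1 < p" using prime_gt_1_nat[OF p] .
  have Ps: "subgroup P G" using P nml_subgroup by blast
  \<comment> \<open>The quotient by \<open>V\<close> satisfies the hypothesis with exponent
    \<open>d - e\<close>, which is at least 1 and smaller than \<open>d\<close>.\<close>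
  have qc: "rchain G p V P" if V: "nml G V" "V \<subseteq> P" "card V = p ^ e" "1 \<le> e" "e < d" for V e
  proof -
    obtain Q \<phi> where "quot G Q \<phi> V" using quot_exists V by blast
    then interpret q: quot G Q \<phi> V .
    have "p ^ n = p ^ e * card (\<phi> ` P)" using q.img_card[OF Ps V(2)] V(3) P(2) by simp
    moreover have "p ^ n = p ^ e * p ^ (n - e)" using V d by (simp flip: power_add)
    ultimately have c: "card (\<phi> ` P) = p ^ (n - e)" using p1 by simp
    have "rchain Q p {\<one>\<^bsub>Q\<^esub>} (\<phi> ` P)"
      by (rule IH[OF _ _ q.Q.fin_group_axioms q.img_nml[OF P(1)] c _ q.hypd_img[OF h Ps V(2,3)]]) (use V d in auto)
    thus ?thesis using q.rchain_vim[of p "{\<one>\<^bsub>Q\<^esub>}" "\<phi> ` P"] q.vim_one q.vim_img[OF Ps V(2)] by simp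
  qed
  show ?thesis
  proof (cases "\<exists>V. nml G V \<and> V \<subseteq> P \<and> card V = p")
    case True
    then obtain V where V: "nml G V" "V \<subseteq> P" "card V = p" by blast
    have "rchain G p V P" using qc[of V 1] V d by simp
    moreover have "rchain G p {\<one>} V"
      using rchain.intros(2)[OF rchain.intros(1)[OF nml_one] V(1), of p] subgroup.one_closed[OF nml_subgroup[OF V(1)]] V(3) by simp
    ultimately show ?thesis using rchain_trans by blast
  next
    case no: False
    have False
    proof -
      have Pne: "P \<noteq> {\<one>}"
      proof
        assume "P = {\<one>}"
        hence "p ^ n = 1" using P(2) by simp
        thus False using p1 d by (cases n) auto
      qed
      obtain N where N: "minnml G N" "N \<subseteq> P" using minnml_exists[OF P(1) Pne] by blast
      have Nn: "nml G N" and Ns: "subgroup N G" and N1: "N \<noteq> {\<one>}" using N nml_subgroup by (auto simp: minnml_def)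
      obtain e where e: "card N = p ^ e" using card_p_sub[OF Ns Ps N(2) P(2) p] by blast
      have "e \<noteq> 0" using e card_one_iff[OF Ns] N1 by auto
      moreover have "e \<noteq> 1" using no Nn N(2) e by auto
      ultimately have e2: "2 \<le> e" by simp
      obtain S where S: "sylow_subgroup G p S" using sylow_exists[OF p] by blast
      then obtain s where Ss: "subgroup S G" "card S = p ^ s" using sylow_pgroup by blast
      have Sc: "S \<subseteq> carrier G" using subgroup.subset[OF Ss(1)] .
      have NS: "N \<subseteq> S" using normal_in_sylow[OF p S P] N(2) by blast
      have one: "{\<one>} \<subseteq> N" "card {\<one>} = p ^ 0" "S \<subseteq> nrm G {\<one>}" "S \<subseteq> nrm G N"
        using subgroup.one_closed[OF Ns] Nn nml_one Sc by (auto simp: nml_def)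
      note btw = inv_between[OF triv_subgroup Ns one(1) Ss p NS one(3,4,2) e]
      note cen = minnml_central[OF p N P]
      \<comment> \<open>Otherwise \<open>N\<close> contains a Sylow-invariant subgroup of order
        \<open>p ^ d\<close>, which would have to be \<open>N\<close> by
        \<open>minnml_psup\<close>.\<close>
      have ed: "e \<le> d"
      proof (rule ccontr)
        assume "\<not> e \<le> d"
        then obtain H where H: "subgroup H G" "H \<subseteq> N" "S \<subseteq> nrm G H" "card H = p ^ d" using btw[of d] by auto
        have "psup G p H" using hypdD(2)[OF h H(1)] H(2,4) N(2) by blast
        moreover have "H \<noteq> {\<one>}"
        proof
          assume "H = {\<one>}"
          hence "p ^ d = 1" using H(4) by simp
          thus False using p1 d by (cases d) auto
        qed
        ultimately have "H = N" using minnml_psup[OF p S N(1) e H(1,2) _ H(3)] by blast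
        thus False using H(4) e p1 \<open>\<not> e \<le> d\<close> by simp
      qed
      have "\<exists>T. T \<subseteq> P \<and> rchain G p N T \<and> card T = p ^ Suc d"
      proof (cases "e < d")
        case True
        have "rchain G p N P" using qc[OF Nn N(2) e _ True] e2 by simp
        moreover have "card P = p ^ (n - e) * card N" using P(2) e ed d by (simp flip: power_add)
        moreover have "Suc d - e \<le> n - e" using d by simp
        ultimately obtain T where "T \<subseteq> P" "rchain G p N T" "card T = p ^ (Suc d - e) * card N"
          using rchain_mid[OF _ p] by blast
        moreover have "p ^ (Suc d - e) * card N = p ^ Suc d" using e ed by (simp flip: power_add power_Suc)
        ultimately show ?thesis by auto
      next
        case False
        hence de: "e = d" using ed by simp
        obtain Q \<phi> where "quot G Q \<phi> N" using quot_exists Nn by blast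
        then interpret q: quot G Q \<phi> N .
        have hq: "hypd Q p 0 (\<phi> ` P)" using q.hypd_img[OF h Ps N(2) e] de by simp
        have Pn: "nml Q (\<phi> ` P)" using q.img_nml P by blast
        obtain m where m: "card (\<phi> ` P) = p ^ m" using q.img_card_p[OF Ps P(2) p] by blast
        have "\<phi> ` P \<noteq> {\<one>\<^bsub>Q\<^esub>}"
        proof
          assume "\<phi> ` P = {\<one>\<^bsub>Q\<^esub>}"
          hence "p ^ n = p ^ d" using q.img_card[OF Ps N(2)] e de P(2) by simp
          thus False using d p1 by simp
        qed
        then obtain V where V: "minnml Q V" "V \<subseteq> \<phi> ` P" using q.Q.minnml_exists[OF Pn] by blast
        have Vn: "nml Q V" and Vs: "subgroup V Q" and V1: "V \<noteq> {\<one>\<^bsub>Q\<^esub>}" using V q.Q.nml_subgroup by (auto simp: minnml_def)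
        obtain v where v: "card V = p ^ v" using q.Q.card_p_sub[OF Vs q.Q.nml_subgroup[OF Pn] V(2) m p] by blast
        have "v \<noteq> 0" using v q.Q.card_one_iff[OF Vs] V1 by auto
        obtain S' where S': "sylow_subgroup Q p S'" using q.Q.sylow_exists[OF p] by blast
        then obtain s' where Ss': "subgroup S' Q" "card S' = p ^ s'" using q.Q.sylow_pgroup by blast
        have VS: "V \<subseteq> S'" using q.Q.normal_in_sylow[OF p S' Vn v] .
        have one': "{\<one>\<^bsub>Q\<^esub>} \<subseteq> V" "card {\<one>\<^bsub>Q\<^esub>} = p ^ 0" "S' \<subseteq> nrm Q {\<one>\<^bsub>Q\<^esub>}" "S' \<subseteq> nrm Q V"
          using subgroup.one_closed[OF Vs] Vn q.Q.nml_one subgroup.subset[OF Ss'(1)] by (auto simp: nml_def)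
        obtain H where H: "subgroup H Q" "H \<subseteq> V" "S' \<subseteq> nrm Q H" "card H = p ^ 1"
          using q.Q.inv_between[OF q.Q.triv_subgroup Vs one'(1) Ss' p VS one'(3,4,2) v, of 1] \<open>v \<noteq> 0\<close> by auto
        have "psup Q p H" using q.Q.hypdD(2)[OF hq H(1)] H(2,4) V(2) by simp
        moreover have "H \<noteq> {\<one>\<^bsub>Q\<^esub>}" using H(4) p1 by auto
        ultimately have "H = V" using q.Q.minnml_psup[OF p S' V(1) v H(1,2) _ H(3)] by blast
        hence cV: "card V = p" using H(4) by simp
        have "card (q.vim V) = p * card N" using q.vim_card[OF Vs] cV by simp
        hence "rchain G p N (q.vim V)"
          by (rule rchain.intros(2)[OF rchain.intros(1)[OF Nn] q.vim_nml[OF Vn] q.N_vim[OF Vs]])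
        moreover have "q.vim V \<subseteq> P" using q.vim_mono[OF V(2)] q.vim_img[OF Ps N(2)] by simp
        moreover have "card (q.vim V) = p ^ Suc d" using q.vim_card[OF Vs] cV e de by simp
        ultimately show ?thesis by blast
      qed
      then obtain T where T: "T \<subseteq> P" "rchain G p N T" "card T = p ^ Suc d" by blast
      have Tn: "nml G T" and NT: "N \<subseteq> T" using rchain_nml[OF T(2)] by auto
      have Ts: "subgroup T G" using Tn nml_subgroup by blast
      note Tc = subgroup.mem_carrier[OF Ts]
      have Tcm: "\<And>x y. x \<in> T \<Longrightarrow> y \<in> T \<Longrightarrow> x \<otimes> y = y \<otimes> x" using hypdD(1)[OF h Ts T(1)] T(3) by blast
      have Tex: "x [^] p = \<one>" if "x \<in> T" for x
        by (rule elementary_chain[OF p T(2,3) Tcm cen(2) _ that]) (use no T(1) in auto)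
      have "e - 1 \<le> e" by simp
      then obtain N1 where N1: "subgroup N1 G" "N1 \<subseteq> N" "S \<subseteq> nrm G N1" "card N1 = p ^ (e - 1)" using btw[of "e - 1"] by auto
      have "card N1 < card N" using N1(4) e e2 p1 by simp
      hence "N1 \<noteq> N" by blast
      then obtain v where v: "v \<in> N" "v \<notin> N1" using N1(2) by blast
      obtain H where H: "subgroup H G" "N1 \<subseteq> H" "H \<subseteq> T" "v \<notin> H" "card T = p * card H"
        using hyperplane[OF Ts Tcm Tex N1(1) _ _ v(2) p] N1(2) NT v(1) by blast
      have cH: "card H = p ^ d" using H(5) T(3) p1 by simp
      have ps: "psup G p H" using hypdD(2)[OF h H(1)] H(3) T(1) cH by blast
      obtain K Y k where K: "subgroup K G" and Y: "subgroup Y G" "Y \<subseteq> H" 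
        and nY: "\<And>g. g \<in> carrier G \<Longrightarrow> g [^] (p ^ k :: nat) \<in> nrm G Y"
        and KH: "\<And>g. g \<in> carrier G \<Longrightarrow> \<exists>a\<in>K. \<exists>h\<in>H. g = a \<otimes> h"
        and M: "\<And>M. subgroup M G \<Longrightarrow> Y \<subseteq> M \<Longrightarrow> M \<subseteq> H \<Longrightarrow> card H = p * card M \<Longrightarrow> K \<inter> H \<subseteq> M"
        by (rule psupE[OF ps H(1)]) (rule that)
      have KT: "nml G (K \<inter> T)"
      proof (rule nmlI[OF subgroups_Inter_pair[OF K Ts]])
        fix g x assume g: "g \<in> carrier G" and x: "x \<in> K \<inter> T"
        obtain a b where ab: "a \<in> K" "b \<in> H" "g = a \<otimes> b" using KH[OF g] by blast
        have ac: "a \<in> carrier G" using ab subgroup.mem_carrier[OF K] by blast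
        have w: "cj G a x \<in> T" "cj G a x \<in> K" using nml_cj[OF Tn ac] x ab cj_mem[OF K] by auto
        have bT: "b \<in> T" using ab H(3) by blast
        have "cj G b (cj G a x) = cj G a x" using cj_fix_iff[of b "cj G a x"] Tcm[OF w(1) bT] w bT Tc by auto
        thus "cj G g x \<in> K \<inter> T" using w ab ac Tc bT x by (simp add: cj_cj)
      qed
      have KT1: "K \<inter> T \<noteq> {\<one>}"
      proof
        assume "K \<inter> T = {\<one>}"
        from cover_card[OF K Ts H(1) KH this] show False using H(5) card_sub_pos[OF H(1)] p1 by simp
      qed
      show False
      proof (rule minnml_cases[OF N(1) KT])
        assume NK: "N \<subseteq> K \<inter> T"
        \<comment> \<open>\<open>H\<close> is elementary abelian. So \<open>Y\<close> contains
          \<open>N1\<close>, and \<open>Y \<inter> N\<close> lies between \<open>N1\<close> and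
          \<open>H \<inter> N\<close>, which turn out to be equal; hence \<open>O^p(G)\<close>
          normalises \<open>N1\<close>.\<close>
        have "K \<inter> H \<subseteq> Y" by (rule psup_elementary[OF p H(1) _ _ Y M]) (use Tcm Tex H(3) in blast)+
        hence N1Y: "N1 \<subseteq> Y" using N1(2) NK H(2) by blast
        have HN: "subgroup (H \<inter> N) G" by (rule subgroups_Inter_pair[OF H(1) Ns])
        obtain c where c: "card (H \<inter> N) = p ^ c" using card_p_sub[OF HN Ns _ e p] by blast
        have "card (H \<inter> N) < card N" by (rule card_proper[OF Ns]) (use v H(4) in blast)
        hence "c < e" using c e p1 by simp
        hence "card (H \<inter> N) \<le> card N1" using c N1(4) p1 by (simp add: power_increasing)
        hence "N1 = H \<inter> N" using sub_eq[OF HN, of N1] N1(2) H(2) by blast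
        hence YN: "Y \<inter> N = N1" using N1Y N1(2) Y(2) by blast
        have "g [^] (p ^ k) \<in> nrm G N1" if g: "g \<in> carrier G" for g
        proof -
          have "cj G (g [^] (p ^ k)) x \<in> Y \<inter> N" if x: "x \<in> Y \<inter> N" for x
            using nrmD[OF nY[OF g]] nml_cj[OF Nn] x g by simp
          thus ?thesis using g YN by (simp add: nrm_def)
        qed
        hence "nml G N1" using nml_gen[OF p S N1(1,3)] by blast
        moreover have "N1 \<noteq> N" using v by blast
        ultimately have "N1 = {\<one>}" using N(1) N1(2) unfolding minnml_def by blast
        hence "p ^ (e - 1) = 1" using N1(4) by simp
        thus False using e2 p1 by simp
      next
        assume KN: "K \<inter> T \<inter> N = {\<one>}"
        obtain N' where N': "minnml G N'" "N' \<subseteq> K \<inter> T" using minnml_exists[OF KT KT1] by blast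
        have Nn': "nml G N'" and Ns': "subgroup N' G" and N1': "N' \<noteq> {\<one>}" using N' nml_subgroup by (auto simp: minnml_def)
        have int: "N' \<inter> N = {\<one>}" using KN N'(2) subgroup.one_closed[OF Ns'] subgroup.one_closed[OF Ns] by blast
        have N'P: "N' \<subseteq> P" using N'(2) T(1) by blast
        obtain e' where e': "card N' = p ^ e'" using card_p_sub[OF Ns' Ps N'P P(2) p] by blast
        have e'1: "1 \<le> e'" using e' card_one_iff[OF Ns'] N1' by (cases e') auto
        \<comment> \<open>Inside \<open>T\<close> the two orders multiply to at most
          \<open>p ^ (d + 1)\<close>, and \<open>e\<close> is at least 2, so \<open>e' < d\<close>.
          This allows a series from \<open>N'\<close> up to \<open>P\<close>, and
          \<open>rchain_min\<close> bounds \<open>N\<close>.\<close>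
        have "p ^ e' * p ^ e \<le> p ^ Suc d" using card_mult_le[OF Ns' Ns Ts _ NT int] N'(2) e e' T(3) by simp
        hence "e' + e \<le> Suc d" using power_le_imp_le_exp[OF p1, of "e' + e" "Suc d"] by (simp only: power_add)
        hence "e' < d" using e2 by simp
        hence "rchain G p N' P" using qc[OF Nn' N'P e' e'1] by blast
        hence "card N = p" using rchain_min[OF _ p N(1) _ e N(2)] int by blast
        thus False using no Nn N(2) by blast
      qed
    qed
    thus ?thesis ..
  qed
qed

end

theorem hypd_rchain:
  assumes p: "Factorial_Ring.prime p"
  shows "fin_group G \<Longrightarrow> nml G P \<Longrightarrow> card P = p ^ n \<Longrightarrow> 1 \<le> d \<Longrightarrow> d < n \<Longrightarrow> hypd G p d P \<Longrightarrow> rchain G p {\<one>\<^bsub>G\<^esub>} P"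
proof (induction d arbitrary: G P n rule: less_induct)
  case (less d)
  show ?case
  proof (cases "d = 1")
    case True
    thus ?thesis using fin_group.hypd_1_rchain[OF less.prems(1) p less.prems(2,3)] less.prems(6) by simp
  next
    case False
    hence d2: "2 \<le> d" using less.prems(4) by simp
    show ?thesis
    proof (rule fin_group.hypd_step[OF less.prems(1) p less.prems(2,3) d2 less.prems(5,6)])
      fix Q :: "('a, 'b) monoid_scheme" and R m d'
      assume "1 \<le> d'" "d' < d" "fin_group Q" "nml Q R" "card R = p ^ m" "d' < m" "hypd Q p d' R"
      thus "rchain Q p {\<one>\<^bsub>Q\<^esub>} R" using less.IH by blast
    qed
  qed
qed

section \<open>s-permutable subgroups and Frattini arguments\<close>

context fin_group
begin

lemma cyc_prime_power:
  assumes q: "Factorial_Ring.prime (q::nat)"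
  shows "z \<in> carrier G \<Longrightarrow> z [^] (q ^ t) = \<one> \<Longrightarrow> \<exists>a. card (cyc G z) = q ^ a"
proof (induction t arbitrary: z)
  case 0
  hence "cyc G z = {\<one>}" by (auto simp: cyc_def)
  thus ?case by (intro exI[of _ 0]) simp
next
  case (Suc t)
  note zc = Suc.prems(1)
  let ?A = "cyc G (z [^] q)"
  have "(z [^] q) [^] (q ^ t) = \<one>" using Suc.prems by (simp add: nat_pow_pow)
  then obtain a where a: "card ?A = q ^ a" using Suc.IH zc by blast
  have A: "subgroup ?A G" using cyc_subgroup zc by simp
  have zA: "?A \<subseteq> cyc G z" using cyc_least[OF cyc_subgroup[OF zc]] pow_mem[OF cyc_subgroup[OF zc] cyc_self[OF zc]] by blast
  have zq: "z [^] q \<in> ?A" using cyc_self zc by simp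
  show ?case
  proof (cases "z \<in> ?A")
    case True
    hence "cyc G z = ?A" using cyc_least[OF A] zA by blast
    thus ?thesis using a by auto
  next
    case False
    have "z \<in> nrm G ?A"
    proof -
      have "cj G z b = b" if b: "b \<in> ?A" for b
      proof -
        obtain i :: nat where "b = z [^] i" using b zA by (auto simp: cyc_def)
        thus ?thesis using zc cj_pow[OF zc zc, of i] cj_fix_iff[OF zc zc] by simp
      qed
      thus ?thesis using zc by (simp add: nrm_def)
    qed
    note C = adjoin[OF A this q zq False]
    let ?C = "{a \<otimes> z [^] (i::nat) |a i. a \<in> ?A}"
    have "?C \<subseteq> cyc G z"
    proof clarify
      fix b and i :: nat assume "b \<in> ?A"
      hence "b \<in> cyc G z" using zA by blast
      thus "b \<otimes> z [^] i \<in> cyc G z"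
        using subgroup.m_closed[OF cyc_subgroup[OF zc]] pow_mem[OF cyc_subgroup[OF zc] cyc_self[OF zc]] by blast
    qed
    hence "cyc G z = ?C" using cyc_least[OF C(1,4)] by blast
    hence "card (cyc G z) = q ^ Suc a" using C(2) a by simp
    thus ?thesis by blast
  qed
qed

lemma sylow_vimage:
  assumes "g \<in> carrier G" "sylow_subgroup G q Q"
  shows "sylow_subgroup G q {z\<in>carrier G. cj G g z \<in> Q}"
  using vimage_cj[OF assms(1)] assms(2) by (simp add: sylow_subgroup_def)

lemma elt_in_sylow:
  assumes q: "Factorial_Ring.prime q" and z: "z \<in> carrier G" "z [^] (q ^ t :: nat) = \<one>"
  shows "\<exists>Q. sylow_subgroup G q Q \<and> z \<in> Q"
proof -
  obtain a where a: "card (cyc G z) = q ^ a" using cyc_prime_power[OF q z] by blast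
  obtain Q where Q: "sylow_subgroup G q Q" using sylow_exists[OF q] by blast
  obtain g where g: "g \<in> carrier G" "\<forall>r\<in>cyc G z. cj G g r \<in> Q" using sylow_conj[OF q Q cyc_subgroup[OF z(1)] a] by blast
  have "z \<in> {z\<in>carrier G. cj G g z \<in> Q}" using g(2) cyc_self[OF z(1)] z(1) by blast
  thus ?thesis using sylow_vimage[OF g(1) Q] by blast
qed

text \<open>One prime \<open>q\<close> is split off at a time, \<open>m = q^t m'\<close>. The power
  \<open>y [^] m'\<close> lies in a Sylow \<open>q\<close>-subgroup, the power of \<open>y\<close>
  with exponent \<open>q^t\<close> is handled by induction, and the two exponents are
  coprime.\<close>

lemma coprime_elt_mem:
  assumes M: "subgroup M G" and sy: "\<And>q Q. Factorial_Ring.prime q \<Longrightarrow> q \<noteq> p \<Longrightarrow> sylow_subgroup G q Q \<Longrightarrow> Q \<subseteq> M"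
  shows "y \<in> carrier G \<Longrightarrow> y [^] (m::nat) = \<one> \<Longrightarrow> m > 0 \<Longrightarrow> \<not> p dvd m \<Longrightarrow> y \<in> M"
proof (induction m arbitrary: y rule: less_induct)
  case (less m)
  show ?case
  proof (cases "m = 1")
    case True
    thus ?thesis using less.prems subgroup.one_closed[OF M] by simp
  next
    case False
    then obtain q where q: "Factorial_Ring.prime q" "q dvd m" using prime_factor_nat by blast
    obtain m' where m': "m = q ^ multiplicity q m * m'" "\<not> q dvd m'"
      using multiplicity_decompose'[of m q] less.prems(3) not_prime_unit q(1) by blast
    let ?t = "multiplicity q m"
    have t0: "?t \<noteq> 0" using q m' by (metis mult_1 power_0)
    have qp: "q \<noteq> p" using q less.prems(4) by blast
    have "(y [^] m') [^] (q ^ ?t) = \<one>" using less.prems(1,2) m'(1) by (simp add: nat_pow_pow mult.commute)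
    hence "\<exists>Q. sylow_subgroup G q Q \<and> y [^] m' \<in> Q" using elt_in_sylow[OF q(1)] less.prems(1) by simp
    hence 1: "y [^] m' \<in> M" using sy[OF q(1) qp] by blast
    have 2: "y [^] (q ^ ?t) \<in> M"
    proof (rule less.IH[of m'])
      have "m' > 0" using m' less.prems(3) by (cases m') auto
      moreover have "1 < q ^ ?t" using one_less_power[OF prime_gt_1_nat[OF q(1)], of ?t] t0 by simp
      ultimately show "m' < m" using m'(1) by (metis mult_less_cancel2 mult_1)
      show "0 < m'" by fact
      show "\<not> p dvd m'" using less.prems(4) m'(1) by (metis dvd_mult)
      show "(y [^] (q ^ ?t)) [^] m' = \<one>" using less.prems(1,2) m'(1) by (simp add: nat_pow_pow)
    qed (use less.prems(1) in simp)
    have "coprime m' (q ^ ?t)" using m'(2) q(1) prime_imp_coprime coprime_commute by (metis coprime_power_right_iff)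
    thus ?thesis using pow_coprime_mem[OF M less.prems(1) 1 2] by blast
  qed
qed

text \<open>Raising to the \<open>p\<close>-part of the group order gives a
  \<open>p'\<close>-element, so the same exponent serves for every \<open>M\<close>.\<close>

lemma p_power_mem:
  assumes p: "Factorial_Ring.prime p" and M: "subgroup M G" and sy: "\<And>q Q. Factorial_Ring.prime q \<Longrightarrow> q \<noteq> p \<Longrightarrow> sylow_subgroup G q Q \<Longrightarrow> Q \<subseteq> M"
    and g: "g \<in> carrier G"
  shows "g [^] (p ^ multiplicity p (Coset.order G)) \<in> M"
proof -
  have pos: "Coset.order G \<noteq> 0" using fin order_gt_0_iff_finite by auto
  obtain m where m: "Coset.order G = p ^ multiplicity p (Coset.order G) * m" "\<not> p dvd m"
    using multiplicity_decompose'[of "Coset.order G" p] pos not_prime_unit p by blast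
  have "m > 0" using m pos by (cases m) auto
  moreover have "(g [^] (p ^ multiplicity p (Coset.order G))) [^] m = \<one>"
    using pow_order_eq_1[OF g] m(1) g by (simp add: nat_pow_pow)
  ultimately show ?thesis using coprime_elt_mem[OF M sy _ _ _ m(2)] g by simp
qed

lemma permuting_product:
  assumes A: "subgroup A G" and B: "subgroup B G" and AB: "A <#> B = B <#> A"
  shows "subgroup (A <#> B) G" "A \<subseteq> A <#> B" "B \<subseteq> A <#> B"
proof -
  note Ac = subgroup.mem_carrier[OF A]
  note Bc = subgroup.mem_carrier[OF B]
  show 1: "A \<subseteq> A <#> B"
  proof
    fix a assume "a \<in> A"
    moreover from this have "a \<otimes> \<one> \<in> A <#> B" using subgroup.one_closed[OF B] unfolding set_mult_def by blast
    ultimately show "a \<in> A <#> B" using Ac by simp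
  qed
  show "B \<subseteq> A <#> B"
  proof
    fix b assume "b \<in> B"
    moreover from this have "\<one> \<otimes> b \<in> A <#> B" using subgroup.one_closed[OF A] unfolding set_mult_def by blast
    ultimately show "b \<in> A <#> B" using Bc by simp
  qed
  show "subgroup (A <#> B) G"
  proof (rule fin_subgroupI)
    show "A <#> B \<subseteq> carrier G" using Ac Bc by (auto simp: set_mult_def)
    show "\<one> \<in> A <#> B" using 1 subgroup.one_closed[OF A] by blast
    fix x y assume "x \<in> A <#> B" "y \<in> A <#> B"
    then obtain a b a' b' where xy: "x = a \<otimes> b" "y = a' \<otimes> b'" "a \<in> A" "b \<in> B" "a' \<in> A" "b' \<in> B" by (auto simp: set_mult_def)
    have "b \<otimes> a' \<in> B <#> A" using xy by (auto simp: set_mult_def)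
    hence "b \<otimes> a' \<in> A <#> B" using AB by simp
    then obtain a2 b2 where ab: "a2 \<in> A" "b2 \<in> B" "b \<otimes> a' = a2 \<otimes> b2" by (auto simp: set_mult_def)
    have "x \<otimes> y = a \<otimes> (b \<otimes> a') \<otimes> b'" using xy Ac Bc by (simp add: m_assoc)
    also have "\<dots> = (a \<otimes> a2) \<otimes> (b2 \<otimes> b')" using ab xy Ac Bc by (simp add: m_assoc)
    finally show "x \<otimes> y \<in> A <#> B" using subgroup.m_closed[OF A xy(3) ab(1)] subgroup.m_closed[OF B ab(2) xy(6)]
      by (auto simp: set_mult_def)
  qed
qed

text \<open>\<open>AS\<close> is a group with Sylow subgroup \<open>S\<close>, so some
  \<open>g = a' s\<close> conjugates \<open>A\<close> into \<open>S\<close>. As \<open>a'\<close>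
  normalises \<open>A\<close> and \<open>s\<close> normalises \<open>S\<close>, already
  \<open>A\<close> lies in \<open>S\<close>.\<close>

lemma s_permutable_in_sylow:
  assumes p: "Factorial_Ring.prime p" and A: "s_permutable G A" "card A = p ^ a" and S: "sylow_subgroup G p S"
  shows "A \<subseteq> S"
proof
  have As: "subgroup A G" and Ss: "subgroup S G" using A S by (auto simp: s_permutable_def sylow_subgroup_def)
  note Ac = subgroup.mem_carrier[OF As]
  note Sc = subgroup.mem_carrier[OF Ss]
  have "A <#> S = S <#> A" using A p S by (auto simp: s_permutable_def)
  note J = permuting_product[OF As Ss this]
  interpret J: fin_group "G\<lparr>carrier := A <#> S\<rparr>" by (rule sub_fin_group[OF J(1)])
  obtain g where g: "g \<in> A <#> S" "\<forall>r\<in>A. cj G g r \<in> S"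
    using J.sylow_conj[OF p sylow_in_sub[OF p S J(1,3)] sub_sub[OF J(1) As J(2)] A(2)] cj_sub[OF J(1)] by auto
  then obtain a' s where as: "g = a' \<otimes> s" "a' \<in> A" "s \<in> S" by (auto simp: set_mult_def)
  fix x assume x: "x \<in> A"
  have "cj G (inv a') x \<in> A" using cj_mem[OF As x] subgroup.m_inv_closed[OF As as(2)] by blast
  hence "cj G g (cj G (inv a') x) \<in> S" using g by blast
  hence "cj G s x \<in> S" using as Ac[OF as(2)] Sc[OF as(3)] Ac[OF x] by (simp flip: cj_cj)
  moreover have "s \<in> nrm G S" using sub_nrm[OF Ss] as(3) by blast
  ultimately show "x \<in> S" using nrm_iff[OF subgroup.subset[OF Ss]] Ac[OF x] by blast
qed

text \<open>\<open>A\<close> lies in the intersection of all Sylow \<open>p\<close>-subgroups, which meets \<open>AQ\<close> exactly in \<open>A\<close>.\<close>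

lemma s_permutable_nrm:
  assumes p: "Factorial_Ring.prime p" and A: "s_permutable G A" "card A = p ^ a"
    and q: "Factorial_Ring.prime q" "q \<noteq> p" "sylow_subgroup G q Q"
  shows "Q \<subseteq> nrm G A"
proof
  fix y assume y: "y \<in> Q"
  obtain S where S: "sylow_subgroup G p S" using sylow_exists[OF p] by blast
  have As: "subgroup A G" and Ss: "subgroup S G" and Qs: "subgroup Q G" using A S q by (auto simp: s_permutable_def sylow_subgroup_def)
  note Ac = subgroup.mem_carrier[OF As]
  have yc: "y \<in> carrier G" using y subgroup.mem_carrier[OF Qs] by blast
  have "A <#> Q = Q <#> A" using A q by (auto simp: s_permutable_def)
  note J = permuting_product[OF As Qs this]
  have "cj G y l \<in> A" if l: "l \<in> A" for l
  proof -
    have lc: "l \<in> carrier G" using l Ac by blast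
    \<comment> \<open>The preimage of \<open>S\<close> under conjugation by \<open>y\<close> is
      again a Sylow \<open>p\<close>-subgroup, so it contains \<open>A\<close>; thus
      \<open>y\<close> conjugates \<open>A\<close> into \<open>S\<close>.\<close>
    have "l \<in> {z\<in>carrier G. cj G y z \<in> S}"
      using s_permutable_in_sylow[OF p A sylow_vimage[OF yc S]] l by blast
    hence uS: "cj G y l \<in> S" by blast
    have "cj G y l \<in> A <#> Q" using cj_mem[OF J(1)] J(2,3) l y by blast
    then obtain l' y' where ly: "cj G y l = l' \<otimes> y'" "l' \<in> A" "y' \<in> Q" by (auto simp: set_mult_def)
    have y'c: "y' \<in> carrier G" using ly subgroup.mem_carrier[OF Qs] by blast
    have "y' = inv l' \<otimes> cj G y l" using ly Ac y'c by (simp add: inv_cancel)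
    moreover have "l' \<in> S" using s_permutable_in_sylow[OF p A S] ly by blast
    ultimately have y'S: "y' \<in> S" using uS subgroup.m_closed[OF Ss] subgroup.m_inv_closed[OF Ss] by simp
    have "coprime (card S) (card Q)" using S q(3) primes_coprime[OF p q(1)] q(2) by (simp add: sylow_subgroup_def)
    hence "y' = \<one>" using pow_coprime_one[OF y'c pow_order_sub[OF Ss y'S] pow_order_sub[OF Qs ly(3)]] by blast
    thus ?thesis using ly Ac by simp
  qed
  thus "y \<in> nrm G A" using yc by (simp add: nrm_def)
qed

text \<open>Each generating subgroup is normalised by all Sylow subgroups for primes other than
  \<open>p\<close>, so the subgroup they generate is too; \<open>p_power_mem\<close> turns this into
  a statement on powers.\<close>

lemma s_core_facts:
  assumes p: "Factorial_Ring.prime p" and H: "subgroup H G" "card H = p ^ h"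
  shows "subgroup (s_core G H) G" "s_core G H \<subseteq> H"
    "\<And>g. g \<in> carrier G \<Longrightarrow> g [^] (p ^ multiplicity p (Coset.order G)) \<in> nrm G (s_core G H)"
proof -
  let ?U = "\<Union>{L. L \<subseteq> H \<and> s_permutable G L}"
  have UH: "?U \<subseteq> H" by blast
  hence Uc: "?U \<subseteq> carrier G" using subgroup.subset[OF H(1)] by blast
  show C: "subgroup (s_core G H) G" unfolding s_core_def by (rule generate_is_subgroup[OF Uc])
  show "s_core G H \<subseteq> H" unfolding s_core_def by (rule generate_subgroup_incl[OF UH H(1)])
  have "Q \<subseteq> nrm G (s_core G H)" if q: "Factorial_Ring.prime q" "q \<noteq> p" "sylow_subgroup G q Q" for q Q
  proof
    fix y assume y: "y \<in> Q"
    have "subgroup Q G" using q by (simp add: sylow_subgroup_def)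
    hence yc: "y \<in> carrier G" using y subgroup.mem_carrier by metis
    let ?V = "{z\<in>carrier G. cj G y z \<in> s_core G H}"
    have UV: "?U \<subseteq> ?V"
    proof
      fix x assume "x \<in> ?U"
      then obtain L where L: "L \<subseteq> H" "s_permutable G L" "x \<in> L" by blast
      have Ls: "subgroup L G" using L by (simp add: s_permutable_def)
      obtain l where l: "card L = p ^ l" using card_p_sub[OF Ls H(1) L(1) H(2) p] by blast
      have "cj G y x \<in> L" using s_permutable_nrm[OF p L(2) l q] y nrmD L(3) by blast
      hence "cj G y x \<in> ?U" using L by blast
      hence "cj G y x \<in> s_core G H" unfolding s_core_def by (rule generate.incl)
      thus "x \<in> ?V" using subgroup.mem_carrier[OF Ls L(3)] by blast
    qed
    have "s_core G H \<subseteq> ?V" using generate_subgroup_incl[OF UV vimage_cj(1)[OF yc C]] by (simp only: s_core_def)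
    thus "y \<in> nrm G (s_core G H)" using yc by (auto simp: nrm_def)
  qed
  thus "g [^] (p ^ multiplicity p (Coset.order G)) \<in> nrm G (s_core G H)" if "g \<in> carrier G" for g
    using p_power_mem[OF p subgroup_nrm[OF subgroup.subset[OF C]] _ that] by blast
qed

lemma index_p_maximal:
  assumes p: "Factorial_Ring.prime p" and H: "subgroup H G" and M: "subgroup M G" "M \<subseteq> H" "card H = p * card M"
  shows "maximal_subgroup (G\<lparr>carrier := H\<rparr>) M"
proof -
  interpret H: fin_group "G\<lparr>carrier := H\<rparr>" by (rule sub_fin_group[OF H])
  have Mp: "card M > 0" by (rule card_sub_pos[OF M(1)])
  have Ms: "subgroup M (G\<lparr>carrier := H\<rparr>)" by (rule sub_sub[OF H M(1,2)])
  have "L = M \<or> L = H" if L: "subgroup L (G\<lparr>carrier := H\<rparr>)" "M \<subseteq> L" for L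
  proof -
    have LH: "L \<subseteq> H" using subgroup.subset[OF L(1)] by simp
    have Lf: "finite L" using LH fin_sub[OF H] finite_subset by blast
    obtain c where c: "card L = card M * c" using H.card_dvd[OF Ms L] by blast
    have "card L dvd card H" using H.card_dvd_order[OF L(1)] by (simp add: Coset.order_def)
    hence "card M * c dvd card M * p" using c M(3) by (simp add: mult.commute)
    hence "c dvd p" using Mp by simp
    hence "c = 1 \<or> c = p" using p prime_nat_iff by blast
    thus ?thesis
    proof
      assume "c = 1"
      hence "M = L" using c card_seteq[OF Lf L(2)] by simp
      thus ?thesis by simp
    next
      assume "c = p"
      hence "L = H" using c M(3) card_seteq[OF fin_sub[OF H] LH] by (simp add: mult.commute)
      thus ?thesis by simp
    qed
  qed
  moreover have "M \<noteq> H" using M(3) Mp prime_gt_1_nat[OF p] by auto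
  ultimately show ?thesis using Ms unfolding maximal_subgroup_def by simp
qed

text \<open>By Dedekind's law \<open>K \<inter> L\<close> supplements \<open>H\<close> in
  \<open>L\<close>. A subgroup of index \<open>p\<close> is maximal in \<open>H\<close>, so it
  contains the Frattini subgroup, and if it contains \<open>s_core G H\<close> then also the product
  of the two.\<close>

lemma wss_psup:
  assumes p: "Factorial_Ring.prime p" and H: "subgroup H G" "card H = p ^ h" and L: "subgroup L G" "H \<subseteq> L"
    and w: "weakly_SPhi_supplemented G H"
  shows "psup (G\<lparr>carrier := L\<rparr>) p H"
proof -
  interpret L: fin_group "G\<lparr>carrier := L\<rparr>" by (rule sub_fin_group[OF L(1)])
  obtain K where K: "subgroup K G" "carrier G = K <#> H" "K \<inter> H \<subseteq> frattini (G\<lparr>carrier := H\<rparr>) <#> s_core G H"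
    using w unfolding weakly_SPhi_supplemented_def by blast
  let ?Y = "s_core G H"
  note Y = s_core_facts[OF p H]
  note Lc = subgroup.mem_carrier[OF L(1)]
  note Kc = subgroup.mem_carrier[OF K(1)]
  show ?thesis unfolding psup_def
  proof (rule exI[of _ "K \<inter> L"], rule exI[of _ ?Y], rule exI[of _ "multiplicity p (Coset.order G)"], intro conjI ballI allI impI)
    show "subgroup (K \<inter> L) (G\<lparr>carrier := L\<rparr>)" using sub_sub[OF L(1) subgroups_Inter_pair[OF K(1) L(1)]] by blast
    show "subgroup ?Y (G\<lparr>carrier := L\<rparr>)" using sub_sub[OF L(1) Y(1)] Y(2) L(2) by blast
    show "?Y \<subseteq> H" by (rule Y(2))
  next
    fix g assume "g \<in> carrier (G\<lparr>carrier := L\<rparr>)"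
    hence g: "g \<in> L" by simp
    have "g [^] (p ^ multiplicity p (Coset.order G)) \<in> nrm G ?Y \<inter> L"
      using Y(3)[OF Lc[OF g]] pow_mem[OF L(1) g] by blast
    thus "g [^]\<^bsub>G\<lparr>carrier := L\<rparr>\<^esub> (p ^ multiplicity p (Coset.order G)) \<in> nrm (G\<lparr>carrier := L\<rparr>) ?Y"
      using nrm_sub[OF subgroup.subset[OF L(1)] L(1), of ?Y] by (simp flip: nat_pow_consistent)
    obtain a b where ab: "a \<in> K" "b \<in> H" "g = a \<otimes> b" using K(2) Lc[OF g] by (auto simp: set_mult_def)
    have bc: "b \<in> L" using ab L(2) by blast
    have "a = g \<otimes> inv b" using ab Kc Lc[OF bc] by (simp add: m_assoc)
    hence "a \<in> L" using g bc subgroup.m_closed[OF L(1)] subgroup.m_inv_closed[OF L(1)] by simp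
    thus "\<exists>a\<in>K \<inter> L. \<exists>h\<in>H. g = a \<otimes>\<^bsub>G\<lparr>carrier := L\<rparr>\<^esub> h" using ab by auto
  next
    fix M assume M: "subgroup M (G\<lparr>carrier := L\<rparr>)" "?Y \<subseteq> M" "M \<subseteq> H" "card H = p * card M"
    have Ms: "subgroup M G" using incl_subgroup[OF L(1) M(1)] .
    have "frattini (G\<lparr>carrier := H\<rparr>) \<subseteq> M" using index_p_maximal[OF p H(1) Ms M(3,4)] unfolding frattini_def by blast
    hence "frattini (G\<lparr>carrier := H\<rparr>) <#> ?Y \<subseteq> M" using M(2) subgroup.m_closed[OF Ms] by (auto simp: set_mult_def)
    thus "K \<inter> L \<inter> H \<subseteq> M" using K(3) by blast
  qed
qed

text \<open>The normal subgroup \<open>N\<close> from \<open>Wemb\<close> contains \<open>S\<close>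
  and its conjugates, and each of its elements acts on \<open>P\<close> like an element of
  \<open>S\<close>, because \<open>S\<close> and the powers acting trivially generate
  \<open>N\<close>. Frattini's argument gives \<open>n\<close> in \<open>N\<close> with
  \<open>b n\<close> normalising \<open>S\<close>; if \<open>n\<close> acts on \<open>P\<close> like
  \<open>u\<close> in \<open>S\<close>, then \<open>b n u^-1\<close> acts like
  \<open>b\<close>.\<close>

lemma frattini_rchain:
  assumes p: "Factorial_Ring.prime p" and S: "sylow_subgroup G p S" and P: "rchain G p {\<one>} P" and b: "b \<in> carrier G"
  shows "\<exists>m\<in>nrm G S. \<forall>x\<in>P. cj G b x = cj G m x"
proof -
  have Pn: "nml G P" using rchain_nml[OF P] by blast
  hence Ps: "subgroup P G" using nml_subgroup by blast
  note Pc = subgroup.mem_carrier[OF Ps]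
  obtain s where Ss: "subgroup S G" "card S = p ^ s" using sylow_pgroup[OF S] by blast
  note Sc = subgroup.mem_carrier[OF Ss(1)]
  obtain N k where N: "nml G N" "\<And>R a. subgroup R G \<Longrightarrow> card R = p ^ a \<Longrightarrow> R \<subseteq> N"
    "\<And>g x. g \<in> N \<Longrightarrow> x \<in> P \<Longrightarrow> cj G (g [^] (p ^ k :: nat)) x = x"
    by (rule WembE[OF rchain_Wemb[OF P p]]) (rule that)
  have Ns: "subgroup N G" using N nml_subgroup by blast
  note Nc = subgroup.mem_carrier[OF Ns]
  have SN: "S \<subseteq> N" using N(2)[OF Ss] .
  interpret N: fin_group "G\<lparr>carrier := N\<rparr>" by (rule sub_fin_group[OF Ns])
  let ?R = "{z\<in>carrier G. cj G (inv b) z \<in> S}"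
  have R: "subgroup ?R G" "card ?R = p ^ s" using vimage_cj[of "inv b", OF _ Ss(1)] b Ss(2) by auto
  have RN: "?R \<subseteq> N" using N(2)[OF R] .
  obtain n where n: "n \<in> N" "\<forall>r\<in>?R. cj G n r \<in> S"
    using N.sylow_conj[OF p sylow_in_sub[OF p S Ns SN] sub_sub[OF Ns R(1) RN] R(2)] cj_sub[OF Ns] by auto
  let ?M = "{x\<in>N. \<exists>s\<in>S. \<forall>w\<in>P. cj G x w = cj G s w}"
  have "?M = N"
  proof (rule gen_all_sub[OF p S Ns SN])
    show "subgroup ?M G"
    proof (rule fin_subgroupI)
      show "\<one> \<in> ?M" using subgroup.one_closed[OF Ns] subgroup.one_closed[OF Ss(1)] by blast
      fix x y assume "x \<in> ?M" "y \<in> ?M"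
      then obtain u v where xy: "x \<in> N" "y \<in> N" "u \<in> S" "v \<in> S" "\<And>w. w \<in> P \<Longrightarrow> cj G x w = cj G u w" "\<And>w. w \<in> P \<Longrightarrow> cj G y w = cj G v w" by blast
      have "cj G (x \<otimes> y) w = cj G (u \<otimes> v) w" if w: "w \<in> P" for w
      proof -
        have "cj G (x \<otimes> y) w = cj G y (cj G u w)" using xy Nc Pc w by (simp flip: cj_cj)
        also have "\<dots> = cj G v (cj G u w)" using xy(6) nml_cj[OF Pn Sc[OF xy(3)] w] by blast
        finally show ?thesis using xy Sc Pc w by (simp add: cj_cj)
      qed
      thus "x \<otimes> y \<in> ?M" using xy subgroup.m_closed[OF Ns] subgroup.m_closed[OF Ss(1)] by blast
    qed (use Nc in blast)
    show "S \<subseteq> ?M" using SN by blast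
    fix g assume g: "g \<in> N"
    have "\<forall>w\<in>P. cj G (g [^] (p ^ k)) w = cj G \<one> w" using N(3)[OF g] Pc by simp
    thus "g [^] (p ^ k) \<in> ?M" using pow_mem[OF Ns g] subgroup.one_closed[OF Ss(1)] by blast
  qed blast
  then obtain u where u: "u \<in> S" "\<And>w. w \<in> P \<Longrightarrow> cj G n w = cj G u w" using n(1) by blast
  have nc: "n \<in> carrier G" and uc: "u \<in> carrier G" using n u Nc Sc by auto
  have bn: "b \<otimes> n \<in> nrm G S"
  proof -
    have "cj G (b \<otimes> n) x \<in> S" if x: "x \<in> S" for x
    proof -
      have "cj G b x \<in> ?R" using x b Sc by simp
      thus ?thesis using n b nc Sc[OF x] by (simp flip: cj_cj)
    qed
    thus ?thesis using b nc by (simp add: nrm_def)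
  qed
  have "inv u \<in> nrm G S" using sub_nrm[OF Ss(1)] subgroup.m_inv_closed[OF Ss(1) u(1)] by blast
  hence m: "b \<otimes> n \<otimes> inv u \<in> nrm G S"
    using subgroup.m_closed[OF subgroup_nrm[OF subgroup.subset[OF Ss(1)]] bn] by blast
  have "cj G b x = cj G (b \<otimes> n \<otimes> inv u) x" if x: "x \<in> P" for x
  proof -
    have "cj G (b \<otimes> n \<otimes> inv u) x = cj G (inv u) (cj G n (cj G b x))" using b nc uc Pc[OF x] by (simp add: cj_cj)
    also have "cj G n (cj G b x) = cj G u (cj G b x)" using u(2) nml_cj[OF Pn b x] by blast
    finally show ?thesis using b uc Pc[OF x] by simp
  qed
  thus ?thesis using m by blast
qed

lemma sylowI:
  assumes p: "Factorial_Ring.prime p" and T: "subgroup T G" "card T = p ^ t" and R: "sylow_subgroup G p R" "card R \<le> card T"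
  shows "sylow_subgroup G p T"
proof -
  have pos: "Coset.order G \<noteq> 0" using fin order_gt_0_iff_finite by auto
  have "p ^ t dvd Coset.order G" using card_dvd_order[OF T(1)] T(2) by simp
  hence "t \<le> multiplicity p (Coset.order G)" using p pos by (intro multiplicity_geI) auto
  moreover have "multiplicity p (Coset.order G) \<le> t"
  proof (rule power_le_imp_le_exp[OF prime_gt_1_nat[OF p]])
    show "p ^ multiplicity p (Coset.order G) \<le> p ^ t" using R T(2) by (simp add: sylow_subgroup_def)
  qed
  ultimately show ?thesis using T by (simp add: sylow_subgroup_def)
qed

text \<open>Frattini's argument in the normal subgroup \<open>C\<close>, in which
  \<open>S \<inter> C\<close> is a Sylow subgroup: the correcting factor \<open>c\<close> lies in
  \<open>C\<close>, so \<open>b c\<close> acts on \<open>P\<close> like \<open>b\<close>.\<close>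

lemma frattini_centralizer:
  assumes p: "Factorial_Ring.prime p" and S: "sylow_subgroup G p S" and P: "nml G P" and b: "b \<in> carrier G"
  defines "C \<equiv> {g\<in>carrier G. \<forall>w\<in>P. g \<otimes> w = w \<otimes> g}"
  shows "subgroup (S \<inter> C) G" "\<exists>m\<in>nrm G (S \<inter> C). \<forall>x\<in>P. cj G b x = cj G m x"
proof -
  have Ps: "subgroup P G" using P nml_subgroup by blast
  note Pc = subgroup.mem_carrier[OF Ps]
  obtain s where Ss: "subgroup S G" "card S = p ^ s" using sylow_pgroup[OF S] by blast
  note Sc = subgroup.mem_carrier[OF Ss(1)]
  have Cs: "subgroup C G" unfolding C_def by (rule subgroup_centI[OF subgroup_self]) (use Pc in blast)
  note Cc = subgroup.mem_carrier[OF Cs]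
  have Cfix: "cj G c w = w" if c: "c \<in> C" and w: "w \<in> P" for c w
  proof -
    have "c \<otimes> w = w \<otimes> c" using c w unfolding C_def by blast
    thus ?thesis using cj_fix_iff[OF Cc[OF c] Pc[OF w]] by simp
  qed
  have Cn: "nml G C"
  proof (rule nmlI[OF Cs])
    fix g c assume g: "g \<in> carrier G" and c: "c \<in> C"
    have cc: "c \<in> carrier G" using c Cc by blast
    have "cj G g c \<otimes> w = w \<otimes> cj G g c" if w: "w \<in> P" for w
    proof -
      have y: "cj G (inv g) w \<in> P" using nml_cj[OF P _ w] g by simp
      hence "c \<otimes> cj G (inv g) w = cj G (inv g) w \<otimes> c" using c unfolding C_def by blast
      hence "cj G g (c \<otimes> cj G (inv g) w) = cj G g (cj G (inv g) w \<otimes> c)" by simp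
      thus ?thesis using g w cc Pc by (simp add: cj_mult)
    qed
    thus "cj G g c \<in> C" using g cc by (simp add: C_def)
  qed
  show D: "subgroup (S \<inter> C) G" by (rule subgroups_Inter_pair[OF Ss(1) Cs])
  obtain d where d: "card (S \<inter> C) = p ^ d" using card_p_sub[OF D Ss(1) _ Ss(2) p] by blast
  interpret C: fin_group "G\<lparr>carrier := C\<rparr>" by (rule sub_fin_group[OF Cs])
  obtain R where R: "sylow_subgroup (G\<lparr>carrier := C\<rparr>) p R" using C.sylow_exists[OF p] by blast
  then obtain r where Rr: "subgroup R (G\<lparr>carrier := C\<rparr>)" "card R = p ^ r" using C.sylow_pgroup by blast
  have Rs: "subgroup R G" by (rule incl_subgroup[OF Cs Rr(1)])
  have RC: "R \<subseteq> C" using subgroup.subset[OF Rr(1)] by simp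
  obtain g where g: "g \<in> carrier G" "\<forall>r\<in>R. cj G g r \<in> S" using sylow_conj[OF p S Rs Rr(2)] by blast
  \<comment> \<open>A Sylow subgroup \<open>R\<close> of \<open>C\<close> can be moved into
    \<open>S\<close> and stays in the normal subgroup \<open>C\<close>, so
    \<open>S \<inter> C\<close> is at least as large.\<close>
  have "cj G g ` R \<subseteq> S \<inter> C" using g RC nml_cj[OF Cn g(1)] by blast
  hence "card (cj G g ` R) \<le> card (S \<inter> C)" using card_mono fin_sub[OF D] by blast
  moreover have "card (cj G g ` R) = card R"
    using card_image inj_on_subset[OF cj_inj[OF g(1)] subgroup.subset[OF Rs]] by blast
  ultimately have sy: "sylow_subgroup (G\<lparr>carrier := C\<rparr>) p (S \<inter> C)"
    using C.sylowI[OF p sub_sub[OF Cs D] d R] by auto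
  let ?R = "{z\<in>carrier G. cj G (inv b) z \<in> S \<inter> C}"
  have R': "subgroup ?R G" "card ?R = p ^ d" using vimage_cj[of "inv b", OF _ D] b d by auto
  have "?R \<subseteq> C"
  proof
    fix z assume z: "z \<in> ?R"
    hence "cj G b (cj G (inv b) z) \<in> C" using nml_cj[OF Cn b] by blast
    thus "z \<in> C" using z b by simp
  qed
  then obtain c where c: "c \<in> C" "\<forall>r\<in>?R. cj G c r \<in> S \<inter> C"
    using C.sylow_conj[OF p sy sub_sub[OF Cs R'(1)] R'(2)] cj_sub[OF Cs] by auto
  have cc: "c \<in> carrier G" using c Cc by blast
  have "b \<otimes> c \<in> nrm G (S \<inter> C)"
  proof -
    have "cj G (b \<otimes> c) x \<in> S \<inter> C" if x: "x \<in> S \<inter> C" for x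
    proof -
      have xc: "x \<in> carrier G" using x Sc by blast
      have "cj G b x \<in> ?R" using x b xc by simp
      hence "cj G c (cj G b x) \<in> S \<inter> C" using c by blast
      thus ?thesis using b cc xc by (simp add: cj_cj)
    qed
    thus ?thesis using b cc by (simp add: nrm_def)
  qed
  moreover have "cj G b x = cj G (b \<otimes> c) x" if x: "x \<in> P" for x
  proof -
    have "cj G c (cj G b x) = cj G b x" using Cfix[OF c(1) nml_cj[OF P b x]] .
    thus ?thesis using b cc Pc[OF x] by (simp add: cj_cj)
  qed
  ultimately show "\<exists>m\<in>nrm G (S \<inter> C). \<forall>x\<in>P. cj G b x = cj G m x" by blast
qed

end

section \<open>Control of fusion\<close>

context fin_group
begin

lemma nrm_conj:
  assumes "q \<in> carrier G" "Q \<subseteq> carrier G" "a \<in> nrm G Q"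
  shows "cj G q a \<in> nrm G (cj G q ` Q)"
proof -
  have ac: "a \<in> carrier G" using assms nrm_carrier by blast
  have "cj G (cj G q a) (cj G q x) \<in> cj G q ` Q" if x: "x \<in> Q" for x
  proof -
    have xc: "x \<in> carrier G" using x assms by blast
    have "cj G (cj G q a) (cj G q x) = cj G q (cj G a x)"
      using assms(1) ac xc by (simp add: cj_def m_assoc inv_mult_group inv_cancel)
    thus ?thesis using nrmD[OF assms(3) x] by blast
  qed
  thus ?thesis using assms(1) ac by (simp add: nrm_def)
qed

lemma cj_image_subgroup:
  assumes "g \<in> carrier G" "subgroup Q G"
  shows "subgroup (cj G g ` Q) G" "card (cj G g ` Q) = card Q"
proof -
  note Qc = subgroup.mem_carrier[OF assms(2)]
  have "cj G g ` Q = {z\<in>carrier G. cj G (inv g) z \<in> Q}"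
  proof
    show "cj G g ` Q \<subseteq> {z\<in>carrier G. cj G (inv g) z \<in> Q}" using Qc assms(1) by auto
    show "{z\<in>carrier G. cj G (inv g) z \<in> Q} \<subseteq> cj G g ` Q"
    proof
      fix z assume "z \<in> {z\<in>carrier G. cj G (inv g) z \<in> Q}"
      thus "z \<in> cj G g ` Q" using assms(1) by (intro image_eqI[of _ _ "cj G (inv g) z"]) auto
    qed
  qed
  thus "subgroup (cj G g ` Q) G" "card (cj G g ` Q) = card Q"
    using vimage_cj[OF inv_closed[OF assms(1)] assms(2)] by auto
qed

lemma cj_image_cj:
  assumes "g \<in> carrier G" "h \<in> carrier G" "Q \<subseteq> carrier G"
  shows "cj G h ` (cj G g ` Q) = cj G (g \<otimes> h) ` Q"
  using assms by (auto simp: image_image cj_cj subset_iff intro!: image_cong)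

lemma nrm_image:
  assumes "subgroup Q G" "g \<in> nrm G Q"
  shows "cj G g ` Q = Q"
proof (rule sub_eq[OF assms(1)])
  show "cj G g ` Q \<subseteq> Q" using nrmD[OF assms(2)] by blast
  show "card Q \<le> card (cj G g ` Q)" using cj_image_subgroup(2)[OF nrm_carrier[OF assms(2)] assms(1)] by simp
qed

text \<open>Among the conjugates \<open>Q\<close> of \<open>P\<close> inside \<open>S\<close>, take
  one whose normaliser in \<open>S\<close> is largest. A Sylow subgroup of the normaliser of
  \<open>Q\<close> in \<open>G\<close> contains \<open>Q\<close> and can be conjugated into
  \<open>S\<close>, where it normalises another such conjugate of \<open>P\<close>; so it cannot be
  larger.\<close>

lemma exists_fully_normalized:
  assumes p: "Factorial_Ring.prime p" and S: "sylow_subgroup G p S" and P: "subgroup P G" "P \<subseteq> S"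
  obtains t where "t \<in> carrier G" "cj G t ` P \<subseteq> S"
    "sylow_subgroup (G\<lparr>carrier := nrm G (cj G t ` P)\<rparr>) p (nrm G (cj G t ` P) \<inter> S)"
proof -
  obtain s where Ss: "subgroup S G" "card S = p ^ s" using sylow_pgroup[OF S] by blast
  have Pc: "P \<subseteq> carrier G" using subgroup.subset[OF P(1)] .
  define R where "R t \<longleftrightarrow> t \<in> carrier G \<and> cj G t ` P \<subseteq> S" for t
  have "cj G \<one> ` P = P" using Pc by (force simp: image_iff subset_iff)
  hence "R \<one>" using P(2) by (simp add: R_def)
  moreover have "\<forall>t. R t \<longrightarrow> card (nrm G (cj G t ` P) \<inter> S) < Suc (card S)"
    using card_mono[OF fin_sub[OF Ss(1)]] by (simp add: less_Suc_eq_le)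
  ultimately obtain t where t: "R t" "\<And>u. R u \<Longrightarrow> card (nrm G (cj G u ` P) \<inter> S) \<le> card (nrm G (cj G t ` P) \<inter> S)"
    using ex_has_greatest_nat[of R \<one> "\<lambda>t. card (nrm G (cj G t ` P) \<inter> S)" "Suc (card S)"] by blast
  have tc: "t \<in> carrier G" and tP: "cj G t ` P \<subseteq> S" using t(1) by (auto simp: R_def)
  let ?Q = "cj G t ` P"
  let ?L = "nrm G ?Q"
  have Qs: "subgroup ?Q G" using cj_image_subgroup[OF tc P(1)] by blast
  have Qc: "?Q \<subseteq> carrier G" using subgroup.subset[OF Qs] .
  have Ls: "subgroup ?L G" by (rule subgroup_nrm[OF Qc])
  have Lc: "\<And>s. s \<in> ?L \<Longrightarrow> s \<in> carrier G" using subgroup.mem_carrier[OF Ls] .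
  have NS: "subgroup (?L \<inter> S) G" by (rule subgroups_Inter_pair[OF Ls Ss(1)])
  interpret L: fin_group "G\<lparr>carrier := ?L\<rparr>" by (rule sub_fin_group[OF Ls])
  obtain c where c: "card (?L \<inter> S) = p ^ c" using card_p_sub[OF NS Ss(1) _ Ss(2) p] by blast
  obtain R0 where R0: "sylow_subgroup (G\<lparr>carrier := ?L\<rparr>) p R0" using L.sylow_exists[OF p] by blast
  then obtain r where r: "subgroup R0 (G\<lparr>carrier := ?L\<rparr>)" "card R0 = p ^ r" using L.sylow_pgroup by blast
  have R0s: "subgroup R0 G" by (rule incl_subgroup[OF Ls r(1)])
  have R0L: "R0 \<subseteq> ?L" using subgroup.subset[OF r(1)] by simp
  obtain q where q: "card ?Q = p ^ q" using card_p_sub[OF Qs Ss(1) tP Ss(2) p] by blast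
  have QL: "?Q \<subseteq> ?L" using sub_nrm[OF Qs] .
  have "nml (G\<lparr>carrier := ?L\<rparr>) ?Q"
    by (rule L.nmlI[OF sub_sub[OF Ls Qs QL]]) (use nrmD cj_sub[OF Ls] in auto)
  hence QR: "?Q \<subseteq> R0" using L.normal_in_sylow[OF p R0 _ q] by blast
  obtain g where g: "g \<in> carrier G" "\<forall>r\<in>R0. cj G g r \<in> S" using sylow_conj[OF p S R0s r(2)] by blast
  have im: "cj G g ` ?Q = cj G (t \<otimes> g) ` P" by (rule cj_image_cj[OF tc g(1) Pc])
  have "cj G g ` ?Q \<subseteq> S" using g(2) QR by blast
  hence "R (t \<otimes> g)" using g(1) tc im by (simp add: R_def)
  hence "card (nrm G (cj G g ` ?Q) \<inter> S) \<le> card (?L \<inter> S)" using t(2)[of "t \<otimes> g"] im by simp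
  moreover have "cj G g ` R0 \<subseteq> nrm G (cj G g ` ?Q) \<inter> S" using nrm_conj[OF g(1) Qc] R0L g(2) by blast
  hence "card (cj G g ` R0) \<le> card (nrm G (cj G g ` ?Q) \<inter> S)" using fin_sub[OF Ss(1)] by (intro card_mono) auto
  moreover have "card (cj G g ` R0) = card R0" using cj_image_subgroup(2)[OF g(1) R0s] .
  ultimately have "card R0 \<le> card (?L \<inter> S)" by simp
  hence "sylow_subgroup (G\<lparr>carrier := ?L\<rparr>) p (?L \<inter> S)"
    using L.sylowI[OF p sub_sub[OF Ls NS] c R0] by blast
  thus ?thesis using that[OF tc tP] by blast
qed

text \<open>The target of the reduction is a fully normalised conjugate \<open>R\<close> of
  \<open>P\<close>. The maps from \<open>P\<close> and from its image under \<open>g\<close> to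
  \<open>R\<close> are chosen to extend to the larger normalisers in \<open>S\<close>, so by
  induction they come from \<open>nrm G S\<close>. It remains to treat an element \<open>b\<close>
  normalising \<open>R\<close>, for which a Frattini argument again finds a larger domain.\<close>

theorem normalizer_controls_fusion:
  assumes p: "Factorial_Ring.prime p" and S: "sylow_subgroup G p S"
    and ch: "\<And>P. subgroup P G \<Longrightarrow> P \<subseteq> S \<Longrightarrow> \<forall>x\<in>S. (\<forall>w\<in>P. x \<otimes> w = w \<otimes> x) \<longrightarrow> x \<in> P
      \<Longrightarrow> rchain (G\<lparr>carrier := nrm G P\<rparr>) p {\<one>} P"
  shows "subgroup P G \<Longrightarrow> P \<subseteq> S \<Longrightarrow> g \<in> carrier G \<Longrightarrow> cj G g ` P \<subseteq> S \<Longrightarrow> \<exists>n\<in>nrm G S. \<forall>x\<in>P. cj G g x = cj G n x"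
proof (induction "card S - card P" arbitrary: P g rule: less_induct)
  case less
  note Ps = less.prems(1) and PS = less.prems(2) and gc = less.prems(3) and gP = less.prems(4)
  obtain s where Ss: "subgroup S G" "card S = p ^ s" using sylow_pgroup[OF S] by blast
  note Sc = subgroup.mem_carrier[OF Ss(1)]
  have NSs: "subgroup (nrm G S) G" by (rule subgroup_nrm[OF subgroup.subset[OF Ss(1)]])
  have NSc: "\<And>s. s \<in> nrm G S \<Longrightarrow> s \<in> carrier G" using nrm_carrier by blast
  note Pc = subgroup.mem_carrier[OF Ps]
  have IH: "\<exists>n\<in>nrm G S. \<forall>x\<in>A. cj G h x = cj G n x"
    if A: "subgroup A G" "A \<subseteq> S" "card P < card A" "h \<in> carrier G" "cj G h ` A \<subseteq> S" for A h
  proof -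
    have "card A \<le> card S" using card_mono[OF fin_sub[OF Ss(1)] A(2)] .
    hence "card S - card A < card S - card P" using A(3) by simp
    thus ?thesis using less.hyps A by blast
  qed
  show ?case
  proof (cases "P = S")
    case True
    hence "g \<in> nrm G S" using gP gc by (auto simp: nrm_def)
    thus ?thesis by blast
  next
    case False
    hence cPS: "card P < card S" using card_proper[OF Ss(1)] PS by blast
    obtain t where t: "t \<in> carrier G" "cj G t ` P \<subseteq> S"
      "sylow_subgroup (G\<lparr>carrier := nrm G (cj G t ` P)\<rparr>) p (nrm G (cj G t ` P) \<inter> S)"
      by (rule exists_fully_normalized[OF p S Ps PS]) (rule that)
    define R where "R = cj G t ` P"
    define L where "L = nrm G R"
    have Rs: "subgroup R G" and cR: "card R = card P" using cj_image_subgroup[OF t(1) Ps] by (auto simp: R_def)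
    have RS: "R \<subseteq> S" using t(2) by (simp add: R_def)
    note Rc = subgroup.mem_carrier[OF Rs]
    have Ls: "subgroup L G" unfolding L_def by (rule subgroup_nrm[OF subgroup.subset[OF Rs]])
    note Lc = subgroup.mem_carrier[OF Ls]
    have SL: "sylow_subgroup (G\<lparr>carrier := L\<rparr>) p (L \<inter> S)" using t(3) by (simp add: L_def R_def)
    interpret L: fin_group "G\<lparr>carrier := L\<rparr>" by (rule sub_fin_group[OF Ls])
    have RL: "R \<subseteq> L" unfolding L_def by (rule sub_nrm[OF Rs])
    have Rn: "nml (G\<lparr>carrier := L\<rparr>) R"
      by (rule L.nmlI[OF sub_sub[OF Ls Rs RL]]) (use nrmD cj_sub[OF Ls] in \<open>auto simp: L_def\<close>)
    have big: "subgroup (nrm G Q \<inter> S) G \<and> Q \<subset> nrm G Q \<inter> S \<and> card P < card (nrm G Q \<inter> S)"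
      if Q: "subgroup Q G" "Q \<subseteq> S" "card Q = card P" for Q
    proof -
      have s: "subgroup (nrm G Q \<inter> S) G"
        by (rule subgroups_Inter_pair[OF subgroup_nrm[OF subgroup.subset[OF Q(1)]] Ss(1)])
      have "Q \<subset> S" using Q cPS by auto
      hence "Q \<subset> nrm G Q \<inter> S" using normalizer_growth[OF Q(1) Ss(1) _ Ss(2) p] sub_nrm[OF Q(1)] Q(2) by blast
      thus ?thesis using s card_proper[OF s \<open>Q \<subset> nrm G Q \<inter> S\<close>] Q(3) by simp
    qed
    \<comment> \<open>An element \<open>l\<close> normalising \<open>R\<close> corrects
      \<open>q\<close> so that the whole normaliser of \<open>Q\<close> in \<open>S\<close> is
      carried into \<open>S\<close>; the induction hypothesis applies to that larger
      subgroup.\<close>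
    have to_R: "\<exists>h\<in>carrier G. cj G h ` Q = R \<and> (\<exists>n\<in>nrm G S. \<forall>x\<in>Q. cj G h x = cj G n x)"
      if Q: "subgroup Q G" "Q \<subseteq> S" "card Q = card P" "q \<in> carrier G" "cj G q ` Q = R" for Q q
    proof -
      let ?A = "nrm G Q \<inter> S"
      have A: "subgroup ?A G" "Q \<subset> ?A" "card P < card ?A" using big[OF Q(1-3)] by auto
      obtain a where a: "card ?A = p ^ a" using card_p_sub[OF A(1) Ss(1) _ Ss(2) p] by blast
      have Qc: "Q \<subseteq> carrier G" using subgroup.subset[OF Q(1)] .
      have qA: "cj G q ` ?A \<subseteq> L" using nrm_conj[OF Q(4) Qc] Q(5) by (auto simp: L_def)
      have qAs: "subgroup (cj G q ` ?A) G" "card (cj G q ` ?A) = p ^ a" using cj_image_subgroup[OF Q(4) A(1)] a by auto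
      obtain l where l: "l \<in> L" "\<forall>r\<in>cj G q ` ?A. cj G l r \<in> L \<inter> S"
        using L.sylow_conj[OF p SL sub_sub[OF Ls qAs(1) qA] qAs(2)] cj_sub[OF Ls] by auto
      have lc: "l \<in> carrier G" using l Lc by blast
      have hc: "q \<otimes> l \<in> carrier G" using Q(4) lc by simp
      have "cj G l ` (cj G q ` ?A) \<subseteq> S" using l(2) by blast
      hence "cj G (q \<otimes> l) ` ?A \<subseteq> S" using cj_image_cj[OF Q(4) lc subgroup.subset[OF A(1)]] by simp
      then obtain n where n: "n \<in> nrm G S" "\<forall>x\<in>?A. cj G (q \<otimes> l) x = cj G n x" using IH[OF A(1) _ A(3) hc] by blast
      have "cj G (q \<otimes> l) ` Q = cj G l ` R" using cj_image_cj[OF Q(4) lc Qc] Q(5) by simp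
      also have "\<dots> = R" using nrm_image[OF Rs] l(1) by (simp add: L_def)
      finally show ?thesis using hc n A(2) by blast
    qed
    obtain h1 n1 where h1: "h1 \<in> carrier G" "cj G h1 ` P = R" "n1 \<in> nrm G S" "\<And>x. x \<in> P \<Longrightarrow> cj G h1 x = cj G n1 x"
      using to_R[OF Ps PS refl t(1)] R_def by blast
    let ?Q = "cj G g ` P"
    have Qs: "subgroup ?Q G" "card ?Q = card P" using cj_image_subgroup[OF gc Ps] by auto
    have "cj G (inv g \<otimes> t) ` ?Q = cj G (g \<otimes> (inv g \<otimes> t)) ` P"
      by (rule cj_image_cj[OF gc _ subgroup.subset[OF Ps]]) (use gc t(1) in simp)
    hence gtQ: "cj G (inv g \<otimes> t) ` ?Q = R" using gc t(1) by (simp add: inv_cancel R_def)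
    have gt: "inv g \<otimes> t \<in> carrier G" using gc t(1) by simp
    obtain h2 n2 where h2: "h2 \<in> carrier G" "cj G h2 ` ?Q = R" "n2 \<in> nrm G S" "\<And>x. x \<in> ?Q \<Longrightarrow> cj G h2 x = cj G n2 x"
      using to_R[OF Qs(1) gP Qs(2) gt gtQ] by blast
    define b where "b = inv h1 \<otimes> (g \<otimes> h2)"
    have bc: "b \<in> carrier G" using h1 h2 gc by (simp add: b_def)
    have bR: "cj G b ` R = R"
    proof -
      have gh: "g \<otimes> h2 \<in> carrier G" using gc h2(1) by simp
      have "cj G (inv h1) ` R = P"
        using h1(1,2) Pc by (force simp: image_image image_iff)
      hence "cj G b ` R = cj G (g \<otimes> h2) ` P"
        unfolding b_def using cj_image_cj[OF inv_closed[OF h1(1)] gh subgroup.subset[OF Rs]] by simp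
      also have "\<dots> = R" using cj_image_cj[OF gc h2(1) subgroup.subset[OF Ps]] h2(2) by simp
      finally show ?thesis .
    qed
    hence bL: "b \<in> L" using bc by (auto simp: L_def nrm_def)
    have bigR: "subgroup (L \<inter> S) G" "R \<subset> L \<inter> S" "card P < card (L \<inter> S)" using big[OF Rs RS cR] by (auto simp: L_def)
    \<comment> \<open>If \<open>R\<close> contains its centraliser in \<open>S\<close>, then on
      \<open>R\<close> the element \<open>b\<close> acts like one that normalises
      \<open>L \<inter> S\<close>, the normaliser of \<open>R\<close> in \<open>S\<close>. Otherwise
      it acts like one that normalises \<open>?D\<close>, the centraliser of \<open>R\<close> in
      \<open>S\<close>.\<close>
    have "\<exists>n\<in>nrm G S. \<forall>x\<in>R. cj G b x = cj G n x"
    proof (cases "\<forall>x\<in>S. (\<forall>w\<in>R. x \<otimes> w = w \<otimes> x) \<longrightarrow> x \<in> R")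
      case True
      have "rchain (G\<lparr>carrier := L\<rparr>) p {\<one>} R" unfolding L_def by (rule ch[OF Rs RS True])
      then obtain m where m: "m \<in> nrm (G\<lparr>carrier := L\<rparr>) (L \<inter> S)" "\<forall>x\<in>R. cj (G\<lparr>carrier := L\<rparr>) b x = cj (G\<lparr>carrier := L\<rparr>) m x"
        using L.frattini_rchain[OF p SL, of R b] bL by auto
      have m': "m \<in> nrm G (L \<inter> S)" "m \<in> L" using m(1) nrm_sub[OF subgroup.subset[OF Ls] Ls, of "L \<inter> S"] by auto
      have "cj G m ` (L \<inter> S) \<subseteq> S" using nrmD[OF m'(1)] by blast
      then obtain n where n: "n \<in> nrm G S" "\<forall>x\<in>L \<inter> S. cj G m x = cj G n x" using IH[OF bigR(1) _ bigR(3)] m'(2) Lc by blast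
      have "cj G b x = cj G n x" if x: "x \<in> R" for x
      proof -
        have "cj G b x = cj G m x" using m(2) x cj_sub[OF Ls bL] cj_sub[OF Ls m'(2)] by simp
        thus ?thesis using n(2) x bigR(2) by auto
      qed
      thus ?thesis using n(1) by blast
    next
      case False
      then obtain z where z: "z \<in> S" "\<And>w. w \<in> R \<Longrightarrow> z \<otimes> w = w \<otimes> z" "z \<notin> R" by blast
      let ?C = "{g\<in>L. \<forall>w\<in>R. g \<otimes> w = w \<otimes> g}"
      let ?D = "L \<inter> S \<inter> ?C"
      have D: "subgroup ?D (G\<lparr>carrier := L\<rparr>)" and ex: "\<exists>m\<in>nrm (G\<lparr>carrier := L\<rparr>) ?D. \<forall>x\<in>R. cj (G\<lparr>carrier := L\<rparr>) b x = cj (G\<lparr>carrier := L\<rparr>) m x"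
        using L.frattini_centralizer[OF p SL Rn, of b] bL by auto
      have Ds: "subgroup ?D G" by (rule incl_subgroup[OF Ls D])
      have Dc: "\<And>s. s \<in> ?D \<Longrightarrow> s \<in> carrier G" using subgroup.mem_carrier[OF Ds] .
      obtain m where m: "m \<in> nrm (G\<lparr>carrier := L\<rparr>) ?D" "\<forall>x\<in>R. cj (G\<lparr>carrier := L\<rparr>) b x = cj (G\<lparr>carrier := L\<rparr>) m x" using ex by blast
      have m': "m \<in> nrm G ?D" "m \<in> L" using m(1) nrm_sub[OF subgroup.subset[OF Ls] Ls, of ?D] by auto
      have mc: "m \<in> carrier G" using m' Lc by blast
      have comm: "d \<otimes> w = w \<otimes> d" if "d \<in> ?D" "w \<in> R" for d w using that by blast
      \<comment> \<open>As \<open>R\<close> and \<open>?D\<close> commute elementwise, their product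
        is a group. It contains \<open>z\<close> and so exceeds \<open>R\<close>, and
        \<open>m\<close> carries both factors into \<open>S\<close>.\<close>
      define E where "E = {w \<otimes> d |w d. w \<in> R \<and> d \<in> ?D}"
      have Es: "subgroup E G"
      proof (rule fin_subgroupI)
        show "E \<subseteq> carrier G" using Rc Dc unfolding E_def by blast
        have "\<one> \<otimes> \<one> \<in> E" using subgroup.one_closed[OF Rs] subgroup.one_closed[OF Ds] unfolding E_def by blast
        thus "\<one> \<in> E" by simp
        fix x y assume "x \<in> E" "y \<in> E"
        then obtain w d w' d' where xy: "x = w \<otimes> d" "y = w' \<otimes> d'" "w \<in> R" "w' \<in> R" "d \<in> ?D" "d' \<in> ?D" unfolding E_def by blast
        have c: "w \<in> carrier G" "w' \<in> carrier G" "d \<in> carrier G" "d' \<in> carrier G"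
          using Rc[OF xy(3)] Rc[OF xy(4)] Dc[OF xy(5)] Dc[OF xy(6)] by auto
        have "x \<otimes> y = w \<otimes> (d \<otimes> w') \<otimes> d'" unfolding xy(1,2) using c by (simp add: m_assoc)
        also have "d \<otimes> w' = w' \<otimes> d" by (rule comm[OF xy(5,4)])
        also have "w \<otimes> (w' \<otimes> d) \<otimes> d' = (w \<otimes> w') \<otimes> (d \<otimes> d')" using c by (simp add: m_assoc)
        finally show "x \<otimes> y \<in> E" using subgroup.m_closed[OF Rs xy(3,4)] subgroup.m_closed[OF Ds xy(5,6)] unfolding E_def by blast
      qed
      have RE: "R \<subseteq> E"
      proof
        fix w assume w: "w \<in> R"
        have "w \<otimes> \<one> \<in> E" using w subgroup.one_closed[OF Ds] unfolding E_def by blast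
        thus "w \<in> E" using Rc[OF w] by simp
      qed
      have zE: "z \<in> E"
      proof -
        have zc: "z \<in> carrier G" using z Sc by blast
        have "cj G z w = w" if w: "w \<in> R" for w using cj_fix_iff[OF zc Rc[OF w]] z(2)[OF w] by simp
        hence "z \<in> L" using zc unfolding L_def nrm_def by simp
        hence "z \<in> ?D" using z by blast
        hence "\<one> \<otimes> z \<in> E" using subgroup.one_closed[OF Rs] unfolding E_def by blast
        thus ?thesis using zc by simp
      qed
      have ES: "E \<subseteq> S" using RS subgroup.m_closed[OF Ss(1)] unfolding E_def by blast
      have "card P < card E" using card_proper[OF Es, of R] RE zE z(3) cR by auto
      moreover have "cj G m ` E \<subseteq> S"
      proof
        fix y assume "y \<in> cj G m ` E"
        then obtain w d where wd: "y = cj G m (w \<otimes> d)" "w \<in> R" "d \<in> ?D" unfolding E_def by blast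
        have "cj G m w \<in> S" using nrmD m'(2) wd(2) RS unfolding L_def by blast
        moreover have "cj G m d \<in> S" using nrmD[OF m'(1) wd(3)] by blast
        ultimately show "y \<in> S" using wd mc Rc[OF wd(2)] Dc[OF wd(3)] subgroup.m_closed[OF Ss(1)] by (simp add: cj_mult)
      qed
      ultimately obtain n where n: "n \<in> nrm G S" "\<forall>x\<in>E. cj G m x = cj G n x" using IH[OF Es ES _ mc] by blast
      have "cj G b x = cj G n x" if x: "x \<in> R" for x
      proof -
        have "cj G b x = cj G m x" using m(2) x cj_sub[OF Ls bL] cj_sub[OF Ls m'(2)] by simp
        thus ?thesis using n(2) x RE by auto
      qed
      thus ?thesis using n(1) by blast
    qed
    then obtain n where n: "n \<in> nrm G S" "\<And>x. x \<in> R \<Longrightarrow> cj G b x = cj G n x" by blast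
    have nc: "n \<in> carrier G" "n1 \<in> carrier G" "n2 \<in> carrier G" using n(1) h1(3) h2(3) NSc by auto
    have "cj G g x = cj G (n1 \<otimes> n \<otimes> inv n2) x" if x: "x \<in> P" for x
    proof -
      have xc: "x \<in> carrier G" using x Pc by blast
      have "cj G b (cj G h1 x) = cj G h2 (cj G g x)" using xc h1(1) h2(1) gc by (simp add: b_def cj_cj inv_cancel)
      moreover have "cj G h2 (cj G g x) = cj G n2 (cj G g x)" using h2(4) x by blast
      moreover have "cj G b (cj G h1 x) = cj G n (cj G n1 x)" using n(2)[of "cj G h1 x"] h1(2,4) x by auto
      ultimately have "cj G n2 (cj G g x) = cj G n (cj G n1 x)" by simp
      hence "cj G g x = cj G (inv n2) (cj G n (cj G n1 x))" using nc xc gc by (metis cj_inv_cj cj_closed)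
      thus ?thesis using nc xc by (simp add: cj_cj m_assoc)
    qed
    moreover have "n1 \<otimes> n \<otimes> inv n2 \<in> nrm G S"
      using subgroup.m_closed[OF NSs subgroup.m_closed[OF NSs h1(3) n(1)] subgroup.m_inv_closed[OF NSs h2(3)]] .
    ultimately show ?thesis by blast
  qed
qed

section \<open>The series of strongly closed subgroups\<close>

lemma rchain_series:
  "rchain G p R P \<Longrightarrow> \<exists>(n::nat) T. T 0 = R \<and> T n = P \<and> (\<forall>i\<le>n. nml G (T i)) \<and>
     (\<forall>i<n. T i \<subseteq> T (Suc i) \<and> card (T (Suc i)) = p * card (T i))"
proof (induction rule: rchain.induct)
  case rchain_base
  thus ?case by (intro exI[of _ 0] exI[of _ "\<lambda>_. R"]) simp
next
  case (rchain_step A B)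
  then obtain n :: nat and T where T: "T 0 = R" "T n = A" "\<forall>i\<le>n. nml G (T i)" "\<forall>i<n. T i \<subseteq> T (Suc i) \<and> card (T (Suc i)) = p * card (T i)" by blast
  show ?case
    by (rule exI[of _ "Suc n"], rule exI[of _ "T(Suc n := B)"])
      (use T rchain_step.hyps in \<open>auto simp: le_Suc_eq less_Suc_eq\<close>)
qed

theorem supersolvable_fusionI:
  fixes p :: nat
  assumes "Factorial_Ring.prime p" and "sylow_subgroup G p S" and "subgroup D G" and "D \<subset> S"
    and "\<And>H. subgroup H G \<Longrightarrow> H \<subseteq> S \<Longrightarrow> card H = card D \<or> card H = p * card D \<Longrightarrow>
           comm_group (G\<lparr>carrier := H\<rparr>) \<and> weakly_SPhi_supplemented G H"
    and "\<And>C. \<not> comm_group (G\<lparr>carrier := S\<rparr>) \<Longrightarrow> \<exists>k. card S = 2 ^ k \<Longrightarrow> card D = 1 \<Longrightarrow>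
           subgroup C G \<Longrightarrow> cyclic_group (G\<lparr>carrier := C\<rparr>) \<Longrightarrow> card C = 4 \<Longrightarrow>
           weakly_SPhi_supplemented G C"
  shows "supersolvable_fusion (G\<lparr>carrier := S\<rparr>) (fusion_system G S)"
proof -
  note p = assms(1) and S = assms(2)
  obtain s where Ss: "subgroup S G" "card S = p ^ s" using sylow_pgroup[OF S] by blast
  note Sc = subgroup.mem_carrier[OF Ss(1)]
  obtain d where d: "card D = p ^ d" using card_p_sub[OF assms(3) Ss(1) _ Ss(2) p] assms(4) by blast
  have "p ^ d < p ^ s" using card_proper[OF Ss(1) assms(4)] d Ss(2) by simp
  hence ds: "d < s" using prime_gt_1_nat[OF p] by simp
  have hyp: "a \<otimes> b = b \<otimes> a" "weakly_SPhi_supplemented G H"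
    if H: "subgroup H G" "H \<subseteq> S" "card H = p ^ d \<or> card H = p ^ Suc d" "a \<in> H" "b \<in> H" for H a b
  proof -
    have h: "comm_group (G\<lparr>carrier := H\<rparr>)" "weakly_SPhi_supplemented G H" using assms(5)[OF H(1,2)] H(3) d by auto
    show "weakly_SPhi_supplemented G H" by fact
    interpret H: comm_group "G\<lparr>carrier := H\<rparr>" by fact
    show "a \<otimes> b = b \<otimes> a" using H.m_comm[of a b] H(4,5) by simp
  qed
  have wss: "weakly_SPhi_supplemented G H" if H: "subgroup H G" "H \<subseteq> S" "card H = p ^ d \<or> card H = p ^ Suc d" for H
    using hyp(2)[OF H] subgroup.one_closed[OF H(1)] by blast
  have ch: "rchain (G\<lparr>carrier := nrm G P\<rparr>) p {\<one>} P"
    if P: "subgroup P G" "P \<subseteq> S" and cen: "\<forall>x\<in>S. (\<forall>w\<in>P. x \<otimes> w = w \<otimes> x) \<longrightarrow> x \<in> P" for P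
  proof -
    obtain n where n: "card P = p ^ n" "n \<le> s" using card_p_sub[OF P(1) Ss(1) P(2) Ss(2) p] by blast
    note Pc = subgroup.mem_carrier[OF P(1)]
    \<comment> \<open>If \<open>card P \<le> card D\<close>, some \<open>H\<close> of order
      \<open>p ^ Suc d\<close> with \<open>P \<subseteq> H \<subseteq> S\<close> is abelian, so it
      centralises \<open>P\<close> and lies in \<open>P\<close> by \<open>cen\<close>, which
      contradicts the orders.\<close>
    have dn: "d < n"
    proof (rule ccontr)
      assume "\<not> d < n"
      hence "n \<le> Suc d" "Suc d \<le> s" using ds by auto
      then obtain H where H: "subgroup H G" "P \<subseteq> H" "H \<subseteq> S" "card H = p ^ Suc d"
        using step_between[OF P(1) Ss(1) P(2) n(1) Ss(2) p] by blast
      have "H \<subseteq> P"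
      proof
        fix x assume x: "x \<in> H"
        have xS: "x \<in> S" using x H(3) by blast
        have "\<forall>w\<in>P. x \<otimes> w = w \<otimes> x" using hyp(1)[OF H(1,3) _ x] H(2,4) by blast
        thus "x \<in> P" using cen xS by blast
      qed
      hence "p ^ Suc d = p ^ n" using H(2,4) n(1) by auto
      hence "Suc d = n" using prime_gt_1_nat[OF p] power_inject_exp by blast
      thus False using \<open>\<not> d < n\<close> by simp
    qed
    let ?L = "nrm G P"
    have Ls: "subgroup ?L G" by (rule subgroup_nrm[OF subgroup.subset[OF P(1)]])
    have PL: "P \<subseteq> ?L" by (rule sub_nrm[OF P(1)])
    interpret L: fin_group "G\<lparr>carrier := ?L\<rparr>" by (rule sub_fin_group[OF Ls])
    have Pn: "nml (G\<lparr>carrier := ?L\<rparr>) P"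
      by (rule L.nmlI[OF sub_sub[OF Ls P(1) PL]]) (use nrmD cj_sub[OF Ls] in auto)
    have psL: "psup (G\<lparr>carrier := ?L\<rparr>) p H" if H: "subgroup H (G\<lparr>carrier := ?L\<rparr>)" "H \<subseteq> P" "weakly_SPhi_supplemented G H" for H
    proof -
      have Hs: "subgroup H G" by (rule incl_subgroup[OF Ls H(1)])
      obtain h where "card H = p ^ h" using card_p_sub[OF Hs P(1) H(2) n(1) p] by blast
      thus ?thesis using wss_psup[OF p Hs _ Ls _ H(3)] H(2) PL by blast
    qed
    show ?thesis
    proof (cases "d = 0")
      case False
      have "hypd (G\<lparr>carrier := ?L\<rparr>) p d P"
        unfolding hypd_def
      proof (intro allI impI)
        fix H assume H: "subgroup H (G\<lparr>carrier := ?L\<rparr>)" "H \<subseteq> P" "card H = p ^ d \<or> card H = p ^ Suc d"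
        have Hs: "subgroup H G" by (rule incl_subgroup[OF Ls H(1)])
        have HS: "H \<subseteq> S" using H(2) P(2) by blast
        have "a \<otimes> b = b \<otimes> a" if "a \<in> H" "b \<in> H" for a b by (rule hyp(1)[OF Hs HS H(3) that])
        moreover have "psup (G\<lparr>carrier := ?L\<rparr>) p H" using psL[OF H(1,2)] wss[OF Hs HS H(3)] by blast
        ultimately show "(\<forall>a\<in>H. \<forall>b\<in>H. a \<otimes>\<^bsub>G\<lparr>carrier := ?L\<rparr>\<^esub> b = b \<otimes>\<^bsub>G\<lparr>carrier := ?L\<rparr>\<^esub> a) \<and> psup (G\<lparr>carrier := ?L\<rparr>) p H" by simp
      qed
      thus ?thesis using hypd_rchain[OF p L.fin_group_axioms Pn n(1) _ dn] False by simp
    next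
      case True
      have "rchain (G\<lparr>carrier := ?L\<rparr>) p {\<one>\<^bsub>G\<lparr>carrier := ?L\<rparr>\<^esub>} P"
      proof (rule L.order_p_rchain[OF p Pn n(1)])
        fix H assume H: "subgroup H (G\<lparr>carrier := ?L\<rparr>)" "H \<subseteq> P" "card H = p"
        have Hs: "subgroup H G" by (rule incl_subgroup[OF Ls H(1)])
        have "weakly_SPhi_supplemented G H" by (rule wss[OF Hs]) (use H(2,3) P(2) True in auto)
        thus "psup (G\<lparr>carrier := ?L\<rparr>) p H" using psL[OF H(1,2)] by blast
      next
        assume p2: "p = 2"
        show "(\<forall>a\<in>P. \<forall>b\<in>P. a \<otimes>\<^bsub>G\<lparr>carrier := ?L\<rparr>\<^esub> b = b \<otimes>\<^bsub>G\<lparr>carrier := ?L\<rparr>\<^esub> a) \<or>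
          (\<forall>x\<in>P. card (cyc (G\<lparr>carrier := ?L\<rparr>) x) = 4 \<longrightarrow> psup (G\<lparr>carrier := ?L\<rparr>) p (cyc (G\<lparr>carrier := ?L\<rparr>) x))"
        proof (cases "\<forall>a\<in>P. \<forall>b\<in>P. a \<otimes> b = b \<otimes> a")
          case False
          have nc: "\<not> comm_group (G\<lparr>carrier := S\<rparr>)"
          proof
            assume "comm_group (G\<lparr>carrier := S\<rparr>)"
            then interpret C: comm_group "G\<lparr>carrier := S\<rparr>" .
            have "a \<otimes> b = b \<otimes> a" if "a \<in> P" "b \<in> P" for a b using C.m_comm[of a b] that P(2) by auto
            thus False using False by blast
          qed
          have "psup (G\<lparr>carrier := ?L\<rparr>) p (cyc G x)" if x: "x \<in> P" "card (cyc G x) = 4" for x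
          proof -
            have xc: "x \<in> carrier G" using x Pc by blast
            have cs: "subgroup (cyc G x) G" by (rule cyc_subgroup[OF xc])
            have cP: "cyc G x \<subseteq> P" by (rule cyc_least[OF P(1) x(1)])
            interpret C: fin_group "G\<lparr>carrier := cyc G x\<rparr>" by (rule sub_fin_group[OF cs])
            have "cyclic_group (G\<lparr>carrier := cyc G x\<rparr>)"
              unfolding C.cyclic_group
            proof (rule bexI[of _ x])
              show "x \<in> carrier (G\<lparr>carrier := cyc G x\<rparr>)" using cyc_self[OF xc] by simp
              have "range (\<lambda>i::int. x [^]\<^bsub>G\<lparr>carrier := cyc G x\<rparr>\<^esub> i) \<subseteq> cyc G x"
                using C.int_pow_closed[of x] cyc_self[OF xc] by auto
              moreover have "cyc G x \<subseteq> range (\<lambda>i::int. x [^]\<^bsub>G\<lparr>carrier := cyc G x\<rparr>\<^esub> i)"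
              proof
                fix y assume "y \<in> cyc G x"
                then obtain i :: nat where "y = x [^] i" by (auto simp: cyc_def)
                hence "y = x [^]\<^bsub>G\<lparr>carrier := cyc G x\<rparr>\<^esub> (int i)" by (simp add: int_pow_int flip: nat_pow_consistent)
                thus "y \<in> range (\<lambda>i::int. x [^]\<^bsub>G\<lparr>carrier := cyc G x\<rparr>\<^esub> i)" by blast
              qed
              ultimately show "carrier (G\<lparr>carrier := cyc G x\<rparr>) = range (\<lambda>i::int. x [^]\<^bsub>G\<lparr>carrier := cyc G x\<rparr>\<^esub> i)" by simp
            qed
            moreover have "\<exists>k. card S = 2 ^ k" using Ss(2) p2 by blast
            moreover have "card D = 1" using d True by simp
            ultimately have "weakly_SPhi_supplemented G (cyc G x)" using assms(6)[OF nc _ _ cs] x(2) by blast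
            thus ?thesis using psL[OF sub_sub[OF Ls cs]] cP PL by blast
          qed
          moreover have "cyc (G\<lparr>carrier := ?L\<rparr>) x = cyc G x" for x by (simp add: cyc_def flip: nat_pow_consistent)
          ultimately show ?thesis by simp
        qed simp
      qed
      thus ?thesis by simp
    qed
  qed
  have ctl: "\<exists>n\<in>nrm G S. \<forall>x\<in>P. cj G g x = cj G n x"
    if "subgroup P G" "P \<subseteq> S" "g \<in> carrier G" "cj G g ` P \<subseteq> S" for P g
    by (rule normalizer_controls_fusion[OF p S _ that]) (rule ch)
  let ?L = "nrm G S"
  have Ls: "subgroup ?L G" by (rule subgroup_nrm[OF subgroup.subset[OF Ss(1)]])
  interpret L: fin_group "G\<lparr>carrier := ?L\<rparr>" by (rule sub_fin_group[OF Ls])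
  \<comment> \<open>\<open>S\<close> trivially contains its own centraliser in
    \<open>S\<close>.\<close>
  have "rchain (G\<lparr>carrier := ?L\<rparr>) p {\<one>} S" by (rule ch[OF Ss(1)]) auto
  from L.rchain_series[OF this] obtain n :: nat and T where T: "T 0 = {\<one>}" "T n = S"
    "\<forall>i\<le>n. nml (G\<lparr>carrier := ?L\<rparr>) (T i)" "\<forall>i<n. T i \<subseteq> T (Suc i) \<and> card (T (Suc i)) = p * card (T i)" by blast
  have Ts: "subgroup (T i) G" if "i \<le> n" for i
    using incl_subgroup[OF Ls L.nml_subgroup] T(3) that by blast
  have TS: "T i \<subseteq> S" if "i \<le> n" for i
    using that
  proof (induction "n - i" arbitrary: i)
    case 0
    thus ?case using T(2) by simp
  next
    case (Suc k)
    hence "i < n" "k = n - Suc i" by auto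
    thus ?case using Suc.hyps(1)[of "Suc i"] T(4) by auto
  qed
  have sc: "strongly_closed (G\<lparr>carrier := S\<rparr>) (fusion_system G S) (T i)" if i: "i \<le> n" for i
    unfolding strongly_closed_def
  proof (intro conjI allI impI ballI)
    show "subgroup (T i) (G\<lparr>carrier := S\<rparr>)" by (rule sub_sub[OF Ss(1) Ts[OF i] TS[OF i]])
    fix P \<phi> assume P: "P \<subseteq> T i" and "\<phi> \<in> fusion_system G S P (carrier (G\<lparr>carrier := S\<rparr>))"
    then obtain g where g: "subgroup P G" "P \<subseteq> S" "g \<in> carrier G" "\<phi> = (\<lambda>x\<in>P. inv g \<otimes> x \<otimes> g)" "\<phi> ` P \<subseteq> S"
      by (auto simp: fusion_system_def)
    have e: "\<phi> x = cj G g x" if "x \<in> P" for x using g(4) that by (simp add: cj_def)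
    hence "cj G g ` P \<subseteq> S" using g(5) by auto
    then obtain m where m: "m \<in> ?L" "\<forall>x\<in>P. cj G g x = cj G m x" using ctl[OF g(1-3)] by blast
    show "\<phi> ` P \<subseteq> T i"
    proof
      fix y assume "y \<in> \<phi> ` P"
      then obtain x where x: "x \<in> P" "y = cj G m x" using e m(2) by auto
      have "cj (G\<lparr>carrier := ?L\<rparr>) m x \<in> T i" using L.nml_cj[of "T i" m x] T(3) i m(1) x(1) P by auto
      thus "y \<in> T i" using x(2) cj_sub[OF Ls m(1)] by simp
    qed
  qed
  have cy: "cyclic_group (G\<lparr>carrier := T (Suc i)\<rparr> Mod T i)" if i: "i < n" for i
  proof -
    have s: "subgroup (T i) G" "subgroup (T (Suc i)) G" "T (Suc i) \<subseteq> S" using Ts TS i by auto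
    obtain b where "card (T (Suc i)) = p ^ b" using card_p_sub[OF s(2) Ss(1) s(3) Ss(2) p] by blast
    thus ?thesis using index_p_quotient(1)[OF s(1,2)] T(4) i p by blast
  qed
  show ?thesis
    unfolding supersolvable_fusion_def
    by (rule exI[of _ n], rule exI[of _ T]) (use T(1,2,4) sc cy in simp)
qed

end

theorem theorem3p26:
  fixes G :: "('a, 'b) monoid_scheme" and p :: nat and S D :: "'a set"
  assumes "group G" and "finite (carrier G)"
    and "Factorial_Ring.prime p" and "p dvd Coset.order G"
    and "sylow_subgroup G p S"
    and "subgroup D G" and "D \<subset> S"
    and "\<And>H. subgroup H G \<Longrightarrow> H \<subseteq> S \<Longrightarrow> card H = card D \<or> card H = p * card D \<Longrightarrow>
           comm_group (G\<lparr>carrier := H\<rparr>) \<and> weakly_SPhi_supplemented G H"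
    and "\<And>C. \<not> comm_group (G\<lparr>carrier := S\<rparr>) \<Longrightarrow> \<exists>k. card S = 2 ^ k \<Longrightarrow> card D = 1 \<Longrightarrow>
           subgroup C G \<Longrightarrow> cyclic_group (G\<lparr>carrier := C\<rparr>) \<Longrightarrow> card C = 4 \<Longrightarrow>
           weakly_SPhi_supplemented G C"
  shows "supersolvable_fusion (G\<lparr>carrier := S\<rparr>) (fusion_system G S)"
proof -
  interpret fin_group G using assms(1,2) by (simp add: fin_group_def fin_group_axioms_def)
  show ?thesis by (rule supersolvable_fusionI[OF assms(3,5-9)])
qed

end
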